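(* Consider a PDE whose highest-order time derivative is of order $n\in\mathbb{N}$ and appears without mixed spatial derivatives, $$\partial_t^nu+\sum_{0\le i<n,\ 0\le j\le m}a_{i,j}\,\partial_t^i\partial_x^ju=0,\qquad n,m\in\mathbb{N},$$ with constant coefficients $a_{i,j}\in\mathbb{C}$. Put $p_i(z)=-\sum_{j=0}^m a_{i-1,j}z^j$ for $i=1,\dots,n$ and suppose that at least one $p_i$ is nonconstant. Then there is some $\rho_0>0$ such that the projection family of operators associated to the solution semigroup is Devaney chaotic on $X_\rho^n$ for all $\rho>\rho_0$.
   Context: For $\rho>0$ the Herzog space is $X_\rho=\{f:\mathbb{R}\to\mathbb{C}: f(x)=\sum_{k\ge0}\frac{a_k\rho^k}{k!}x^k,\ (a_k)_{k\ge0}\in c_0(\mathbb{N}_0)\}$ with norm $\|f\|=\sup_k|a_k|$; $\partial_x$ is bounded on it. Setting $u_1=u$, $u_{i+1}=\partial_tu_i$, the PDE becomes the Cauchy problem $\partial_t(u_1,\dots,u_n)^T=A_d(u_1,\dots,u_n)^T$ with initial data in $X_\rho^n$ and $$A_d=\begin{pmatrix}0&I&0&\dots\\0&0&I&\dots\\ \vdots&\vdots&\vdots&\ddots\\ p_1(\partial_x)&p_2(\partial_x)&\dots&p_n(\partial_x)\end{pmatrix};$$ the solution semigroup is $(e^{tA_d})_{t\ge0}$ on $X_\rho^n$, and the associated projection family is $(\pi\circ e^{tA_d}:X_\rho^n\to X_\rho)_{t\ge0}$, where $\pi$ is the first coordinate projection. A $C_0$-semigroup $(T_t)$ is Devaney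 chaotic if $\{T_tx:t\ge0\}$ is dense for some $x$ and the set of $x$ with $T_tx=x$ for some $t>0$ is dense. The projection family $(\pi\circ\mathcal{T}_t)_{t\ge0}$ of a $C_0$-semigroup $(\mathcal{T}_t)$ on $X^n$ is Devaney chaotic if there is a closed subspace $Y\ne\{0\}$ of $X^n$, invariant under $(\mathcal{T}_t)$, such that $(\mathcal{T}_t|_Y)$ is Devaney chaotic and $\overline{\pi(Y)}=X$. *)

theory Defs
  imports "HOL-Complex_Analysis.Complex_Analysis" "HOL-Library.Function_Algebras"
begin

section \<open>Norm topology on a carrier set\<close>

text \<open>
  The Herzog space depends on a real parameter, so it is a set of functions and not a type.  A
  normed space is therefore given by a carrier \<open>S\<close> and a norm \<open>N\<close>.  The locale \<open>Metric_space\<close>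
  requires nonnegativity and symmetry of the distance also outside the carrier, where \<open>N\<close> has
  no meaning; hence the guard.
\<close>

definition norm_dist :: "'v::ab_group_add set \<Rightarrow> ('v \<Rightarrow> real) \<Rightarrow> 'v \<Rightarrow> 'v \<Rightarrow> real" where
  "norm_dist S N u v = (if u \<in> S \<and> v \<in> S then N (u - v) else 0)"

definition norm_topology :: "'v::ab_group_add set \<Rightarrow> ('v \<Rightarrow> real) \<Rightarrow> 'v topology" where
  "norm_topology S N = Metric_space.mtopology S (norm_dist S N)"

lemma Metric_space_norm_dist:
  assumes diff: "\<And>u v. u \<in> S \<Longrightarrow> v \<in> S \<Longrightarrow> u - v \<in> S"
    and nonneg: "\<And>u. u \<in> S \<Longrightarrow> 0 \<le> N u"
    and zero: "\<And>u. u \<in> S \<Longrightarrow> N u = 0 \<longleftrightarrow> u = 0"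
    and minus: "\<And>u. u \<in> S \<Longrightarrow> N (- u) = N u"
    and triangle: "\<And>u v. u \<in> S \<Longrightarrow> v \<in> S \<Longrightarrow> N (u + v) \<le> N u + N v"
  shows "Metric_space S (norm_dist S N)"
proof
  fix u v w
  show "0 \<le> norm_dist S N u v"
    by (simp add: norm_dist_def diff nonneg)
  show "norm_dist S N u v = norm_dist S N v u"
    using minus[OF diff, of u v] by (simp add: norm_dist_def)
  assume u: "u \<in> S" and v: "v \<in> S"
  show "norm_dist S N u v = 0 \<longleftrightarrow> u = v"
    using u v by (simp add: norm_dist_def zero diff)
  assume w: "w \<in> S"
  show "norm_dist S N u w \<le> norm_dist S N u v + norm_dist S N v w"
    using triangle[OF diff[OF u v] diff[OF v w]] u v w by (simp add: norm_dist_def)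
qed


section \<open>The Herzog space\<close>

definition herzog_series :: "real \<Rightarrow> (real \<Rightarrow> complex) \<Rightarrow> (nat \<Rightarrow> complex) \<Rightarrow> bool" where
  "herzog_series \<rho> f a \<longleftrightarrow>
     a \<longlonglongrightarrow> 0 \<and> (\<forall>x. (\<lambda>k. a k * of_real (\<rho> ^ k / fact k) * of_real (x ^ k)) sums f x)"

definition herzog_space :: "real \<Rightarrow> (real \<Rightarrow> complex) set" where
  "herzog_space \<rho> = {f. \<exists>a. herzog_series \<rho> f a}"

definition herzog_norm :: "real \<Rightarrow> (real \<Rightarrow> complex) \<Rightarrow> real" where
  "herzog_norm \<rho> f = (SUP k. norm ((THE a. herzog_series \<rho> f a) k))"

lemma real_powser_sums_0:
  fixes d :: "nat \<Rightarrow> real"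
  assumes "\<And>x. (\<lambda>k. d k * x ^ k) sums 0"
  shows "d m = 0"
proof (rule ccontr)
  assume m: "d m \<noteq> 0"
  have "d 0 = 0"
    using assms[of 0] powser_sums_zero_iff[of d 0] by simp
  with m have "m > 0"
    by (cases m) auto
  show False
  proof (rule powser_0_nonzero[where r = 1 and a = d and \<xi> = 0 and f = "\<lambda>_. 0" and m = m])
    fix s :: real
    assume "0 < s" and nz: "\<And>z::real. z \<in> cball 0 s - {0} \<Longrightarrow> (0::real) \<noteq> 0"
    then show False
      using nz[of s] by simp
  qed (use assms m \<open>m > 0\<close> in simp_all)
qed

lemma herzog_series_diff:
  assumes "herzog_series \<rho> f a" "herzog_series \<rho> g b"
  shows "herzog_series \<rho> (f - g) (\<lambda>k. a k - b k)"
  using assms unfolding herzog_series_def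
  by (auto intro!: tendsto_eq_intros sums_diff simp: left_diff_distrib
      simp del: of_real_power of_real_divide)

lemma herzog_series_add:
  assumes "herzog_series \<rho> f a" "herzog_series \<rho> g b"
  shows "herzog_series \<rho> (f + g) (\<lambda>k. a k + b k)"
  using assms unfolding herzog_series_def
  by (auto intro!: tendsto_eq_intros sums_add simp: distrib_right
      simp del: of_real_power of_real_divide)

lemma herzog_series_0:
  assumes "herzog_series \<rho> (\<lambda>_. 0) a" "\<rho> > 0"
  shows "a k = 0"
proof -
  have s: "(\<lambda>k. a k * of_real (\<rho> ^ k / fact k) * of_real (x ^ k)) sums 0" for x
    using assms(1) by (simp add: herzog_series_def)
  have "Re (a k) * (\<rho> ^ k / fact k) = 0"
  proof (rule real_powser_sums_0[of "\<lambda>k. Re (a k) * (\<rho> ^ k / fact k)"])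
    show "(\<lambda>k. Re (a k) * (\<rho> ^ k / fact k) * x ^ k) sums 0" for x
      using sums_Re[OF s[of x]] by (simp del: of_real_power of_real_divide)
  qed
  moreover have "Im (a k) * (\<rho> ^ k / fact k) = 0"
  proof (rule real_powser_sums_0[of "\<lambda>k. Im (a k) * (\<rho> ^ k / fact k)"])
    show "(\<lambda>k. Im (a k) * (\<rho> ^ k / fact k) * x ^ k) sums 0" for x
      using sums_Im[OF s[of x]] by (simp del: of_real_power of_real_divide)
  qed
  ultimately show ?thesis
    using \<open>\<rho> > 0\<close> by (simp add: complex_eq_iff)
qed

lemma herzog_series_unique:
  assumes "herzog_series \<rho> f a" "herzog_series \<rho> f b" "\<rho> > 0"
  shows "a = b"
proof
  fix k
  have "herzog_series \<rho> (\<lambda>_. 0) (\<lambda>k. a k - b k)"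
    using herzog_series_diff[OF assms(1,2)] by (simp add: zero_fun_def)
  from herzog_series_0[OF this \<open>\<rho> > 0\<close>] show "a k = b k"
    by simp
qed

lemma herzog_norm_eq:
  assumes "herzog_series \<rho> f a" "\<rho> > 0"
  shows "herzog_norm \<rho> f = (SUP k. norm (a k))"
proof -
  have "(THE a. herzog_series \<rho> f a) = a"
    using assms herzog_series_unique by blast
  then show ?thesis
    by (simp add: herzog_norm_def)
qed

lemma herzog_series_bdd:
  assumes "herzog_series \<rho> f a"
  shows "bdd_above (range (\<lambda>k. norm (a k)))"
proof -
  have "Bseq a"
    using assms convergentI convergent_imp_Bseq unfolding herzog_series_def by blast
  then show ?thesis
    by (auto simp: Bseq_def bdd_above_def)
qed

lemma herzog_space_diff: "f \<in> herzog_space \<rho> \<Longrightarrow> g \<in> herzog_space \<rho> \<Longrightarrow> f - g \<in> herzog_space \<rho>"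
  unfolding herzog_space_def using herzog_series_diff by blast

lemma herzog_space_0: "0 \<in> herzog_space \<rho>"
  unfolding herzog_space_def herzog_series_def
  by (auto intro!: exI[of _ "\<lambda>_. 0"])

lemma herzog_norm_nonneg:
  assumes "f \<in> herzog_space \<rho>" "\<rho> > 0"
  shows "0 \<le> herzog_norm \<rho> f"
proof -
  from assms obtain a where a: "herzog_series \<rho> f a"
    by (auto simp: herzog_space_def)
  have "0 \<le> norm (a 0)" by simp
  also have "\<dots> \<le> (SUP k. norm (a k))"
    by (rule cSUP_upper[OF _ herzog_series_bdd[OF a]]) simp
  finally show ?thesis
    by (simp add: herzog_norm_eq[OF a \<open>\<rho> > 0\<close>])
qed

lemma herzog_norm_eq_0:
  assumes "f \<in> herzog_space \<rho>" "\<rho> > 0"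
  shows "herzog_norm \<rho> f = 0 \<longleftrightarrow> f = 0"
proof -
  from assms obtain a where a: "herzog_series \<rho> f a"
    by (auto simp: herzog_space_def)
  show ?thesis
  proof
    assume "herzog_norm \<rho> f = 0"
    then have "norm (a k) \<le> 0" for k
      using cSUP_upper[OF _ herzog_series_bdd[OF a], of k] herzog_norm_eq[OF a \<open>\<rho> > 0\<close>] by simp
    then have "(\<lambda>k. 0) sums f x" for x
      using a by (simp add: herzog_series_def)
    then show "f = 0"
      by (auto simp: sums_iff fun_eq_iff)
  next
    assume "f = 0"
    then have "a k = 0" for k
      using a herzog_series_0[OF _ \<open>\<rho> > 0\<close>] by (simp add: zero_fun_def)
    then show "herzog_norm \<rho> f = 0"
      by (simp add: herzog_norm_eq[OF a \<open>\<rho> > 0\<close>])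
  qed
qed

lemma herzog_norm_minus:
  assumes "f \<in> herzog_space \<rho>" "\<rho> > 0"
  shows "herzog_norm \<rho> (- f) = herzog_norm \<rho> f"
proof -
  from assms obtain a where a: "herzog_series \<rho> f a"
    by (auto simp: herzog_space_def)
  then have "herzog_series \<rho> (- f) (\<lambda>k. - a k)"
    unfolding herzog_series_def using sums_minus by (auto intro!: tendsto_eq_intros)
  from herzog_norm_eq[OF this] herzog_norm_eq[OF a] show ?thesis
    using \<open>\<rho> > 0\<close> by simp
qed

lemma herzog_norm_triangle:
  assumes "f \<in> herzog_space \<rho>" "g \<in> herzog_space \<rho>" "\<rho> > 0"
  shows "herzog_norm \<rho> (f + g) \<le> herzog_norm \<rho> f + herzog_norm \<rho> g"
proof -
  from assms obtain a b where a: "herzog_series \<rho> f a" and b: "herzog_series \<rho> g b"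
    by (auto simp: herzog_space_def)
  have "norm (a k + b k) \<le> (SUP k. norm (a k)) + (SUP k. norm (b k))" for k
    using norm_triangle_ineq[of "a k" "b k"]
      cSUP_upper[OF _ herzog_series_bdd[OF a], of k] cSUP_upper[OF _ herzog_series_bdd[OF b], of k]
    by simp
  then have "(SUP k. norm (a k + b k)) \<le> (SUP k. norm (a k)) + (SUP k. norm (b k))"
    by (intro cSUP_least) auto
  then show ?thesis
    by (simp add: herzog_norm_eq[OF a] herzog_norm_eq[OF b] \<open>\<rho> > 0\<close>
        herzog_norm_eq[OF herzog_series_add[OF a b]])
qed

lemma Metric_space_herzog:
  assumes "\<rho> > 0"
  shows "Metric_space (herzog_space \<rho>) (norm_dist (herzog_space \<rho>) (herzog_norm \<rho>))"
  using assms
  by (intro Metric_space_norm_dist)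
    (auto simp: herzog_space_diff herzog_norm_nonneg herzog_norm_eq_0 herzog_norm_minus
      herzog_norm_triangle)


section \<open>Finite powers\<close>

text \<open>
  An element \<open>(u\<^sub>1, \<dots>, u\<^sub>n)\<close> of \<open>X\<^sup>n\<close> is a function on the naturals vanishing outside \<open>{1..n}\<close>.
  The norm is the sum of the component norms, one of the equivalent norms inducing the product
  topology.
\<close>

type_synonym fvec = "nat \<Rightarrow> real \<Rightarrow> complex"

definition vec_space :: "(real \<Rightarrow> complex) set \<Rightarrow> nat \<Rightarrow> fvec set" where
  "vec_space X n = {U. (\<forall>i\<in>{1..n}. U i \<in> X) \<and> (\<forall>i. i \<notin> {1..n} \<longrightarrow> U i = 0)}"

definition vec_norm :: "((real \<Rightarrow> complex) \<Rightarrow> real) \<Rightarrow> nat \<Rightarrow> fvec \<Rightarrow> real" where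
  "vec_norm N n U = (\<Sum>i=1..n. N (U i))"

definition fvec_scale :: "complex \<Rightarrow> fvec \<Rightarrow> fvec" where
  "fvec_scale c U = (\<lambda>i x. c * U i x)"

interpretation fvec: vector_space fvec_scale
  by unfold_locales (auto simp: fvec_scale_def fun_eq_iff algebra_simps)

lemma Metric_space_herzog_vec:
  fixes n :: nat
  assumes "\<rho> > 0"
  defines "S \<equiv> vec_space (herzog_space \<rho>) n" and "N \<equiv> vec_norm (herzog_norm \<rho>) n"
  shows "Metric_space S (norm_dist S N)"
proof (rule Metric_space_norm_dist)
  fix U V
  assume U: "U \<in> S"
  show "0 \<le> N U"
    using U assms by (auto simp: vec_space_def vec_norm_def intro!: sum_nonneg herzog_norm_nonneg)
  show "N U = 0 \<longleftrightarrow> U = 0"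
  proof -
    have "N U = 0 \<longleftrightarrow> (\<forall>i\<in>{1..n}. herzog_norm \<rho> (U i) = 0)"
      using U assms unfolding N_def vec_norm_def
      by (intro sum_nonneg_eq_0_iff) (auto simp: vec_space_def intro!: herzog_norm_nonneg)
    also have "\<dots> \<longleftrightarrow> (\<forall>i\<in>{1..n}. U i = 0)"
      using U assms by (auto simp: vec_space_def herzog_norm_eq_0)
    also have "\<dots> \<longleftrightarrow> (\<forall>i. U i = 0)"
      using U by (auto simp: S_def vec_space_def)
    finally show ?thesis
      by (simp add: fun_eq_iff)
  qed
  show "N (- U) = N U"
    using U assms by (auto simp: vec_space_def vec_norm_def herzog_norm_minus intro!: sum.cong)
  assume V: "V \<in> S"
  show "U - V \<in> S"
    using U V by (auto simp: S_def vec_space_def herzog_space_diff)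
  show "N (U + V) \<le> N U + N V"
    using U V assms unfolding N_def vec_norm_def sum.distrib[symmetric]
    by (intro sum_mono) (auto simp: vec_space_def intro!: herzog_norm_triangle)
qed


section \<open>Semigroups and chaos\<close>

definition C0_semigroup :: "fvec set \<Rightarrow> (fvec \<Rightarrow> real) \<Rightarrow> (real \<Rightarrow> fvec \<Rightarrow> fvec) \<Rightarrow> bool" where
  "C0_semigroup S N T \<longleftrightarrow>
     (\<forall>t\<ge>0. (\<forall>U\<in>S. T t U \<in> S) \<and>
             (\<forall>U\<in>S. \<forall>V\<in>S. T t (U + V) = T t U + T t V) \<and>
             (\<forall>c. \<forall>U\<in>S. T t (fvec_scale c U) = fvec_scale c (T t U)) \<and>
             (\<exists>C. \<forall>U\<in>S. N (T t U) \<le> C * N U)) \<and>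
     (\<forall>U\<in>S. T 0 U = U) \<and>
     (\<forall>s\<ge>0. \<forall>t\<ge>0. \<forall>U\<in>S. T (s + t) U = T s (T t U)) \<and>
     (\<forall>U\<in>S. limitin (norm_topology S N) (\<lambda>t. T t U) U (at_right 0))"

definition devaney_chaotic :: "fvec set \<Rightarrow> (fvec \<Rightarrow> real) \<Rightarrow> (real \<Rightarrow> fvec \<Rightarrow> fvec) \<Rightarrow> bool" where
  "devaney_chaotic S N T \<longleftrightarrow>
     C0_semigroup S N T \<and>
     (\<exists>U\<in>S. norm_topology S N closure_of {T t U |t. t \<ge> 0} = S) \<and>
     norm_topology S N closure_of {U \<in> S. \<exists>t>0. T t U = U} = S"

definition projection_family_chaotic ::
    "(real \<Rightarrow> complex) set \<Rightarrow> ((real \<Rightarrow> complex) \<Rightarrow> real) \<Rightarrow> nat \<Rightarrow> (real \<Rightarrow> fvec \<Rightarrow> fvec) \<Rightarrow> bool" where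
  "projection_family_chaotic X N n T \<longleftrightarrow>
     C0_semigroup (vec_space X n) (vec_norm N n) T \<and>
     (\<exists>Y \<subseteq> vec_space X n.
        fvec.subspace Y \<and>
        closedin (norm_topology (vec_space X n) (vec_norm N n)) Y \<and>
        Y \<noteq> {0} \<and>
        (\<forall>t\<ge>0. \<forall>U\<in>Y. T t U \<in> Y) \<and>
        devaney_chaotic Y (vec_norm N n) T \<and>
        norm_topology X N closure_of ((\<lambda>U. U 1) ` Y) = X)"


section \<open>The solution semigroup of the equation\<close>

text \<open>
  The equation is \<open>\<partial>\<^sub>t\<^sup>n u + (\<Sum>i<n. \<Sum>j\<le>m. a i j \<partial>\<^sub>t\<^sup>i \<partial>\<^sub>x\<^sup>j u) = 0\<close>.  With \<open>u\<^sub>i = \<partial>\<^sub>t\<^sup>i\<^sup>-\<^sup>1 u\<close> it becomes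
  \<open>\<partial>\<^sub>t (u\<^sub>1, \<dots>, u\<^sub>n) = A (u\<^sub>1, \<dots>, u\<^sub>n)\<close> for the companion operator \<open>A\<close> below, \<open>p\<^sub>i\<close> being
  \<open>symbol_poly a m i\<close>.
\<close>

definition symbol_poly :: "(nat \<Rightarrow> nat \<Rightarrow> complex) \<Rightarrow> nat \<Rightarrow> nat \<Rightarrow> complex poly" where
  "symbol_poly a m i = - (\<Sum>j\<le>m. monom (a (i - 1) j) j)"

definition Dx :: "(real \<Rightarrow> complex) \<Rightarrow> real \<Rightarrow> complex" where
  "Dx f = (\<lambda>x. vector_derivative f (at x))"

definition poly_Dx :: "complex poly \<Rightarrow> (real \<Rightarrow> complex) \<Rightarrow> real \<Rightarrow> complex" where
  "poly_Dx p f = (\<lambda>x. \<Sum>j\<le>degree p. coeff p j * (Dx ^^ j) f x)"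

definition companion_op :: "nat \<Rightarrow> (nat \<Rightarrow> complex poly) \<Rightarrow> fvec \<Rightarrow> fvec" where
  "companion_op n p U =
     (\<lambda>i. if i \<in> {1..<n} then U (i + 1)
          else if i = n then (\<Sum>l=1..n. poly_Dx (p l) (U l))
          else 0)"

text \<open>
  The exponential series of \<open>t A\<close>, evaluated at \<open>U\<close> and summed in the norm of the space.  For
  bounded \<open>A\<close> on a Banach space the series also converges in operator norm, to the same operator.
\<close>

definition exp_semigroup :: "fvec set \<Rightarrow> (fvec \<Rightarrow> real) \<Rightarrow> (fvec \<Rightarrow> fvec) \<Rightarrow> real \<Rightarrow> fvec \<Rightarrow> fvec" where
  "exp_semigroup S N A t U =
     (THE V. limitin (norm_topology S N)
        (\<lambda>K. \<Sum>k<K. fvec_scale (of_real (t ^ k / fact k)) ((A ^^ k) U)) V sequentially)"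

definition solution_semigroup ::
    "real \<Rightarrow> nat \<Rightarrow> nat \<Rightarrow> (nat \<Rightarrow> nat \<Rightarrow> complex) \<Rightarrow> real \<Rightarrow> fvec \<Rightarrow> fvec" where
  "solution_semigroup \<rho> n m a =
     exp_semigroup (vec_space (herzog_space \<rho>) n) (vec_norm (herzog_norm \<rho>) n)
       (companion_op n (symbol_poly a m))"

end

theory Submission
  imports Defs "HOL-Computational_Algebra.Fundamental_Theorem_Algebra"
begin

text \<open>
  The exponential \<open>e\<^bsup>lt + zx\<^esup>\<close> solves the equation if and only if \<open>(l, z)\<close> lies on the
  characteristic curve \<open>l\<^sup>n = \<Sum>\<^sub>i p\<^sub>i(z) l\<^sup>i\<^sup>-\<^sup>1\<close>.  Its initial vector, with components
  \<open>l\<^sup>i\<^sup>-\<^sup>1 e\<^bsup>zx\<^esup>\<close>, belongs to \<open>X\<^sub>\<rho>\<^sup>n\<close> for \<open>|z| < \<rho>\<close> and is an eigenvector of \<open>A\<^sub>d\<close> for the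
  eigenvalue \<open>l\<close>.  If some \<open>p\<^sub>i\<close> is nonconstant, the curve has a holomorphic branch \<open>z = h(l)\<close> on a
  disc around a point \<open>c\<close> of the imaginary axis (\<open>characteristic_branch\<close>).  The space \<open>Y\<close> is the
  closed span of the eigenvectors along this branch.

  Within such a family, the eigenvectors for any set of eigenvalues accumulating at \<open>c\<close> span a
  dense subspace of \<open>Y\<close> (\<open>mem_closed_subspace\<close>): a closed subspace that contains them contains the
  Taylor coefficients of the family at \<open>c\<close>.  Three sets of eigenvalues are used.  Those with
  negative real part give a dense set of initial values whose orbits tend to \<open>0\<close>, those with
  positive real part a dense set of points with backward orbits tending to \<open>0\<close>.  Hence the semigroup
  is topologically transitive on \<open>Y\<close> and, by Baire's theorem, has a dense orbit
  (\<open>transitive\<close>, \<open>dense_orbit_if_transitive\<close>).  Those in \<open>2\<pi>i\<rat>\<close> give a dense set of periodic points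
  (\<open>periodic_dense\<close>).

  The first components of the eigenvectors are the exponentials \<open>e\<^bsup>h(l)x\<^esup>\<close>.  The function \<open>h\<close> is not
  constant, since the equation of the curve is monic in \<open>l\<close>.  So the exponents accumulate at \<open>h(c)\<close>, and the
  same identity argument, applied to \<open>z \<mapsto> e\<^bsup>zx\<^esup>\<close> at \<open>h(c)\<close> and then at \<open>0\<close>, gives a dense span
  in \<open>X\<^sub>\<rho>\<close> once the disc around \<open>h(c)\<close> of radius \<open>\<rho> - |h(c)|\<close> contains \<open>0\<close> in its interior
  (\<open>exponentials_dense\<close>).  This is why \<open>\<rho>\<^sub>0\<close> is about \<open>2|h(c)|\<close>.

  The analysis takes place in the Banach space of bounded families indexed by pairs \<open>(i, k)\<close>, the
  entry being the coefficient number \<open>k\<close> of the component \<open>i\<close>; there \<open>\<partial>\<^sub>x\<close> is \<open>\<rho>\<close> times a shift.  The map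
  \<open>egf_vec\<close> carries the results over to \<open>X\<^sub>\<rho>\<^sup>n\<close>.
\<close>

section \<open>The exponential of a bounded operator\<close>

definition op_exp :: "('b::banach \<Rightarrow> 'b) \<Rightarrow> real \<Rightarrow> 'b \<Rightarrow> 'b" where
  "op_exp L t x = (\<Sum>k. (t ^ k / fact k) *\<^sub>R (L ^^ k) x)"

locale bounded_operator = bounded_linear L for L :: "'b::banach \<Rightarrow> 'b" +
  fixes M :: real
  assumes norm_le: "norm (L x) \<le> M * norm x" and M_nonneg: "0 \<le> M"
begin

lemma norm_power_le: "norm ((L ^^ k) x) \<le> M ^ k * norm x"
proof (induction k)
  case (Suc k)
  have "norm ((L ^^ Suc k) x) \<le> M * norm ((L ^^ k) x)"
    by (simp add: norm_le)
  also have "\<dots> \<le> M * (M ^ k * norm x)"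
    by (rule mult_left_mono[OF Suc M_nonneg])
  finally show ?case by simp
qed simp

lemma bounded_linear_power: "bounded_linear (L ^^ k)"
proof (induction k)
  case 0
  show ?case
    by (simp add: id_def bounded_linear_ident)
next
  case (Suc k)
  show ?case
    using bounded_linear_compose[OF bounded_linear_axioms Suc] by (simp add: o_def)
qed

lemma norm_term_le: "norm ((t ^ k / fact k) *\<^sub>R (L ^^ k) x) \<le> (\<bar>t\<bar> * M) ^ k / fact k * norm x"
proof -
  have "norm ((t ^ k / fact k) *\<^sub>R (L ^^ k) x) = \<bar>t\<bar> ^ k / fact k * norm ((L ^^ k) x)"
    by (simp add: power_abs)
  also have "\<dots> \<le> \<bar>t\<bar> ^ k / fact k * (M ^ k * norm x)"
    by (intro mult_left_mono norm_power_le) auto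
  finally show ?thesis by (simp add: power_mult_distrib)
qed

lemma exp_bound_sums: "(\<lambda>k. (\<bar>t\<bar> * M) ^ k / fact k * c) sums (exp (\<bar>t\<bar> * M) * c)" for c :: real
  using sums_mult2[OF exp_converges[of "\<bar>t\<bar> * M"], of c] by (simp add: divide_inverse ac_simps)

lemma summable_norm_terms: "summable (\<lambda>k. norm ((t ^ k / fact k) *\<^sub>R (L ^^ k) x))"
proof (rule summable_comparison_test'[OF sums_summable[OF exp_bound_sums[of t "norm x"]]])
  show "norm (norm ((t ^ k / fact k) *\<^sub>R (L ^^ k) x)) \<le> (\<bar>t\<bar> * M) ^ k / fact k * norm x" for k
    using norm_term_le[of t k x] by (simp only: real_norm_def abs_norm_cancel)
qed

lemma op_exp_sums: "(\<lambda>k. (t ^ k / fact k) *\<^sub>R (L ^^ k) x) sums op_exp L t x"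
  unfolding op_exp_def by (rule summable_sums[OF summable_norm_cancel[OF summable_norm_terms]])

lemma op_exp_0 [simp]: "op_exp L 0 x = x"
proof -
  have "(\<lambda>k. (0 ^ k / fact k) *\<^sub>R (L ^^ k) x) sums (\<Sum>k\<in>{0}. (0 ^ k / fact k) *\<^sub>R (L ^^ k) x)"
    by (rule sums_finite) auto
  then show ?thesis
    by (rule sums_unique2[OF op_exp_sums, THEN trans]) simp
qed

lemma norm_op_exp_le: "norm (op_exp L t x) \<le> exp (\<bar>t\<bar> * M) * norm x"
proof -
  have "norm (op_exp L t x) \<le> (\<Sum>k. norm ((t ^ k / fact k) *\<^sub>R (L ^^ k) x))"
    unfolding op_exp_def by (rule summable_norm[OF summable_norm_terms])
  also have "\<dots> \<le> (\<Sum>k. (\<bar>t\<bar> * M) ^ k / fact k * norm x)"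
    by (intro suminf_le norm_term_le summable_norm_terms sums_summable[OF exp_bound_sums])
  also have "\<dots> = exp (\<bar>t\<bar> * M) * norm x"
    using exp_bound_sums by (simp add: sums_iff)
  finally show ?thesis .
qed

lemma bounded_linear_op_exp: "bounded_linear (op_exp L t)"
proof (rule bounded_linear_intro[where K = "exp (\<bar>t\<bar> * M)"])
  fix x y r
  show "op_exp L t (x + y) = op_exp L t x + op_exp L t y"
    using sums_add[OF op_exp_sums op_exp_sums, of t x t y] op_exp_sums[of t "x + y"]
    by (simp add: linear_simps(1)[OF bounded_linear_power] scaleR_add_right sums_unique2)
  show "op_exp L t (r *\<^sub>R x) = r *\<^sub>R op_exp L t x"
    using sums_scaleR_right[OF op_exp_sums, of r t x] op_exp_sums[of t "r *\<^sub>R x"]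
    by (simp add: linear_simps(5)[OF bounded_linear_power] sums_unique2 mult.commute)
  show "norm (op_exp L t x) \<le> norm x * exp (\<bar>t\<bar> * M)"
    using norm_op_exp_le[of t x] by (simp add: mult.commute)
qed

text \<open>
  Both sides are iterated sums of the absolutely summable double family
  \<open>s\<^sup>j t\<^sup>k / (j! k!) L\<^sup>j\<^sup>+\<^sup>k x\<close>, which is grouped by rows on one side and by the value of
  \<open>j + k\<close> on the other.
\<close>
lemma op_exp_add: "op_exp L (s + t) x = op_exp L s (op_exp L t x)"
proof -
  define c where "c = (\<lambda>(r::real) k. r ^ k / fact k)"
  define f where "f = (\<lambda>(j, k). (c s j * c t k) *\<^sub>R (L ^^ (j + k)) x)"
  have absf: "(\<lambda>jk. norm (f jk)) summable_on UNIV \<times> UNIV"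
  proof -
    define g where "g = (\<lambda>(j, k). ((\<bar>s\<bar> * M) ^ j / fact j) * ((\<bar>t\<bar> * M) ^ k / fact k * norm x))"
    have row: "((\<lambda>k. g (j, k)) has_sum ((\<bar>s\<bar> * M) ^ j / fact j * (exp (\<bar>t\<bar> * M) * norm x))) UNIV" for j
      unfolding g_def prod.case
      by (intro has_sum_cmult_right norm_summable_imp_has_sum exp_bound_sums)
        (use M_nonneg sums_summable[OF exp_bound_sums[of t "norm x"]] in simp)
    have rows: "((\<lambda>j. (\<bar>s\<bar> * M) ^ j / fact j * (exp (\<bar>t\<bar> * M) * norm x)) has_sum
        (exp (\<bar>s\<bar> * M) * (exp (\<bar>t\<bar> * M) * norm x))) UNIV"
      by (intro norm_summable_imp_has_sum exp_bound_sums)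
        (use M_nonneg sums_summable[OF exp_bound_sums[of s "exp (\<bar>t\<bar> * M) * norm x"]] in simp)
    have nonneg: "0 \<le> g jk" for jk
      using M_nonneg by (cases jk) (simp add: g_def)
    then have norm_g: "norm (g jk) = g jk" for jk
      by simp
    have norm_row: "norm ((\<bar>s\<bar> * M) ^ j / fact j * (exp (\<bar>t\<bar> * M) * norm x))
        = (\<bar>s\<bar> * M) ^ j / fact j * (exp (\<bar>t\<bar> * M) * norm x)" for j
      using M_nonneg by simp
    have "(\<lambda>jk. norm (g jk)) summable_on UNIV \<times> UNIV"
      unfolding Infinite_Sum.abs_summable_on_Sigma_iff
      using has_sum_imp_summable[OF row] has_sum_imp_summable[OF rows] infsumI[OF row] M_nonneg
      by (simp add: norm_g norm_row del: times_divide_eq_left times_divide_eq_right real_norm_def)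
    then show ?thesis
    proof (rule Infinite_Sum.abs_summable_on_comparison_test)
      fix jk :: "nat \<times> nat"
      obtain j k where jk: "jk = (j, k)" by fastforce
      have "norm (f jk) = (\<bar>s\<bar> ^ j / fact j * (\<bar>t\<bar> ^ k / fact k)) * norm ((L ^^ (j + k)) x)"
        by (simp add: f_def jk c_def abs_mult power_abs)
      also have "\<dots> \<le> (\<bar>s\<bar> ^ j / fact j * (\<bar>t\<bar> ^ k / fact k)) * (M ^ (j + k) * norm x)"
        by (intro mult_left_mono norm_power_le) auto
      also have "\<dots> = g jk"
        by (simp add: g_def jk power_add power_mult_distrib)
      also have "\<dots> = norm (g jk)"
        using nonneg[of jk] by simp
      finally show "norm (f jk) \<le> norm (g jk)" .
    qed
  qed
  then have sumf: "f summable_on UNIV \<times> UNIV"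
    by (rule abs_summable_summable)
  have exp_infsum: "op_exp L r y = (\<Sum>\<^sub>\<infinity>k. c r k *\<^sub>R (L ^^ k) y)" for r y
    using norm_summable_imp_has_sum[OF summable_norm_terms op_exp_sums, of r y]
    by (simp add: infsumI c_def)
  have inner: "(\<Sum>\<^sub>\<infinity>k. f (j, k)) = c s j *\<^sub>R (L ^^ j) (op_exp L t x)" for j
  proof -
    interpret P: bounded_linear "\<lambda>y. c s j *\<^sub>R (L ^^ j) y"
      by (intro bounded_linear_compose[OF bounded_linear_scaleR_right] bounded_linear_power)
    have "(\<lambda>k. c s j *\<^sub>R (L ^^ j) ((t ^ k / fact k) *\<^sub>R (L ^^ k) x)) sums (c s j *\<^sub>R (L ^^ j) (op_exp L t x))"
      by (rule P.sums[OF op_exp_sums])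
    moreover have "c s j *\<^sub>R (L ^^ j) ((t ^ k / fact k) *\<^sub>R (L ^^ k) x) = f (j, k)" for k
      by (simp add: f_def c_def linear_simps(5)[OF bounded_linear_power] funpow_add)
    ultimately have "(\<lambda>k. f (j, k)) sums (c s j *\<^sub>R (L ^^ j) (op_exp L t x))"
      by simp
    moreover have "(\<lambda>k. norm (f (j, k))) summable_on UNIV"
      using absf unfolding Infinite_Sum.abs_summable_on_Sigma_iff by simp
    then have "summable (\<lambda>k. norm (f (j, k)))"
      using summable_on_UNIV_nonneg_real_iff by fastforce
    ultimately show ?thesis
      by (intro infsumI norm_summable_imp_has_sum)
  qed
  have "op_exp L s (op_exp L t x) = (\<Sum>\<^sub>\<infinity>j. \<Sum>\<^sub>\<infinity>k. f (j, k))"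
    by (simp add: exp_infsum[of s] inner)
  also have "\<dots> = infsum f (UNIV \<times> UNIV)"
    by (rule infsum_Sigma_banach[OF sumf])
  also have "\<dots> = infsum (\<lambda>(m, j). f (j, m - j)) (SIGMA m:UNIV. {..m})"
    by (rule infsum_reindex_bij_witness[where i = "\<lambda>(m, j). (j, m - j)" and j = "\<lambda>(j, k). (j + k, j)"]) auto
  also have "\<dots> = (\<Sum>\<^sub>\<infinity>m. \<Sum>\<^sub>\<infinity>j\<in>{..m}. f (j, m - j))"
  proof -
    have "f summable_on UNIV \<times> UNIV \<longleftrightarrow> (\<lambda>(m, j). f (j, m - j)) summable_on (SIGMA m:UNIV. {..m})"
      by (rule summable_on_reindex_bij_witness[where i = "\<lambda>(m, j). (j, m - j)" and j = "\<lambda>(j, k). (j + k, j)"])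
        auto
    with sumf have "(\<lambda>(m, j). f (j, m - j)) summable_on (SIGMA m:UNIV. {..m})"
      by blast
    from infsum_Sigma_banach[OF this] show ?thesis by simp
  qed
  also have "\<dots> = (\<Sum>\<^sub>\<infinity>m. c (s + t) m *\<^sub>R (L ^^ m) x)"
  proof (rule infsum_cong)
    fix m :: nat
    have "(\<Sum>\<^sub>\<infinity>j\<in>{..m}. f (j, m - j)) = (\<Sum>j\<le>m. c s j * c t (m - j)) *\<^sub>R (L ^^ m) x"
      by (simp add: f_def scaleR_sum_left)
    also have "(\<Sum>j\<le>m. c s j * c t (m - j)) = c (s + t) m"
    proof -
      have "c (s + t) m = (\<Sum>j\<le>m. of_nat (m choose j) * s ^ j * t ^ (m - j) / fact m)"
        by (simp add: c_def binomial_ring sum_divide_distrib)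
      also have "\<dots> = (\<Sum>j\<le>m. c s j * c t (m - j))"
        by (rule sum.cong) (simp_all add: c_def binomial_fact)
      finally show ?thesis
        by simp
    qed
    finally show "(\<Sum>\<^sub>\<infinity>j\<in>{..m}. f (j, m - j)) = c (s + t) m *\<^sub>R (L ^^ m) x" .
  qed
  also have "\<dots> = op_exp L (s + t) x"
    by (rule exp_infsum[symmetric])
  finally show ?thesis by simp
qed

lemma op_exp_tendsto_0: "((\<lambda>t. op_exp L t x) \<longlongrightarrow> x) (at 0)"
proof -
  have bound: "norm (op_exp L t x - x) \<le> (exp (\<bar>t\<bar> * M) - 1) * norm x" for t
  proof -
    have s: "(\<lambda>k. (t ^ Suc k / fact (Suc k)) *\<^sub>R (L ^^ Suc k) x) sums (op_exp L t x - x)"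
      using op_exp_sums[of t x] by (subst sums_Suc_iff) simp
    have e: "(\<lambda>k. (\<bar>t\<bar> * M) ^ Suc k / fact (Suc k) * norm x) sums (exp (\<bar>t\<bar> * M) * norm x - norm x)"
      using exp_bound_sums[of t "norm x"] by (subst sums_Suc_iff) simp
    have sn: "summable (\<lambda>k. norm ((t ^ Suc k / fact (Suc k)) *\<^sub>R (L ^^ Suc k) x))"
      using summable_norm_terms[of t x] by (subst summable_Suc_iff)
    have "norm (op_exp L t x - x) \<le> (\<Sum>k. norm ((t ^ Suc k / fact (Suc k)) *\<^sub>R (L ^^ Suc k) x))"
      unfolding sums_unique[OF s] by (rule summable_norm[OF sn])
    also have "\<dots> \<le> (\<Sum>k. (\<bar>t\<bar> * M) ^ Suc k / fact (Suc k) * norm x)"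
      by (rule suminf_le[OF norm_term_le sn sums_summable[OF e]])
    also have "\<dots> = (exp (\<bar>t\<bar> * M) - 1) * norm x"
      using sums_unique[OF e] by (simp add: left_diff_distrib)
    finally show ?thesis .
  qed
  have "((\<lambda>t. (exp (\<bar>t\<bar> * M) - 1) * norm x) \<longlongrightarrow> (exp (\<bar>0\<bar> * M) - 1) * norm x) (at 0)"
    by (intro tendsto_intros)
  then have "((\<lambda>t. op_exp L t x - x) \<longlongrightarrow> 0) (at 0)"
    by (intro Lim_null_comparison[OF always_eventually[OF allI[OF bound]]]) simp
  then show ?thesis
    by (simp add: LIM_zero_iff)
qed

lemma op_exp_mem_closed:
  assumes "closed W" "subspace W" "\<And>y. y \<in> W \<Longrightarrow> L y \<in> W" "x \<in> W"
  shows "op_exp L t x \<in> W"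
proof -
  have pow: "(L ^^ k) x \<in> W" for k
    by (induction k) (use assms in auto)
  have "(\<lambda>n. \<Sum>k<n. (t ^ k / fact k) *\<^sub>R (L ^^ k) x) \<longlonglongrightarrow> op_exp L t x"
    using op_exp_sums by (simp add: sums_def)
  then show ?thesis
    by (rule closed_sequentially[OF assms(1), rotated])
      (use pow in \<open>auto intro!: subspace_sum[OF assms(2)] subspace_scale[OF assms(2)]\<close>)
qed

end

section \<open>Holomorphic families of bounded functions\<close>

text \<open>
  Every function on a discrete space is continuous, so bounded families over a discrete index set
  are exactly the bounded continuous functions.  Pairs of naturals serve as the index set below.
\<close>
instance prod :: (discrete_topology, discrete_topology) discrete_topology
proof
  fix S :: "('a \<times> 'b) set"
  have "open (\<Union>x\<in>S. {fst x} \<times> {snd x})"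
    by (intro open_UN ballI open_Times open_discrete)
  also have "(\<Union>x\<in>S. {fst x} \<times> {snd x}) = S"
    by auto
  finally show "open S" .
qed

definition cscale ::
    "complex \<Rightarrow> ('i::topological_space \<Rightarrow>\<^sub>C complex) \<Rightarrow> ('i \<Rightarrow>\<^sub>C complex)" where
  "cscale c f = Bcontfun (\<lambda>i. c * f i)"

lemma cscale_apply: "cscale c f i = c * f i"
proof -
  have "(\<lambda>i. c * f i) \<in> bcontfun"
    by (rule bcontfun_normI[where b = "norm c * norm f"])
      (auto intro!: continuous_intros mult_left_mono norm_bounded simp: norm_mult)
  then show ?thesis
    by (simp add: cscale_def Bcontfun_inverse)
qed

interpretation cfam: vector_space cscale
  by unfold_locales (auto intro!: bcontfun_eqI simp: cscale_apply algebra_simps)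

lemma norm_cscale_le: "norm (cscale c f) \<le> norm c * norm f"
  by (rule norm_bound) (simp add: cscale_apply norm_mult mult_left_mono norm_bounded)

lemma norm_cscale: "norm (cscale c f) = norm c * norm f"
proof (cases "c = 0")
  case False
  have "norm f = norm (cscale (inverse c) (cscale c f))"
    using False by simp
  also have "\<dots> \<le> norm (inverse c) * norm (cscale c f)"
    by (rule norm_cscale_le)
  finally have "norm c * norm f \<le> norm (cscale c f)"
    using False by (simp add: norm_divide field_simps)
  then show ?thesis
    using norm_cscale_le[of c f] by simp
qed simp

lemma scaleR_eq_cscale: "r *\<^sub>R f = cscale (of_real r) f"
  by (rule bcontfun_eqI) (simp add: cscale_apply scaleR_conv_of_real)

lemma bounded_linear_cscale: "bounded_linear (cscale c)"
  by (rule bounded_linear_intro[where K = "norm c"])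
    (simp_all add: cfam.scale_right_distrib scaleR_eq_cscale norm_cscale mult.commute)

lemma bounded_linear_cscale_left: "bounded_linear (\<lambda>c. cscale c f)"
  by (rule bounded_linear_intro[where K = "norm f"])
    (simp_all add: cfam.scale_left_distrib scaleR_eq_cscale norm_cscale scaleR_conv_of_real)

lemma subspace_of_complex: "cfam.subspace W \<Longrightarrow> subspace W"
  by (simp add: subspace_def cfam.subspace_def scaleR_eq_cscale)

lemma cfam_subspace_closure:
  assumes "cfam.subspace W"
  shows "cfam.subspace (closure W)"
proof (rule cfam.subspaceI)
  show "0 \<in> closure W"
    using assms closure_subset by (blast dest: cfam.subspace_0)
  show "x + y \<in> closure W" if "x \<in> closure W" "y \<in> closure W" for x y
  proof -
    from that obtain f g where "\<And>n. f n \<in> W" "f \<longlonglongrightarrow> x" "\<And>n. g n \<in> W" "g \<longlonglongrightarrow> y"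
      unfolding closure_sequential by blast
    then show ?thesis
      unfolding closure_sequential using assms
      by (intro exI[of _ "\<lambda>n. f n + g n"]) (auto intro: tendsto_add cfam.subspace_add)
  qed
  show "cscale c x \<in> closure W" if "x \<in> closure W" for c x
  proof -
    from that obtain f where "\<And>n. f n \<in> W" "f \<longlonglongrightarrow> x"
      unfolding closure_sequential by blast
    then show ?thesis
      unfolding closure_sequential using assms
      by (intro exI[of _ "\<lambda>n. cscale c (f n)"])
        (auto intro: bounded_linear.tendsto[OF bounded_linear_cscale] cfam.subspace_scale)
  qed
qed

lemma bcontfun_discreteI:
  fixes f :: "'i::discrete_topology \<Rightarrow> 'b::real_normed_vector"
  assumes "\<And>i. norm (f i) \<le> B"
  shows "f \<in> bcontfun"
  using assms by (intro bcontfun_normI) auto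

lemma apply_Bcontfun:
  fixes f :: "'i::discrete_topology \<Rightarrow> 'b::real_normed_vector"
  assumes "\<And>i. norm (f i) \<le> B"
  shows "apply_bcontfun (Bcontfun f) = f"
  by (rule Bcontfun_inverse[OF bcontfun_discreteI[OF assms]])

definition taylor_coeff :: "(complex \<Rightarrow> complex) \<Rightarrow> complex \<Rightarrow> nat \<Rightarrow> complex" where
  "taylor_coeff f c j = (deriv ^^ j) f c / fact j"

lemma taylor_coeff_bound:
  assumes "f holomorphic_on ball c r" "\<And>z. z \<in> ball c r \<Longrightarrow> norm (f z) \<le> B" "0 < s" "s < r"
  shows "norm (taylor_coeff f c j) \<le> B / s ^ j"
proof -
  have sub: "cball c s \<subseteq> ball c r" "ball c s \<subseteq> ball c r"
    using assms by auto
  have "norm ((deriv ^^ j) f c) \<le> fact j * B / s ^ j"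
  proof (rule Cauchy_inequality)
    show "f holomorphic_on ball c s"
      using assms(1) sub(2) by (rule holomorphic_on_subset)
    show "continuous_on (cball c s) f"
      using holomorphic_on_imp_continuous_on[OF assms(1)] sub(1) by (rule continuous_on_subset)
    show "norm (f x) \<le> B" if "norm (c - x) = s" for x
      using assms that by (auto simp: dist_norm)
  qed (use assms in auto)
  then show ?thesis
    by (simp add: taylor_coeff_def norm_divide field_simps)
qed

text \<open>
  The estimate depends on \<open>f\<close> only through the bound \<open>B\<close>.  It therefore holds uniformly for all
  entries of a bounded holomorphic family, and turns the entrywise Taylor series into one that
  converges in the supremum norm.
\<close>
lemma taylor_remainder_bound:
  assumes f: "f holomorphic_on ball c r" "\<And>z. z \<in> ball c r \<Longrightarrow> norm (f z) \<le> B"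
    and s: "s < r" and w: "dist w c < s"
  defines "q \<equiv> dist w c / s"
  shows "norm (f w - (\<Sum>l<j. (w - c) ^ l * taylor_coeff f c l)) \<le> B * q ^ j / (1 - q)"
proof -
  have s0: "0 < s"
    using w zero_le_dist[of w c] by linarith
  have q: "0 \<le> q" "q < 1"
    using w s0 by (auto simp: q_def)
  have "w \<in> ball c r"
    using w s by (simp add: dist_commute)
  from holomorphic_power_series[OF f(1) this]
  have "(\<lambda>l. (w - c) ^ l * taylor_coeff f c l) sums f w"
    by (simp add: taylor_coeff_def mult.commute)
  from sums_split_initial_segment[OF this, of j]
  have tail: "(\<lambda>l. (w - c) ^ (l + j) * taylor_coeff f c (l + j)) sums
      (f w - (\<Sum>l<j. (w - c) ^ l * taylor_coeff f c l))" .
  have term_le: "norm ((w - c) ^ (l + j) * taylor_coeff f c (l + j)) \<le> B * q ^ j * q ^ l" for l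
  proof -
    have "norm ((w - c) ^ (l + j) * taylor_coeff f c (l + j))
        \<le> dist w c ^ (l + j) * (B / s ^ (l + j))"
      unfolding norm_mult norm_power dist_norm
      using taylor_coeff_bound[OF f s0 s] by (intro mult_left_mono) auto
    also have "\<dots> = B * q ^ j * q ^ l"
      by (simp add: q_def power_divide power_add mult.commute)
    finally show ?thesis .
  qed
  have geo: "(\<lambda>l. B * q ^ j * q ^ l) sums (B * q ^ j * (1 / (1 - q)))"
    using q by (intro sums_mult geometric_sums) simp
  have sn: "summable (\<lambda>l. norm ((w - c) ^ (l + j) * taylor_coeff f c (l + j)))"
  proof (rule summable_comparison_test'[OF sums_summable[OF geo]])
    show "norm (norm ((w - c) ^ (l + j) * taylor_coeff f c (l + j))) \<le> B * q ^ j * q ^ l" for l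
      using term_le[of l] by (simp only: real_norm_def abs_norm_cancel)
  qed
  have "norm (f w - (\<Sum>l<j. (w - c) ^ l * taylor_coeff f c l))
      \<le> (\<Sum>l. norm ((w - c) ^ (l + j) * taylor_coeff f c (l + j)))"
    unfolding sums_unique[OF tail] by (rule summable_norm[OF sn])
  also have "\<dots> \<le> (\<Sum>l. B * q ^ j * q ^ l)"
    by (rule suminf_le[OF term_le sn sums_summable[OF geo]])
  also have "\<dots> = B * q ^ j / (1 - q)"
    using sums_unique[OF geo] by simp
  finally show ?thesis .
qed

locale holomorphic_family =
  fixes F :: "complex \<Rightarrow> ('i::discrete_topology \<Rightarrow>\<^sub>C complex)" and c :: complex and r B :: real
  assumes radius_pos: "0 < r"
    and holomorphic: "\<And>i. (\<lambda>z. F z i) holomorphic_on ball c r"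
    and bounded: "\<And>z. z \<in> ball c r \<Longrightarrow> norm (F z) \<le> B"
begin

definition coefficient :: "nat \<Rightarrow> ('i \<Rightarrow>\<^sub>C complex)" where
  "coefficient j = Bcontfun (\<lambda>i. taylor_coeff (\<lambda>z. F z i) c j)"

lemma norm_apply_le: "z \<in> ball c r \<Longrightarrow> norm (F z i) \<le> B"
  using norm_bounded[of "F z" i] bounded[of z] by linarith

lemma coefficient_apply: "coefficient j i = taylor_coeff (\<lambda>z. F z i) c j"
  unfolding coefficient_def
  using taylor_coeff_bound[OF holomorphic norm_apply_le, of "r / 2"] radius_pos
  by (subst apply_Bcontfun[where B = "B / (r / 2) ^ j"]) auto

lemma remainder_bound:
  assumes "s < r" "dist w c < s"
  shows "norm (F w - (\<Sum>l<j. cscale ((w - c) ^ l) (coefficient l)))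
    \<le> B * (dist w c / s) ^ j / (1 - dist w c / s)"
proof (rule norm_bound)
  fix i
  have "apply_bcontfun (\<Sum>l<j. cscale ((w - c) ^ l) (coefficient l)) i
      = (\<Sum>l<j. (w - c) ^ l * taylor_coeff (\<lambda>z. F z i) c l)"
    by (induction j) (simp_all add: cscale_apply coefficient_apply)
  then show "norm (apply_bcontfun (F w - (\<Sum>l<j. cscale ((w - c) ^ l) (coefficient l))) i)
    \<le> B * (dist w c / s) ^ j / (1 - dist w c / s)"
    using taylor_remainder_bound[OF holomorphic norm_apply_le assms, of i j] by simp
qed

lemma bound_nonneg: "0 \<le> B"
  using bounded[of c] radius_pos norm_ge_zero[of "F c"] by (simp del: norm_ge_zero)

text \<open>
  A closed subspace that contains \<open>F z\<close> for points \<open>z\<close> accumulating at the centre contains all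
  Taylor coefficients: each one is the limit of the divided remainders
  \<open>(F z - \<Sum>\<^bsub>l<j\<^esub> (z - c)\<^sup>l u\<^sub>l) / (z - c)\<^sup>j\<close>, where the lower coefficients \<open>u\<^sub>l\<close> are known to lie
  in the subspace already.
\<close>
lemma coefficient_mem:
  assumes W: "closed W" "cfam.subspace W" and acc: "c islimpt \<Lambda>"
    and mem: "\<And>z. z \<in> \<Lambda> \<Longrightarrow> z \<in> ball c r \<Longrightarrow> F z \<in> W"
  shows "coefficient j \<in> W"
proof (induction j rule: less_induct)
  case (less j)
  define s where "s = r / 2"
  have s: "0 < s" "s < r"
    using radius_pos by (auto simp: s_def)
  define K where "K = 2 * B / s ^ Suc j"
  have K: "0 \<le> K"
    using bound_nonneg s by (simp add: K_def)
  have "\<exists>y\<in>W. dist y (coefficient j) < e" if e: "e > 0" for e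
  proof -
    \<comment> \<open>Up to \<open>s / 2\<close> the geometric tail costs a factor of at most \<open>2\<close>, hence the constant \<open>K\<close>.\<close>
    define d where "d = min (s / 2) (e / (K + 1))"
    have "d > 0"
      using s e K by (simp add: d_def)
    with acc obtain w where w: "w \<in> \<Lambda>" "w \<noteq> c" "dist w c < d"
      unfolding islimpt_approachable by blast
    define \<delta> where "\<delta> = dist w c"
    have \<delta>: "0 < \<delta>" "\<delta> < s / 2" "\<delta> < e / (K + 1)"
      using w by (auto simp: \<delta>_def d_def)
    define v where "v = F w - (\<Sum>l<j. cscale ((w - c) ^ l) (coefficient l))"
    define y where "y = cscale (inverse ((w - c) ^ j)) v"
    have "F w \<in> W"
      using w \<delta> s by (intro mem) (auto simp: \<delta>_def dist_commute)
    then have "v \<in> W"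
      unfolding v_def using W(2) less
      by (intro cfam.subspace_diff cfam.subspace_sum cfam.subspace_scale) auto
    then have "y \<in> W"
      unfolding y_def using W(2) by (intro cfam.subspace_scale)
    moreover have "dist y (coefficient j) < e"
    proof -
      \<comment> \<open>The coefficient becomes one more summand of the Taylor polynomial.\<close>
      have "y - coefficient j
          = cscale (inverse ((w - c) ^ j)) (F w - (\<Sum>l<Suc j. cscale ((w - c) ^ l) (coefficient l)))"
        using w(2) by (simp add: y_def v_def cfam.scale_right_diff_distrib algebra_simps)
      then have "dist y (coefficient j)
          = inverse (\<delta> ^ j) * norm (F w - (\<Sum>l<Suc j. cscale ((w - c) ^ l) (coefficient l)))"
        by (simp only: dist_norm norm_cscale norm_inverse norm_power \<delta>_def)
      also have "\<dots> \<le> inverse (\<delta> ^ j) * (B * (\<delta> / s) ^ Suc j / (1 - \<delta> / s))"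
        unfolding \<delta>_def using \<delta> s
        by (intro mult_left_mono remainder_bound) (auto simp: \<delta>_def)
      also have "\<dots> \<le> inverse (\<delta> ^ j) * (B * (\<delta> / s) ^ Suc j / (1 / 2))"
        using \<delta> s bound_nonneg by (intro mult_left_mono divide_left_mono) (auto simp: field_simps)
      also have "\<dots> = K * \<delta>"
        using \<delta> s by (simp add: K_def field_simps power_divide)
      also have "\<dots> \<le> (K + 1) * \<delta>"
        using \<delta> by simp
      also have "\<dots> < e"
        using \<delta>(3) K by (simp add: field_simps)
      finally show ?thesis .
    qed
    ultimately show ?thesis by blast
  qed
  then show ?case
    using closed_approachable[OF W(1)] by blast
qed

text \<open>
  A vector-valued identity theorem.  It takes the place of the usual argument that composes the
  family with a continuous functional and applies the scalar identity theorem.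
\<close>
lemma mem_closed_subspace:
  assumes W: "closed W" "cfam.subspace W" and acc: "c islimpt \<Lambda>"
    and mem: "\<And>z. z \<in> \<Lambda> \<Longrightarrow> z \<in> ball c r \<Longrightarrow> F z \<in> W"
    and w: "w \<in> ball c r"
  shows "F w \<in> W"
proof -
  define s where "s = (dist w c + r) / 2"
  have s: "s < r" "dist w c < s"
    using w by (auto simp: s_def dist_commute)
  define q where "q = dist w c / s"
  have "0 < s"
    using s zero_le_dist[of w c] by linarith
  then have q: "0 \<le> q" "q < 1"
    using s by (auto simp: q_def)
  have "(\<lambda>j. B * q ^ j / (1 - q)) \<longlonglongrightarrow> B * 0 / (1 - q)"
    using q by (intro tendsto_intros LIMSEQ_power_zero) auto
  then have "(\<lambda>j. F w - (\<Sum>l<j. cscale ((w - c) ^ l) (coefficient l))) \<longlonglongrightarrow> 0"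
    by (intro Lim_null_comparison[OF always_eventually[OF allI[OF remainder_bound[OF s]]]])
      (simp add: q_def)
  then have "(\<lambda>j. F w - (F w - (\<Sum>l<j. cscale ((w - c) ^ l) (coefficient l)))) \<longlonglongrightarrow> F w - 0"
    by (intro tendsto_intros)
  then have "(\<lambda>j. \<Sum>l<j. cscale ((w - c) ^ l) (coefficient l)) \<longlonglongrightarrow> F w"
    by simp
  then show ?thesis
  proof (rule closed_sequentially[OF W(1), rotated])
    show "(\<Sum>l<j. cscale ((w - c) ^ l) (coefficient l)) \<in> W" for j
      using W(2) coefficient_mem[OF W acc mem]
      by (intro cfam.subspace_sum cfam.subspace_scale) auto
  qed
qed

end

section \<open>Chaos from a holomorphic family of eigenvectors\<close>

text \<open>
  Finite combinations with coefficients from a countable dense set of complex numbers suffice.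
\<close>
lemma countable_dense_in_span:
  assumes "countable S"
  obtains D where "countable D" "D \<subseteq> cfam.span S" "cfam.span S \<subseteq> closure D"
proof -
  obtain Q :: "complex set" where Q: "countable Q" "\<And>X. open X \<Longrightarrow> X \<noteq> {} \<Longrightarrow> \<exists>q\<in>Q. q \<in> X"
    using countable_dense_exists by blast
  define comb where "comb xs = (\<Sum>(c, v)\<leftarrow>xs. cscale c v)" for xs :: "(complex \<times> ('a \<Rightarrow>\<^sub>C complex)) list"
  define D where "D = comb ` lists (Q \<times> S)"
  show ?thesis
  proof
    show "countable D"
      unfolding D_def using Q(1) assms by (intro countable_image countable_lists countable_SIGMA)
    show "D \<subseteq> cfam.span S"
    proof -
      have "comb xs \<in> cfam.span S" if "xs \<in> lists (Q \<times> S)" for xs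
        using that by (induction xs) (auto simp: comb_def cfam.span_zero cfam.span_add cfam.span_scale cfam.span_base)
      then show ?thesis by (auto simp: D_def)
    qed
    show "cfam.span S \<subseteq> closure D"
    proof
      fix x assume "x \<in> cfam.span S"
      then have "\<forall>e>0. \<exists>d\<in>D. dist d x < e"
      proof (induction x rule: cfam.span_induct_alt)
        case base
        have "0 \<in> D"
          unfolding D_def by (rule image_eqI[of _ _ "[]"]) (auto simp: comb_def)
        then show ?case by (metis dist_self)
      next
        case (step c x y)
        show ?case
        proof (intro allI impI)
          fix e :: real assume e: "e > 0"
          obtain d where d: "d \<in> D" "dist d y < e / 2"
            using step(2) e half_gt_zero by blast
          define \<delta> where "\<delta> = e / (2 * (norm x + 1))"
          have "\<delta> > 0" using e by (simp add: \<delta>_def add_nonneg_pos)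
          then obtain q where q: "q \<in> Q" "dist q c < \<delta>"
            using Q(2)[of "ball c \<delta>"] by (auto simp: dist_commute)
          obtain xs where xs: "xs \<in> lists (Q \<times> S)" "d = comb xs"
            using d by (auto simp: D_def)
          have "cscale q x + d \<in> D"
            unfolding D_def
            by (rule image_eqI[of _ _ "(q, x) # xs"]) (use xs q step(1) in \<open>auto simp: comb_def\<close>)
          moreover have "dist (cscale q x + d) (cscale c x + y) < e"
          proof -
            have "dist (cscale q x + d) (cscale c x + y) = norm (cscale (q - c) x + (d - y))"
              by (simp add: dist_norm cfam.scale_left_diff_distrib algebra_simps)
            also have "\<dots> \<le> norm (q - c) * norm x + norm (d - y)"
              using norm_triangle_ineq[of "cscale (q - c) x" "d - y"] by (simp add: norm_cscale)
            also have "norm (q - c) * norm x \<le> \<delta> * (norm x + 1)"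
              using q(2) \<open>\<delta> > 0\<close> by (intro mult_mono) (auto simp: dist_norm)
            also have "\<delta> * (norm x + 1) = e / 2"
            proof -
              have "norm x + 1 \<noteq> 0"
                using norm_ge_zero[of x] by linarith
              then show ?thesis by (simp add: \<delta>_def divide_simps)
            qed
            also have "norm (d - y) < e / 2"
              using d(2) by (simp add: dist_norm)
            finally show ?thesis by simp
          qed
          ultimately show "\<exists>d\<in>D. dist d (cscale c x + y) < e" by blast
        qed
      qed
      then show "x \<in> closure D"
        by (simp add: closure_approachable)
    qed
  qed
qed

text \<open>
  Birkhoff's transitivity theorem.  For a fixed target and tolerance, the points whose orbit
  comes near the target form an open set, and transitivity makes it dense.  The Baire category
  theorem provides a point common to the countably many sets that belong to the targets in \<open>D\<close>.
\<close>
lemma (in bounded_operator) dense_orbit_if_transitive: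
  assumes Y: "closed Y" "Y \<noteq> {}" and D: "countable D" "D \<subseteq> Y" "Y \<subseteq> closure D"
    and trans: "\<And>x y e. x \<in> Y \<Longrightarrow> y \<in> Y \<Longrightarrow> e > 0 \<Longrightarrow>
      \<exists>z\<in>Y. dist z x < e \<and> (\<exists>t\<ge>0. dist (op_exp L t z) y < e)"
  obtains x where "x \<in> Y" "\<And>y e. y \<in> Y \<Longrightarrow> e > 0 \<Longrightarrow> \<exists>t\<ge>0. dist (op_exp L t x) y < e"
proof -
  define G where "G y n = {x \<in> Y. \<exists>t\<ge>0. dist (op_exp L t x) y < 1 / Suc n}" for y and n :: nat
  define \<G> where "\<G> = (\<lambda>(y, n). G y n) ` (D \<times> UNIV)"
  have "top_of_set Y closure_of \<Inter>\<G> = topspace (top_of_set Y)"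
  proof (rule Baire_category)
    show "completely_metrizable_space (top_of_set Y) \<or>
        locally_compact_space (top_of_set Y) \<and> regular_space (top_of_set Y)"
      using Y(1) completely_metrizable_space_closedin[OF completely_metrizable_space_euclidean] closed_closedin
      by blast
    show "countable \<G>"
      unfolding \<G>_def using D(1) by (intro countable_image countable_SIGMA) auto
    fix T assume "T \<in> \<G>"
    then obtain y n where y: "y \<in> D" and T: "T = G y n"
      by (auto simp: \<G>_def)
    have "open (\<Union>t\<in>{0..}. {x. dist (op_exp L t x) y < 1 / Suc n})"
      by (intro open_UN ballI open_Collect_less continuous_intros
          bounded_linear.continuous_on[OF bounded_linear_op_exp])
    moreover have "T = Y \<inter> (\<Union>t\<in>{0..}. {x. dist (op_exp L t x) y < 1 / Suc n})"
      by (auto simp: T G_def)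
    ultimately have "openin (top_of_set Y) T"
      by (metis openin_open_Int)
    moreover have "Y \<subseteq> closure T"
    proof
      fix x assume x: "x \<in> Y"
      show "x \<in> closure T"
        unfolding closure_approachable
      proof (intro allI impI)
        fix e :: real assume e: "e > 0"
        have "min e (1 / Suc n) > 0" using e by simp
        from trans[OF x subsetD[OF D(2) y] this]
        obtain z t where "z \<in> Y" "dist z x < e" "t \<ge> 0" "dist (op_exp L t z) y < 1 / Suc n"
          by auto
        then show "\<exists>z\<in>T. dist z x < e"
          unfolding T G_def by blast
      qed
    qed
    moreover have "T \<subseteq> Y" by (auto simp: T G_def)
    ultimately show "openin (top_of_set Y) T \<and> top_of_set Y closure_of T = topspace (top_of_set Y)"
      by (simp add: closure_of_subtopology Int_absorb1 Int_absorb2)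
  qed
  then have "\<Inter>\<G> \<inter> Y \<noteq> {}"
    using Y(2) by (auto simp: closure_of_subtopology Int_commute)
  then obtain x where x: "x \<in> Y" "x \<in> \<Inter>\<G>" by blast
  show ?thesis
  proof
    show "x \<in> Y" by fact
    fix y e assume y: "y \<in> Y" and e: "(e::real) > 0"
    obtain d where d: "d \<in> D" "dist d y < e / 2"
      using subsetD[OF D(3) y] e unfolding closure_approachable by (meson half_gt_zero)
    obtain n where n: "1 / Suc n < e / 2"
      using e half_gt_zero nat_approx_posE by blast
    have "x \<in> G d n"
      using x(2) d(1) by (auto simp: \<G>_def)
    then obtain t where t: "t \<ge> 0" "dist (op_exp L t x) d < e / 2"
      using n unfolding G_def by fastforce
    then have "dist (op_exp L t x) y < e"
      using d(2) dist_triangle[of "op_exp L t x" y d] by simp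
    with t show "\<exists>t\<ge>0. dist (op_exp L t x) y < e" by blast
  qed
qed

instance bcontfun :: (metric_space, banach) banach ..

lemma op_exp_cscale:
  fixes L :: "('i::metric_space \<Rightarrow>\<^sub>C complex) \<Rightarrow> ('i \<Rightarrow>\<^sub>C complex)"
  assumes "bounded_operator L M" and complex_linear: "\<And>a x. L (cscale a x) = cscale a (L x)"
  shows "op_exp L t (cscale a x) = cscale a (op_exp L t x)"
proof -
  interpret bounded_operator L M by fact
  have "(L ^^ k) (cscale a x) = cscale a ((L ^^ k) x)" for k
    by (induction k) (simp_all add: complex_linear)
  then have "(\<lambda>k. cscale a ((t ^ k / fact k) *\<^sub>R (L ^^ k) x)) sums op_exp L t (cscale a x)"
    using op_exp_sums[of t "cscale a x"] by (simp add: scaleR_eq_cscale mult.commute)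
  moreover have "(\<lambda>k. cscale a ((t ^ k / fact k) *\<^sub>R (L ^^ k) x)) sums cscale a (op_exp L t x)"
    by (rule bounded_linear.sums[OF bounded_linear_cscale op_exp_sums])
  ultimately show ?thesis
    by (rule sums_unique2)
qed

text \<open>
  The eigenvalue itself is the parameter of the family.  As the centre lies on the imaginary axis,
  it is an accumulation point of the decaying, of the growing and of the periodic eigenvalues.
\<close>
locale eigenvector_family =
  bounded_operator L M + holomorphic_family F c r B
  for L :: "('i::{discrete_topology, metric_space} \<Rightarrow>\<^sub>C complex) \<Rightarrow> ('i \<Rightarrow>\<^sub>C complex)" and M and F :: "complex \<Rightarrow> ('i \<Rightarrow>\<^sub>C complex)" and c r B +
  assumes complex_linear: "L (cscale a x) = cscale a (L x)"
    and eigenvector: "\<mu> \<in> ball c r \<Longrightarrow> L (F \<mu>) = cscale \<mu> (F \<mu>)"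
    and imaginary_center: "Re c = 0"
begin

definition eigenspace :: "('i \<Rightarrow>\<^sub>C complex) set" where
  "eigenspace = closure (cfam.span (F ` ball c r))"

lemma closed_eigenspace: "closed eigenspace"
  by (simp add: eigenspace_def)

lemma subspace_eigenspace: "cfam.subspace eigenspace"
  unfolding eigenspace_def by (intro cfam_subspace_closure cfam.subspace_span)

lemma span_subset_eigenspace: "\<Lambda> \<subseteq> ball c r \<Longrightarrow> cfam.span (F ` \<Lambda>) \<subseteq> eigenspace"
  unfolding eigenspace_def by (meson cfam.span_mono closure_subset image_mono order_trans)

text \<open>
  By the identity theorem, eigenvectors for any set of eigenvalues that accumulates at the centre
  already span the whole space.
\<close>
lemma eigenspace_subset_closure_span:
  assumes "c islimpt \<Lambda>"
  shows "eigenspace \<subseteq> closure (cfam.span (F ` (\<Lambda> \<inter> ball c r)))"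
proof -
  define W where "W = closure (cfam.span (F ` (\<Lambda> \<inter> ball c r)))"
  have W: "closed W" "cfam.subspace W"
    by (auto simp: W_def intro!: cfam_subspace_closure cfam.subspace_span)
  have "F z \<in> W" if "z \<in> \<Lambda>" "z \<in> ball c r" for z
    unfolding W_def using that by (intro subsetD[OF closure_subset] cfam.span_base) blast
  then have "F ` ball c r \<subseteq> W"
    using mem_closed_subspace[OF W assms] by blast
  then show ?thesis
    unfolding eigenspace_def W_def[symmetric]
    by (intro closure_minimal W(1) cfam.span_minimal W(2))
qed

lemma L_mem_eigenspace: "x \<in> eigenspace \<Longrightarrow> L x \<in> eigenspace"
proof -
  assume x: "x \<in> eigenspace"
  have "L y \<in> cfam.span (F ` ball c r)" if "y \<in> cfam.span (F ` ball c r)" for y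
    using that
  proof (induction y rule: cfam.span_induct_alt)
    case (step a x y)
    then obtain \<mu> where \<mu>: "x = F \<mu>" "\<mu> \<in> ball c r"
      by blast
    have "F \<mu> \<in> cfam.span (F ` ball c r)"
      using \<mu>(2) by (intro cfam.span_base imageI)
    then show ?case
      using step(2) by (simp add: add complex_linear \<mu>(1) eigenvector[OF \<mu>(2)] cfam.span_add cfam.span_scale)
  qed (simp add: zero cfam.span_zero)
  then have "L ` closure (cfam.span (F ` ball c r)) \<subseteq> eigenspace"
    unfolding eigenspace_def
    by (intro image_closure_subset linear_continuous_on bounded_linear_axioms)
      (use closure_subset in auto)
  with x show ?thesis
    by (auto simp: eigenspace_def)
qed

lemma op_exp_mem_eigenspace: "x \<in> eigenspace \<Longrightarrow> op_exp L t x \<in> eigenspace"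
  by (rule op_exp_mem_closed[OF closed_eigenspace subspace_of_complex[OF subspace_eigenspace] L_mem_eigenspace])

lemma op_exp_eigenvector:
  assumes "\<mu> \<in> ball c r"
  shows "op_exp L t (F \<mu>) = cscale (exp (\<mu> * of_real t)) (F \<mu>)"
proof -
  have pow: "(L ^^ k) (F \<mu>) = cscale (\<mu> ^ k) (F \<mu>)" for k
    by (induction k) (simp_all add: complex_linear eigenvector[OF assms] mult.commute)
  have "(t ^ k / fact k) *\<^sub>R (L ^^ k) (F \<mu>) = cscale ((\<mu> * of_real t) ^ k /\<^sub>R fact k) (F \<mu>)" for k
    by (simp add: pow scaleR_eq_cscale scaleR_conv_of_real power_mult_distrib divide_inverse ac_simps)
  then have "(\<lambda>k. cscale ((\<mu> * of_real t) ^ k /\<^sub>R fact k) (F \<mu>)) sums op_exp L t (F \<mu>)"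
    using op_exp_sums[of t "F \<mu>"] by simp
  moreover have "(\<lambda>k. cscale ((\<mu> * of_real t) ^ k /\<^sub>R fact k) (F \<mu>)) sums
      cscale (exp (\<mu> * of_real t)) (F \<mu>)"
    by (rule bounded_linear.sums[OF bounded_linear_cscale_left exp_converges])
  ultimately show ?thesis
    by (rule sums_unique2)
qed

lemmas op_exp_cscale' = op_exp_cscale[OF bounded_operator_axioms complex_linear]

lemma op_exp_linear: "op_exp L t (cscale a x + y) = cscale a (op_exp L t x) + op_exp L t y"
  by (simp add: linear_simps(1)[OF bounded_linear_op_exp] op_exp_cscale')

lemma exp_decay:
  assumes "Re \<mu> < 0"
  shows "((\<lambda>t. exp (\<mu> * complex_of_real t)) \<longlongrightarrow> 0) at_top"
proof -
  have "((\<lambda>t. exp (Re \<mu> * t)) \<longlongrightarrow> 0) at_top"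
    by (intro filterlim_compose[OF exp_at_bot] filterlim_tendsto_neg_mult_at_bot[OF tendsto_const assms] filterlim_ident)
  then show ?thesis
    by (intro tendsto_norm_zero_cancel[of "\<lambda>t. exp (\<mu> * complex_of_real t)"]) simp
qed

lemma tendsto_cscale_zero:
  assumes "(f \<longlongrightarrow> 0) A"
  shows "((\<lambda>t. cscale (f t) x) \<longlongrightarrow> 0) A"
  using bounded_linear.tendsto[OF bounded_linear_cscale_left assms, of x] by simp

lemma stable_span:
  assumes "x \<in> cfam.span (F ` ({\<mu>. Re \<mu> < 0} \<inter> ball c r))"
  shows "((\<lambda>t. op_exp L t x) \<longlongrightarrow> 0) at_top"
  using assms
proof (induction x rule: cfam.span_induct_alt)
  case (step a x y)
  then obtain \<mu> where \<mu>: "x = F \<mu>" "Re \<mu> < 0" "\<mu> \<in> ball c r" by auto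
  have "((\<lambda>t. cscale a (op_exp L t x)) \<longlongrightarrow> 0) at_top"
    using bounded_linear.tendsto[OF bounded_linear_cscale tendsto_cscale_zero[OF exp_decay[OF \<mu>(2)]], of a "F \<mu>"]
    by (simp add: \<mu>(1) op_exp_eigenvector[OF \<mu>(3)])
  from tendsto_add[OF this step(2)] show ?case
    by (simp add: op_exp_linear)
qed (simp add: linear_simps(3)[OF bounded_linear_op_exp])

text \<open>
  The function \<open>g\<close> is a backward orbit of \<open>x\<close>: an eigenvector for \<open>\<mu>\<close> has the preimage under the
  semigroup at time \<open>t\<close> obtained by scaling with \<open>exp (- \<mu> t)\<close>, which tends to \<open>0\<close> if \<open>Re \<mu> > 0\<close>.
\<close>
lemma unstable_span:
  assumes "x \<in> cfam.span (F ` ({\<mu>. Re \<mu> > 0} \<inter> ball c r))"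
  shows "\<exists>g. (g \<longlongrightarrow> 0) at_top \<and> (\<forall>t. g t \<in> eigenspace \<and> op_exp L t (g t) = x)"
  using assms
proof (induction x rule: cfam.span_induct_alt)
  case base
  show ?case
    by (intro exI[of _ "\<lambda>_. 0"])
      (simp add: linear_simps(3)[OF bounded_linear_op_exp] cfam.subspace_0[OF subspace_eigenspace])
next
  case (step a x y)
  then obtain \<mu> where \<mu>: "x = F \<mu>" "Re \<mu> > 0" "\<mu> \<in> ball c r" by auto
  obtain g where g: "(g \<longlongrightarrow> 0) at_top" "\<And>t. g t \<in> eigenspace" "\<And>t. op_exp L t (g t) = y"
    using step by blast
  define h where "h t = cscale a (cscale (exp (- \<mu> * of_real t)) x)" for t
  have "F \<mu> \<in> eigenspace"
    using span_subset_eigenspace[of "{\<mu>}"] \<mu>(3) cfam.span_base[of "F \<mu>" "F ` {\<mu>}"] by auto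
  then have "h t + g t \<in> eigenspace" for t
    unfolding h_def \<mu>(1) using g(2)
    by (intro cfam.subspace_add[OF subspace_eigenspace] cfam.subspace_scale[OF subspace_eigenspace])
  moreover have "op_exp L t (h t + g t) = cscale a x + y" for t
    unfolding h_def op_exp_linear g(3)
    by (simp add: op_exp_cscale' \<mu>(1) op_exp_eigenvector[OF \<mu>(3)] exp_minus)
  moreover have "((\<lambda>t. h t + g t) \<longlongrightarrow> 0) at_top"
  proof -
    have "((\<lambda>t. exp (- \<mu> * complex_of_real t)) \<longlongrightarrow> 0) at_top"
      using exp_decay[of "- \<mu>"] \<mu>(2) by simp
    from bounded_linear.tendsto[OF bounded_linear_cscale tendsto_cscale_zero[OF this]]
    have "(h \<longlongrightarrow> 0) at_top"
      unfolding h_def by simp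
    from tendsto_add[OF this g(1)] show ?thesis by simp
  qed
  ultimately show ?case by blast
qed

text \<open>
  The numbers \<open>\<mu>\<close> with \<open>exp (N \<mu>) = 1\<close> for some positive integer \<open>N\<close>.
\<close>
definition rational_rotations :: "complex set" where
  "rational_rotations = range (\<lambda>q :: rat. 2 * pi * \<i> * of_real (of_rat q))"

text \<open>
  Integer periods of finitely many eigenvectors have a common multiple.  The induction carries
  all multiples of a period along because a product of two periods is used for the sum.
\<close>
lemma periodic_span:
  assumes "x \<in> cfam.span (F ` (rational_rotations \<inter> ball c r))"
  shows "\<exists>N>0. \<forall>k::nat. op_exp L (real (N * k)) x = x"
  using assms
proof (induction x rule: cfam.span_induct_alt)
  case base
  show ?case
    by (intro exI[of _ 1]) (simp add: linear_simps(3)[OF bounded_linear_op_exp])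
next
  case (step a x y)
  then obtain q where q: "x = F (2 * pi * \<i> * of_real (of_rat q))"
      "2 * pi * \<i> * of_real (of_rat q) \<in> ball c r"
    by (auto simp: rational_rotations_def)
  obtain N where N: "N > 0" "\<And>k::nat. op_exp L (real (N * k)) y = y"
    using step(2) by auto
  obtain n d where nd: "quotient_of q = (n, d)" by fastforce
  then have d: "d > 0" "q = of_int n / of_int d"
    using quotient_of_denom_pos[OF nd] quotient_of_div[OF nd] by simp_all
  define K where "K = nat d"
  have K: "K > 0" "of_int d = (of_nat K :: real)"
    using d(1) by (auto simp: K_def)
  have "op_exp L (real (N * K * k)) (cscale a x + y) = cscale a x + y" for k
  proof -
    have "op_exp L (real (N * (K * k))) y = y"
      using N(2)[of "K * k"] .
    moreover have "op_exp L (real (K * (N * k))) x = x"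
    proof -
      have "complex_of_real (of_rat q) * of_nat K = of_int n"
      proof -
        have "of_rat q * real K = of_int n"
          unfolding d(2) of_rat_divide of_rat_of_int_eq K(2) using K(1) by simp
        then show ?thesis
          by (metis of_real_mult of_real_of_int_eq of_real_of_nat_eq)
      qed
      then have "2 * pi * \<i> * of_real (of_rat q) * of_real (real (K * (N * k)))
          = complex_of_real (2 * of_int (n * int (N * k)) * pi) * \<i>"
        by (simp add: algebra_simps)
      moreover have "exp (complex_of_real (2 * of_int (n * int (N * k)) * pi) * \<i>) = 1"
        by (rule exp_integer_2pi) auto
      ultimately show ?thesis
        by (simp only: q(1) op_exp_eigenvector[OF q(2)] cfam.scale_one)
    qed
    moreover have "N * K * k = N * (K * k)" "K * (N * k) = N * (K * k)"
      by (simp_all add: ac_simps)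
    ultimately show ?thesis
      by (simp only: op_exp_linear)
  qed
  then show ?case
    using N(1) K(1) by (intro exI[of _ "N * K"]) simp
qed

lemma center_islimptI:
  assumes "\<And>e. e > 0 \<Longrightarrow> \<exists>s. 0 < s \<and> s < e \<and> c + of_real s * a \<in> \<Lambda>" "norm a = 1"
  shows "c islimpt \<Lambda>"
  unfolding islimpt_approachable
proof (intro allI impI)
  fix e :: real assume "e > 0"
  then obtain s where "0 < s" "s < e" "c + of_real s * a \<in> \<Lambda>"
    using assms by blast
  then show "\<exists>z\<in>\<Lambda>. z \<noteq> c \<and> dist z c < e"
    using assms(2) by (intro bexI[of _ "c + of_real s * a"]) (auto simp: dist_norm norm_mult)
qed

lemma center_islimpt_stable: "c islimpt {\<mu>. Re \<mu> < 0}"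
proof (rule center_islimptI[where a = "-1"])
  show "\<exists>s. 0 < s \<and> s < e \<and> c + complex_of_real s * - 1 \<in> {\<mu>. Re \<mu> < 0}" if "e > 0" for e
    using that imaginary_center by (intro exI[of _ "e / 2"]) auto
qed simp

lemma center_islimpt_unstable: "c islimpt {\<mu>. Re \<mu> > 0}"
proof (rule center_islimptI[where a = 1])
  show "\<exists>s. 0 < s \<and> s < e \<and> c + complex_of_real s * 1 \<in> {\<mu>. Re \<mu> > 0}" if "e > 0" for e
    using that imaginary_center by (intro exI[of _ "e / 2"]) auto
qed simp

lemma center_islimpt_rotations: "c islimpt rational_rotations"
proof (rule center_islimptI[where a = \<i>])
  fix e :: real assume e: "e > 0"
  obtain q where q: "Im c / (2 * pi) < of_rat q" "of_rat q < (Im c + e) / (2 * pi)"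
    using of_rat_dense[of "Im c / (2 * pi)" "(Im c + e) / (2 * pi)"] e
    by (auto simp: divide_strict_right_mono)
  define s where "s = 2 * pi * of_rat q - Im c"
  have "0 < s" "s < e"
    using q by (simp_all add: s_def field_simps)
  moreover have "c + of_real s * \<i> = 2 * pi * \<i> * of_real (of_rat q)"
    using imaginary_center by (simp add: complex_eq_iff s_def)
  then have "c + of_real s * \<i> \<in> rational_rotations"
    unfolding rational_rotations_def by blast
  ultimately show "\<exists>s. 0 < s \<and> s < e \<and> c + complex_of_real s * \<i> \<in> rational_rotations"
    by blast
qed simp

lemma periodic_dense:
  assumes "y \<in> eigenspace" "e > 0"
  shows "\<exists>x\<in>eigenspace. dist x y < e \<and> (\<exists>t>0. op_exp L t x = x)"
proof -
  have "y \<in> closure (cfam.span (F ` (rational_rotations \<inter> ball c r)))"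
    using eigenspace_subset_closure_span[OF center_islimpt_rotations] assms(1) by blast
  then obtain x where x: "x \<in> cfam.span (F ` (rational_rotations \<inter> ball c r))" "dist x y < e"
    using assms(2) unfolding closure_approachable by blast
  obtain N where "N > 0" "op_exp L (real N) x = x"
    using periodic_span[OF x(1)] mult_1_right by metis
  moreover have "x \<in> eigenspace"
    using x(1) span_subset_eigenspace[of "rational_rotations \<inter> ball c r"] by auto
  ultimately show ?thesis
    using x(2) of_nat_0_less_iff[of N] by blast
qed

text \<open>
  Near \<open>x\<close> there is a combination \<open>x'\<close> of decaying eigenvectors, and near \<open>y\<close> a combination \<open>y'\<close>
  of growing ones.  For large \<open>t\<close> the point \<open>x' + g t\<close>, with \<open>g\<close> a backward orbit of \<open>y'\<close>, is still
  near \<open>x\<close> and is moved near \<open>y\<close> in time \<open>t\<close>.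
\<close>
lemma transitive:
  assumes "x \<in> eigenspace" "y \<in> eigenspace" "e > 0"
  shows "\<exists>z\<in>eigenspace. dist z x < e \<and> (\<exists>t\<ge>0. dist (op_exp L t z) y < e)"
proof -
  have e2: "e / 2 > 0" using assms(3) by simp
  obtain x' where x': "x' \<in> cfam.span (F ` ({\<mu>. Re \<mu> < 0} \<inter> ball c r))" "dist x' x < e / 2"
    using closure_approachableD[OF subsetD[OF eigenspace_subset_closure_span[OF center_islimpt_stable] assms(1)] e2]
    by (metis dist_commute)
  obtain y' where y': "y' \<in> cfam.span (F ` ({\<mu>. Re \<mu> > 0} \<inter> ball c r))" "dist y' y < e / 2"
    using closure_approachableD[OF subsetD[OF eigenspace_subset_closure_span[OF center_islimpt_unstable] assms(2)] e2]
    by (metis dist_commute)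
  obtain g where g: "(g \<longlongrightarrow> 0) at_top" "\<And>t. g t \<in> eigenspace" "\<And>t. op_exp L t (g t) = y'"
    using unstable_span[OF y'(1)] by blast
  have "\<forall>\<^sub>F t in at_top. norm (g t) < e / 2 \<and> norm (op_exp L t x') < e / 2 \<and> t \<ge> 0"
    using tendstoD[OF g(1) e2] tendstoD[OF stable_span[OF x'(1)] e2] eventually_ge_at_top[of 0]
    by eventually_elim simp
  then obtain t where t: "norm (g t) < e / 2" "norm (op_exp L t x') < e / 2" "t \<ge> 0"
    using eventually_happens'[OF trivial_limit_at_top_linorder] by blast
  show ?thesis
  proof (intro bexI conjI exI)
    show "x' + g t \<in> eigenspace"
      using x'(1) span_subset_eigenspace[of "{\<mu>. Re \<mu> < 0} \<inter> ball c r"] g(2)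
      by (intro cfam.subspace_add[OF subspace_eigenspace]) auto
    show "dist (x' + g t) x < e"
      using norm_triangle_ineq[of "x' - x" "g t"] x'(2) t(1) by (simp add: dist_norm algebra_simps)
    have "op_exp L t (x' + g t) - y = op_exp L t x' + (y' - y)"
      by (simp add: linear_simps(1)[OF bounded_linear_op_exp] g(3))
    then show "dist (op_exp L t (x' + g t)) y < e"
      using norm_triangle_ineq[of "op_exp L t x'" "y' - y"] y'(2) t(2) by (simp add: dist_norm algebra_simps)
    show "t \<ge> 0" by fact
  qed
qed

lemma dense_orbit:
  obtains x where "x \<in> eigenspace"
    "\<And>y e. y \<in> eigenspace \<Longrightarrow> e > 0 \<Longrightarrow> \<exists>t\<ge>0. dist (op_exp L t x) y < e"
proof -
  have "countable (F ` (rational_rotations \<inter> ball c r))"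
    by (auto simp: rational_rotations_def intro!: countable_image countable_Int1)
  then obtain D where D: "countable D" "D \<subseteq> cfam.span (F ` (rational_rotations \<inter> ball c r))"
      "cfam.span (F ` (rational_rotations \<inter> ball c r)) \<subseteq> closure D"
    by (rule countable_dense_in_span)
  show ?thesis
  proof (rule dense_orbit_if_transitive[OF closed_eigenspace _ D(1) _ _ transitive])
    show "eigenspace \<noteq> {}"
      using cfam.subspace_0[OF subspace_eigenspace] by blast
    show "D \<subseteq> eigenspace"
      using D(2) span_subset_eigenspace[of "rational_rotations \<inter> ball c r"] by auto
    show "eigenspace \<subseteq> closure D"
      using eigenspace_subset_closure_span[OF center_islimpt_rotations]
        closure_minimal[OF D(3) closed_closure] by blast
  qed (use that in auto)
qed

end

section \<open>Holomorphic branches of an algebraic curve\<close>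

text \<open>
  A polynomial in the second variable of a curve, with coefficients depending holomorphically on
  the first.  The number \<open>D\<close> bounds the degree, which may drop for particular parameters.
\<close>
definition polynomial_family :: "nat \<Rightarrow> (complex \<Rightarrow> complex poly) \<Rightarrow> bool" where
  "polynomial_family D Q \<longleftrightarrow>
     (\<forall>l. degree (Q l) \<le> D) \<and> (\<forall>j. (\<lambda>l. coeff (Q l) j) holomorphic_on UNIV)"

lemma polynomial_family_pderiv:
  "polynomial_family D Q \<Longrightarrow> polynomial_family (D - 1) (\<lambda>l. pderiv (Q l))"
  unfolding polynomial_family_def coeff_pderiv degree_pderiv
  by (auto intro!: holomorphic_intros diff_le_mono)

lemma polynomial_family_higher_pderiv:
  assumes "polynomial_family D Q"
  shows "polynomial_family (D - k) (\<lambda>l. (pderiv ^^ k) (Q l))"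
proof (induction k)
  case (Suc k)
  then show ?case
    using polynomial_family_pderiv[OF Suc] by simp
qed (use assms in simp)

lemma poly_family_eq:
  assumes "polynomial_family D Q"
  shows "poly (Q l) z = (\<Sum>j\<le>D. coeff (Q l) j * z ^ j)"
proof -
  have "degree (Q l) \<le> D"
    using assms by (simp add: polynomial_family_def)
  then show ?thesis
    unfolding poly_altdef by (intro sum.mono_neutral_left) (auto simp: coeff_eq_0)
qed

lemma holomorphic_on_poly_family:
  assumes "polynomial_family D Q" "h holomorphic_on S"
  shows "(\<lambda>l. poly (Q l) (h l)) holomorphic_on S"
proof -
  have "(\<lambda>l. coeff (Q l) j) holomorphic_on S" for j
    using assms(1) holomorphic_on_subset unfolding polynomial_family_def by blast
  then show ?thesis
    unfolding poly_family_eq[OF assms(1)] by (intro holomorphic_intros assms(2))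
qed

lemma norm_prod_mset_ge:
  fixes A :: "complex multiset"
  assumes "\<And>x. x \<in># A \<Longrightarrow> m \<le> norm (z - x)" "0 \<le> m"
  shows "m ^ size A \<le> norm (\<Prod>x\<in>#A. z - x)"
  using assms(1)
proof (induction A)
  case (add x A)
  then have "m * m ^ size A \<le> norm (z - x) * norm (\<Prod>x\<in>#A. z - x)"
    using assms(2) by (intro mult_mono) auto
  then show ?case by (simp add: norm_mult)
qed simp

text \<open>
  In the factorisation into linear factors, the root closest to \<open>z\<close> contributes the smallest
  factor to \<open>|p(z)|\<close>.
\<close>
lemma exists_root_near:
  fixes p :: "complex poly"
  assumes "degree p > 0"
  shows "\<exists>w. poly p w = 0 \<and> norm (lead_coeff p) * dist z w ^ degree p \<le> norm (poly p z)"
proof -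
  have "p \<noteq> 0" using assms by auto
  then obtain A where A: "size A = degree p" "p = smult (lead_coeff p) (\<Prod>x\<in>#A. [:-x, 1:])"
    using alg_closed_imp_factorization[OF \<open>p \<noteq> 0\<close>] by blast
  have val: "poly p y = lead_coeff p * (\<Prod>x\<in>#A. y - x)" for y
    by (subst A(2)) (simp add: poly_prod_mset)
  have fin: "finite ((\<lambda>x. norm (z - x)) ` set_mset A)" "(\<lambda>x. norm (z - x)) ` set_mset A \<noteq> {}"
    using A(1) assms by auto
  obtain w where w: "w \<in># A" "norm (z - w) = Min ((\<lambda>x. norm (z - x)) ` set_mset A)"
    using Min_in[OF fin] by force
  have "norm (z - w) ^ size A \<le> norm (\<Prod>x\<in>#A. z - x)"
    by (rule norm_prod_mset_ge) (use w fin in auto)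
  then have "norm (lead_coeff p) * norm (z - w) ^ degree p \<le> norm (poly p z)"
    by (simp add: val[of z] norm_mult A(1) mult_left_mono)
  moreover have "poly p w = 0"
    using w(1) by (subst val) (auto simp: prod_mset_zero_iff)
  ultimately show ?thesis
    by (auto simp: dist_norm)
qed

text \<open>
  The value at \<open>z0\<close> stays small and the leading coefficient stays away from \<open>0\<close>, so the closest
  root cannot be far from \<open>z0\<close>.
\<close>
lemma root_persists:
  assumes Q: "polynomial_family D Q" and D: "D > 0" "coeff (Q l0) D \<noteq> 0"
    and root: "poly (Q l0) z0 = 0" and e: "e > 0"
  shows "\<forall>\<^sub>F l in nhds l0. coeff (Q l) D \<noteq> 0 \<and> (\<exists>w. poly (Q l) w = 0 \<and> dist w z0 < e)"
proof -
  have "continuous_on UNIV (\<lambda>l. poly (Q l) z0)"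
    by (intro holomorphic_on_imp_continuous_on holomorphic_on_poly_family[OF Q] holomorphic_on_const)
  moreover have "continuous_on UNIV (\<lambda>l. coeff (Q l) D)"
    using Q holomorphic_on_imp_continuous_on unfolding polynomial_family_def by blast
  ultimately have "open {l. norm (poly (Q l) z0) < norm (coeff (Q l) D) * e ^ D}"
    by (intro open_Collect_less continuous_intros)
  moreover have "norm (poly (Q l0) z0) < norm (coeff (Q l0) D) * e ^ D"
    using root D(2) e by simp
  ultimately have "\<forall>\<^sub>F l in nhds l0. norm (poly (Q l) z0) < norm (coeff (Q l) D) * e ^ D"
    using eventually_nhds_in_open[of "{l. norm (poly (Q l) z0) < norm (coeff (Q l) D) * e ^ D}" l0] by simp
  then show ?thesis
  proof eventually_elim
    case (elim l)
    then have nz: "coeff (Q l) D \<noteq> 0"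
      using norm_ge_zero[of "poly (Q l) z0"] by (auto simp del: norm_ge_zero)
    then have deg: "degree (Q l) = D"
      using Q le_degree[OF nz] unfolding polynomial_family_def by (intro antisym) blast+
    then obtain w where w: "poly (Q l) w = 0" "norm (coeff (Q l) D) * dist z0 w ^ D \<le> norm (poly (Q l) z0)"
      using exists_root_near[of "Q l" z0] D(1) by auto
    have "norm (coeff (Q l) D) * dist z0 w ^ D < norm (coeff (Q l) D) * e ^ D"
      by (rule le_less_trans[OF w(2) elim])
    from mult_left_less_imp_less[OF this norm_ge_zero] have "dist z0 w ^ D < e ^ D" .
    from power_less_imp_less_base[OF this less_imp_le[OF e]] have "dist w z0 < e"
      by (simp only: dist_commute)
    with w(1) nz show ?case
      by blast
  qed
qed

text \<open>
  The divided difference \<open>(f(z) - f(w)) / (z - w)\<close> of a polynomial, continued to the diagonal, is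
  jointly continuous; near a simple root it does not vanish, so that there the root is unique and
  depends on the parameter in a differentiable way.
\<close>
definition divided_diff :: "nat \<Rightarrow> (complex \<Rightarrow> complex poly) \<Rightarrow> complex \<times> complex \<times> complex \<Rightarrow> complex" where
  "divided_diff D Q = (\<lambda>(l, z, w). \<Sum>j\<le>D. coeff (Q l) j * (\<Sum>i<j. w ^ (j - Suc i) * z ^ i))"

lemma divided_diff_eq:
  assumes "polynomial_family D Q"
  shows "poly (Q l) z - poly (Q l) w = (z - w) * divided_diff D Q (l, z, w)"
  unfolding divided_diff_def poly_family_eq[OF assms] prod.case
  by (simp add: sum_distrib_left right_diff_distrib[symmetric] sum_subtractf[symmetric] power_diff_sumr2
      mult.left_commute)

lemma divided_diff_diag:
  assumes "polynomial_family D Q"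
  shows "divided_diff D Q (l, z, z) = poly (pderiv (Q l)) z"
proof (rule DERIV_unique)
  have "((\<lambda>z. \<Sum>j\<le>D. coeff (Q l) j * z ^ j) has_field_derivative
      (\<Sum>j\<le>D. coeff (Q l) j * (of_nat j * z ^ (j - 1)))) (at z)"
    by (auto intro!: derivative_eq_intros sum.cong)
  moreover have "(\<Sum>i<j. z ^ (j - Suc i) * z ^ i) = of_nat j * z ^ (j - 1)" for j
    by (simp flip: power_add)
  ultimately show "((\<lambda>z. poly (Q l) z) has_field_derivative divided_diff D Q (l, z, z)) (at z)"
    by (simp add: divided_diff_def poly_family_eq[OF assms])
  show "((\<lambda>z. poly (Q l) z) has_field_derivative poly (pderiv (Q l)) z) (at z)"
    by (rule poly_DERIV)
qed

lemma continuous_on_divided_diff: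
  assumes "polynomial_family D Q"
  shows "continuous_on UNIV (divided_diff D Q)"
proof -
  have "continuous_on UNIV (\<lambda>l. coeff (Q l) j)" for j
    using assms holomorphic_on_imp_continuous_on unfolding polynomial_family_def by blast
  then have "continuous_on UNIV (\<lambda>x. coeff (Q (fst x)) j)" for j :: nat and x :: "complex \<times> complex \<times> complex"
    by (rule continuous_on_compose2) (auto intro!: continuous_intros)
  then show ?thesis
    unfolding divided_diff_def case_prod_beta by (intro continuous_intros)
qed

lemma isolated_simple_root:
  assumes Q: "polynomial_family D Q" and simple: "poly (pderiv (Q l0)) z0 \<noteq> 0"
  obtains \<delta> where "\<delta> > 0"
    "\<And>l z w. dist l l0 < \<delta> \<Longrightarrow> dist z z0 < \<delta> \<Longrightarrow> dist w z0 < \<delta> \<Longrightarrow> divided_diff D Q (l, z, w) \<noteq> 0"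
proof -
  define S where "S = divided_diff D Q -` (- {0})"
  have "open S"
    unfolding S_def by (rule open_vimage[OF _ continuous_on_divided_diff[OF Q]]) auto
  moreover have "(l0, z0, z0) \<in> S"
    by (simp add: S_def divided_diff_diag[OF Q] simple)
  ultimately obtain e where e: "e > 0" "\<And>x. dist x (l0, z0, z0) < e \<Longrightarrow> x \<in> S"
    unfolding open_dist by blast
  show ?thesis
  proof (rule that[of "e / 3"])
    fix l z w assume "dist l l0 < e / 3" "dist z z0 < e / 3" "dist w z0 < e / 3"
    moreover have "dist (l, z, w) (l0, z0, z0) \<le> dist l l0 + (dist z z0 + dist w z0)"
      unfolding dist_Pair_Pair
      by (rule order_trans[OF sqrt_sum_squares_le_sum])
        (auto intro!: sqrt_sum_squares_le_sum add_left_mono)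
    ultimately have "dist (l, z, w) (l0, z0, z0) < e"
      by linarith
    from e(2)[OF this] show "divided_diff D Q (l, z, w) \<noteq> 0"
      by (simp add: S_def)
  qed (use e in simp)
qed

text \<open>
  Nearby roots exist because roots persist, and they are unique because the divided difference
  does not vanish.  Continuity of the resulting function \<open>h\<close> follows in the same way, and the identity
  \<open>0 = Q\<^sub>l(h l) - Q\<^sub>\<lambda>(h \<lambda>) = (h l - h \<lambda>) K(l, h l, h \<lambda>) + (Q\<^sub>l(h \<lambda>) - Q\<^sub>\<lambda>(h \<lambda>))\<close>, with \<open>K\<close> the divided
  difference, gives the derivative of \<open>h\<close> at \<open>\<lambda>\<close>.
\<close>
lemma implicit_root_function:
  assumes Q: "polynomial_family D Q" and lead: "coeff (Q l0) D \<noteq> 0"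
    and root: "poly (Q l0) z0 = 0" and simple: "poly (pderiv (Q l0)) z0 \<noteq> 0"
  obtains r e h where "r > 0" "e > 0" "h holomorphic_on ball l0 r"
    "\<And>l. l \<in> ball l0 r \<Longrightarrow> poly (Q l) (h l) = 0"
    "\<And>l w. l \<in> ball l0 r \<Longrightarrow> dist w z0 < e \<Longrightarrow> poly (Q l) w = 0 \<Longrightarrow> w = h l"
proof -
  have D: "D > 0"
  proof (rule ccontr)
    assume "\<not> D > 0"
    then have "degree (Q l0) = 0"
      using Q by (auto simp: polynomial_family_def)
    then have "pderiv (Q l0) = 0"
      by (simp only: pderiv_eq_0_iff)
    with simple show False
      by simp
  qed
  obtain \<delta> where \<delta>: "\<delta> > 0" "\<And>l z w. dist l l0 < \<delta> \<Longrightarrow> dist z z0 < \<delta> \<Longrightarrow> dist w z0 < \<delta> \<Longrightarrow>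
      divided_diff D Q (l, z, w) \<noteq> 0"
    using isolated_simple_root[OF Q simple] by blast
  obtain r0 where r0: "r0 > 0" "\<And>l. dist l l0 < r0 \<Longrightarrow> coeff (Q l) D \<noteq> 0 \<and> (\<exists>w. poly (Q l) w = 0 \<and> dist w z0 < \<delta>)"
    using root_persists[OF Q D lead root \<delta>(1)] unfolding eventually_nhds_metric by blast
  define r where "r = min r0 \<delta>"
  have r: "r > 0" "\<And>l. l \<in> ball l0 r \<Longrightarrow> dist l l0 < \<delta> \<and> dist l l0 < r0"
    using r0 \<delta> by (auto simp: r_def dist_commute)
  define h where "h l = (SOME w. poly (Q l) w = 0 \<and> dist w z0 < \<delta>)" for l
  have h: "poly (Q l) (h l) = 0" "dist (h l) z0 < \<delta>" if "l \<in> ball l0 r" for l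
    using someI_ex[OF conjunct2[OF r0(2)[of l]]] r(2)[OF that] by (auto simp: h_def)
  have uniq: "w = h l" if "l \<in> ball l0 r" "dist w z0 < \<delta>" "poly (Q l) w = 0" for l w
    using divided_diff_eq[OF Q, of l w "h l"] \<delta>(2)[of l w "h l"] h[OF that(1)] r(2)[OF that(1)] that by simp
  have cont: "(h \<longlongrightarrow> h l1) (nhds l1)" if l1: "l1 \<in> ball l0 r" for l1
  proof (rule tendstoI)
    fix e :: real assume e: "e > 0"
    define e' where "e' = min e (\<delta> - dist (h l1) z0)"
    have "e' > 0"
      using e h(2)[OF l1] by (simp add: e'_def)
    moreover have "coeff (Q l1) D \<noteq> 0"
      using r0(2) r(2)[OF l1] by blast
    ultimately have "\<forall>\<^sub>F l in nhds l1. coeff (Q l) D \<noteq> 0 \<and> (\<exists>w. poly (Q l) w = 0 \<and> dist w (h l1) < e')"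
      using root_persists[OF Q D _ h(1)[OF l1]] by blast
    moreover have "\<forall>\<^sub>F l in nhds l1. l \<in> ball l0 r"
      using l1 by (intro eventually_nhds_in_open) auto
    ultimately show "\<forall>\<^sub>F l in nhds l1. dist (h l) (h l1) < e"
    proof eventually_elim
      case (elim l)
      then obtain w where w: "poly (Q l) w = 0" "dist w (h l1) < e'"
        by blast
      then have "dist w z0 < \<delta>"
        using dist_triangle[of w z0 "h l1"] by (simp add: e'_def)
      then have "w = h l"
        using uniq elim w(1) by blast
      with w(2) show ?case
        by (simp add: e'_def)
    qed
  qed
  have "h field_differentiable (at l1)" if l1: "l1 \<in> ball l0 r" for l1
  proof -
    define K where "K = divided_diff D Q"
    have "(\<lambda>l. poly (Q l) (h l1)) holomorphic_on UNIV"
      by (rule holomorphic_on_poly_family[OF Q holomorphic_on_const])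
    then obtain d where "((\<lambda>l. poly (Q l) (h l1)) has_field_derivative d) (at l1)"
      using holomorphic_on_imp_differentiable_at[of _ UNIV l1] by (auto simp: field_differentiable_def)
    then have d: "((\<lambda>l. (poly (Q l) (h l1) - poly (Q l1) (h l1)) / (l - l1)) \<longlongrightarrow> d) (at l1)"
      by (simp add: has_field_derivative_iff)
    have "(h \<longlongrightarrow> h l1) (at l1)"
      using cont[OF l1] by (rule tendsto_mono[rotated]) (simp add: at_within_def)
    moreover have "isCont K (l1, h l1, h l1)"
      using continuous_on_divided_diff[OF Q] by (simp add: K_def continuous_on_eq_continuous_at)
    ultimately have Klim: "((\<lambda>l. K (l, h l, h l1)) \<longlongrightarrow> K (l1, h l1, h l1)) (at l1)"
      by (intro isCont_tendsto_compose[of _ K] tendsto_intros)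
    have K0: "K (l, h l, h l1) \<noteq> 0" if "l \<in> ball l0 r" for l
      unfolding K_def using h(2)[OF that] h(2)[OF l1] r(2)[OF that] by (intro \<delta>(2)) auto
    have "((\<lambda>l. - ((poly (Q l) (h l1) - poly (Q l1) (h l1)) / (l - l1)) / K (l, h l, h l1))
        \<longlongrightarrow> - d / K (l1, h l1, h l1)) (at l1)"
      by (intro tendsto_intros d Klim K0 l1)
    moreover have "\<forall>\<^sub>F l in at l1. - ((poly (Q l) (h l1) - poly (Q l1) (h l1)) / (l - l1)) / K (l, h l, h l1)
        = (h l - h l1) / (l - l1)"
    proof -
      have "\<forall>\<^sub>F l in at l1. l \<in> ball l0 r"
        using l1 by (intro eventually_at_in_open') auto
      then show ?thesis
      proof eventually_elim
        case (elim l)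
        have eq: "- poly (Q l) (h l1) = (h l - h l1) * K (l, h l, h l1)"
          using divided_diff_eq[OF Q, of l "h l" "h l1"] h(1)[OF elim] by (simp add: K_def)
        have "- ((poly (Q l) (h l1) - 0) / (l - l1)) / K (l, h l, h l1)
            = - poly (Q l) (h l1) / K (l, h l, h l1) / (l - l1)"
          by simp
        then show ?case
          using K0[OF elim] by (simp add: eq h(1)[OF l1])
      qed
    qed
    ultimately have "((\<lambda>l. (h l - h l1) / (l - l1)) \<longlongrightarrow> - d / K (l1, h l1, h l1)) (at l1)"
      by (rule Lim_transform_eventually)
    then show ?thesis
      by (auto simp: field_differentiable_def has_field_derivative_iff)
  qed
  then have "h holomorphic_on ball l0 r"
    by (simp add: holomorphic_on_open field_differentiable_def)
  then show ?thesis
    using r(1) \<delta>(1) h(1) uniq that by blast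
qed

lemma order_higher_pderiv:
  fixes p :: "complex poly"
  assumes "p \<noteq> 0" "k < order z p"
  shows "(pderiv ^^ k) p \<noteq> 0 \<and> order z ((pderiv ^^ k) p) = order z p - k"
  using assms(2)
proof (induction k)
  case (Suc k)
  define q where "q = (pderiv ^^ k) p"
  have q: "q \<noteq> 0" "order z q = order z p - k"
    using Suc by (auto simp: q_def)
  then have "poly q z = 0"
    using Suc.prems by (simp add: order_root)
  then have ord: "order z q = Suc (order z (pderiv q))"
    by (rule order_pderiv[OF q(1)])
  have "pderiv q \<noteq> 0"
  proof
    assume "pderiv q = 0"
    then have "degree q = 0"
      by (simp add: pderiv_eq_0_iff)
    with order_degree[OF q(1), of z] ord show False by simp
  qed
  with ord q(2) show ?case
    by (simp add: q_def)
qed (use assms(1) in simp)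

text \<open>
  Among the points of the curve over those points of the imaginary axis where the degree does not
  drop, choose one whose root has the least multiplicity \<open>\<mu>\<close>.  There the root is a simple zero of the derivative of order \<open>\<mu> - 1\<close>, whose
  zeros near the point form a holomorphic branch.  Roots near the point that lie over the axis
  have multiplicity at least \<open>\<mu>\<close>, so they are zeros of that derivative and lie on the branch.
  Hence the branch satisfies the equation of the curve over the axis, and then everywhere.
\<close>
lemma holomorphic_branch:
  assumes Q: "polynomial_family D Q" and D: "D > 0"
    and start: "Re l1 = 0" "coeff (Q l1) D \<noteq> 0"
  obtains l0 r h where "Re l0 = 0" "r > 0" "h holomorphic_on ball l0 r"
    "\<And>l. l \<in> ball l0 r \<Longrightarrow> poly (Q l) (h l) = 0"
proof -
  define P where "P = (\<lambda>(l, z). Re l = 0 \<and> coeff (Q l) D \<noteq> 0 \<and> poly (Q l) z = 0)"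
  have deg: "degree (Q l) = D" if "coeff (Q l) D \<noteq> 0" for l
    using Q le_degree[OF that] unfolding polynomial_family_def by (intro antisym) blast+
  have "\<exists>x. P x"
    using exists_root_near[of "Q l1" 0] deg[OF start(2)] start D unfolding P_def by auto
  then obtain x where "P x" and min: "\<And>y. P y \<Longrightarrow> order (snd x) (Q (fst x)) \<le> order (snd y) (Q (fst y))"
    using ex_has_least_nat[of P _ "\<lambda>x. order (snd x) (Q (fst x))"] by blast
  obtain l0 z0 where x: "x = (l0, z0)" by fastforce
  have l0: "Re l0 = 0" "coeff (Q l0) D \<noteq> 0" "poly (Q l0) z0 = 0"
    using \<open>P x\<close> by (auto simp: P_def x)
  have "Q l0 \<noteq> 0"
    using l0(2) by auto
  \<comment> \<open>The number \<open>k + 1\<close> is the least multiplicity \<open>\<mu>\<close>.\<close>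
  define k where "k = order z0 (Q l0) - 1"
  have k: "k < order z0 (Q l0)" "order z0 (Q l0) = Suc k"
    using l0(3) \<open>Q l0 \<noteq> 0\<close> by (auto simp: k_def order_root)
  define G where "G = (\<lambda>l. (pderiv ^^ k) (Q l))"
  have G: "polynomial_family (D - k) G"
    unfolding G_def by (rule polynomial_family_higher_pderiv[OF Q])
  have G0: "G l0 \<noteq> 0" "order z0 (G l0) = 1"
    using order_higher_pderiv[OF \<open>Q l0 \<noteq> 0\<close> k(1)] k(2) by (auto simp: G_def)
  then have root: "poly (G l0) z0 = 0"
    by (simp add: order_root)
  have simple: "poly (pderiv (G l0)) z0 \<noteq> 0"
  proof
    assume "poly (pderiv (G l0)) z0 = 0"
    moreover have "order z0 (pderiv (G l0)) = 0"
      using order_pderiv[OF G0(1) root] G0(2) by simp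
    ultimately have "pderiv (G l0) = 0"
      by (simp add: order_root)
    then have "degree (G l0) = 0"
      by (simp only: pderiv_eq_0_iff)
    with order_degree[OF G0(1), of z0] G0(2) show False by simp
  qed
  have "degree ((pderiv ^^ i) p) = degree p - i" for p :: "complex poly" and i
    by (induction i) (simp_all add: degree_pderiv)
  then have "degree (G l0) = D - k"
    by (simp add: G_def deg[OF l0(2)])
  then have lead: "coeff (G l0) (D - k) \<noteq> 0"
    using G0(1) by (metis leading_coeff_0_iff)
  obtain r e h where r: "r > 0" and e: "e > 0" and h: "h holomorphic_on ball l0 r"
    and uniq: "\<And>l w. l \<in> ball l0 r \<Longrightarrow> dist w z0 < e \<Longrightarrow> poly (G l) w = 0 \<Longrightarrow> w = h l"
    by (rule implicit_root_function[OF G lead root simple]) blast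
  obtain s where s: "s > 0" "\<And>l. dist l l0 < s \<Longrightarrow> coeff (Q l) D \<noteq> 0 \<and> (\<exists>w. poly (Q l) w = 0 \<and> dist w z0 < e)"
    using root_persists[OF Q D l0(2,3) e] unfolding eventually_nhds_metric by blast
  have on_line: "poly (Q l) (h l) = 0" if l: "l \<in> ball l0 (min r s)" "Re l = 0" for l
  proof -
    have "dist l l0 < s"
      using l(1) by (simp add: dist_commute)
    with s(2) obtain w where w: "coeff (Q l) D \<noteq> 0" "poly (Q l) w = 0" "dist w z0 < e"
      by blast
    then have "P (l, w)"
      using l(2) by (simp add: P_def)
    from min[OF this] have "k < order w (Q l)"
      using k(1) by (simp add: x)
    moreover have "Q l \<noteq> 0"
      using w(1) by auto
    ultimately have "poly (G l) w = 0"
      using order_higher_pderiv[of "Q l" k w] by (simp add: G_def order_root)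
    then have "w = h l"
      using uniq w(3) l(1) by simp
    with w(2) show ?thesis by simp
  qed
  have sub: "ball l0 (min r s) \<subseteq> ball l0 r"
    by auto
  have acc: "l0 islimpt {l \<in> ball l0 (min r s). Re l = 0}"
    unfolding islimpt_approachable
  proof (intro allI impI)
    fix \<epsilon> :: real assume "\<epsilon> > 0"
    define t where "t = min \<epsilon> (min r s) / 2"
    have "t > 0" "t < \<epsilon>" "t < min r s"
      using \<open>\<epsilon> > 0\<close> r s(1) by (auto simp: t_def min_def)
    then show "\<exists>l\<in>{l \<in> ball l0 (min r s). Re l = 0}. l \<noteq> l0 \<and> dist l l0 < \<epsilon>"
      using l0(1) by (intro bexI[of _ "l0 + of_real t * \<i>"]) (auto simp: dist_norm norm_mult)
  qed
  have "poly (Q l) (h l) = 0" if "l \<in> ball l0 (min r s)" for l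
  proof (rule analytic_continuation[where f = "\<lambda>l. poly (Q l) (h l)", OF _ open_ball _ _ _ acc])
    show "(\<lambda>l. poly (Q l) (h l)) holomorphic_on ball l0 (min r s)"
      by (rule holomorphic_on_poly_family[OF Q holomorphic_on_subset[OF h sub]])
  qed (use that r s(1) on_line in auto)
  then show ?thesis
    using that[of l0 "min r s" h] l0(1) r s(1) holomorphic_on_subset[OF h sub] by simp
qed

section \<open>The characteristic curve\<close>

text \<open>
  The characteristic polynomial of the companion matrix, with \<open>\<partial>\<^sub>x\<close> replaced by \<open>z\<close>, at the point
  \<open>l\<close>.  It is viewed as a polynomial in \<open>z\<close>, so that a branch gives \<open>z\<close> as a function of the
  eigenvalue.
\<close>
definition char_poly :: "nat \<Rightarrow> (nat \<Rightarrow> complex poly) \<Rightarrow> complex \<Rightarrow> complex poly" where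
  "char_poly n p l = [:l ^ n:] - (\<Sum>i=1..n. smult (l ^ (i - 1)) (p i))"

lemma poly_char_poly: "poly (char_poly n p l) z = l ^ n - (\<Sum>i=1..n. l ^ (i - 1) * poly (p i) z)"
  by (simp add: char_poly_def poly_sum)

lemma coeff_char_poly:
  "coeff (char_poly n p l) j = (if j = 0 then l ^ n else 0) - (\<Sum>i=1..n. l ^ (i - 1) * coeff (p i) j)"
  by (simp add: char_poly_def coeff_sum coeff_pCons split: nat.split)

lemma infinite_imaginary: "infinite {l. Re l = 0}"
proof -
  have "infinite (range (\<lambda>t::real. of_real t * \<i>))"
    using infinite_UNIV_char_0[where 'a = real] by (subst finite_image_iff) (auto simp: inj_on_def)
  then show ?thesis
    by (rule infinite_super[rotated]) auto
qed

text \<open>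
  The coefficient of the top power of \<open>z\<close> is a nonzero polynomial in \<open>l\<close> and so does not vanish on
  the whole imaginary axis.
\<close>
lemma characteristic_branch:
  assumes "\<exists>i\<in>{1..n}. degree (p i) > 0"
  obtains l0 r h where "Re l0 = 0" "r > 0" "h holomorphic_on ball l0 r"
    "\<And>l. l \<in> ball l0 r \<Longrightarrow> l ^ n = (\<Sum>i=1..n. l ^ (i - 1) * poly (p i) (h l))"
proof -
  define D where "D = Max ((\<lambda>i. degree (p i)) ` {1..n})"
  have le: "degree (p i) \<le> D" if "i \<in> {1..n}" for i
    using that by (simp add: D_def)
  have D: "D > 0"
    using assms le by (meson le_less_trans not_gr_zero not_le)
  have "D \<in> (\<lambda>i. degree (p i)) ` {1..n}"
    unfolding D_def using assms by (intro Max_in) auto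
  then obtain i0 where i0: "i0 \<in> {1..n}" "degree (p i0) = D" by auto
  have fam: "polynomial_family D (char_poly n p)"
    unfolding polynomial_family_def
  proof (intro conjI allI)
    fix l j
    show "degree (char_poly n p l) \<le> D"
      unfolding char_poly_def
      by (intro degree_diff_le degree_sum_le order_trans[OF degree_smult_le le]) simp_all
    show "(\<lambda>l. coeff (char_poly n p l) j) holomorphic_on UNIV"
      unfolding coeff_char_poly by (cases "j = 0") (auto intro!: holomorphic_intros)
  qed
  define q where "q = (\<Sum>i=1..n. monom (coeff (p i) D) (i - 1))"
  have "coeff q (i0 - 1) = (\<Sum>i=1..n. if i = i0 then coeff (p i) D else 0)"
    unfolding q_def coeff_sum coeff_monom using i0(1) by (intro sum.cong) auto
  also have "\<dots> = coeff (p i0) D"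
    using i0(1) by simp
  finally have "coeff q (i0 - 1) \<noteq> 0"
    using i0(2) D by (metis degree_0 leading_coeff_0_iff less_irrefl)
  then have "q \<noteq> 0" by auto
  then have "\<not> {l. Re l = 0} \<subseteq> {l. poly q l = 0}"
    using poly_roots_finite infinite_imaginary finite_subset by blast
  then obtain l1 where l1: "Re l1 = 0" "poly q l1 \<noteq> 0" by blast
  have "coeff (char_poly n p l1) D = - poly q l1"
    using D by (simp add: coeff_char_poly q_def poly_sum poly_monom mult.commute)
  with l1(2) have "coeff (char_poly n p l1) D \<noteq> 0" by simp
  from holomorphic_branch[OF fam D l1(1) this]
  obtain l0 r h where "Re l0 = 0" "r > 0" "h holomorphic_on ball l0 r"
    "\<And>l. l \<in> ball l0 r \<Longrightarrow> poly (char_poly n p l) (h l) = 0" by blast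
  then show ?thesis
    by (intro that[of l0 r h]) (auto simp: poly_char_poly)
qed

text \<open>Over a fixed \<open>z\<close> the curve has at most \<open>n\<close> points, its equation being monic in \<open>l\<close>.\<close>
lemma finite_char_fibre:
  fixes p :: "nat \<Rightarrow> complex poly"
  shows "finite {l. l ^ n = (\<Sum>i=1..n. l ^ (i - 1) * poly (p i) z)}"
proof -
  define q where "q = monom 1 n - (\<Sum>i=1..n. monom (poly (p i) z) (i - 1))"
  have "coeff (\<Sum>i=1..n. monom (poly (p i) z) (i - 1)) n = 0"
    unfolding coeff_sum coeff_monom by (intro sum.neutral) auto
  then have "coeff q n = 1"
    by (simp add: q_def)
  then have "q \<noteq> 0" by auto
  from poly_roots_finite[OF this] show ?thesis
    by (simp add: q_def poly_monom poly_sum mult.commute)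
qed

section \<open>The Herzog space as a space of bounded families\<close>

lemma closure_of_norm_topology_eqI:
  assumes "Metric_space S (norm_dist S N)" "A \<subseteq> S"
    and "\<And>x e. x \<in> S \<Longrightarrow> e > 0 \<Longrightarrow> \<exists>y\<in>A. N (x - y) < e"
  shows "norm_topology S N closure_of A = S"
proof -
  interpret Metric_space S "norm_dist S N" by fact
  show ?thesis
    unfolding norm_topology_def metric_closure_of
  proof (intro equalityI subsetI CollectI conjI allI impI)
    fix x and r :: real assume x: "x \<in> S" and r: "r > 0"
    obtain y where "y \<in> A" "N (x - y) < r"
      using assms(3)[OF x r] by blast
    then show "\<exists>y\<in>A. y \<in> mball x r"
      using x assms(2) by (intro bexI[of _ y]) (auto simp: in_mball norm_dist_def)
  qed auto
qed

lemma limitin_norm_topology: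
  assumes "Metric_space S (norm_dist S N)"
  shows "limitin (norm_topology S N) f l F \<longleftrightarrow>
    l \<in> S \<and> (\<forall>e>0. \<forall>\<^sub>F x in F. f x \<in> S \<and> N (f x - l) < e)"
proof -
  interpret Metric_space S "norm_dist S N" by fact
  show ?thesis
    unfolding norm_topology_def limitin_metric
    by (auto simp: norm_dist_def elim!: eventually_mono)
qed

lemma Metric_space_norm_dist_subset:
  assumes "Metric_space S (norm_dist S N)" "S' \<subseteq> S"
  shows "Metric_space S' (norm_dist S' N)"
proof -
  interpret Metric_space S "norm_dist S N" by fact
  have eq: "norm_dist S' N u v = norm_dist S N u v" if "u \<in> S'" "v \<in> S'" for u v
    using that assms(2) by (auto simp: norm_dist_def)
  show ?thesis
  proof
    fix u v w
    show "0 \<le> norm_dist S' N u v"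
      using eq[of u v] nonneg[of u v] by (cases "u \<in> S' \<and> v \<in> S'") (auto simp: norm_dist_def)
    show "norm_dist S' N u v = norm_dist S' N v u"
      using eq[of u v] eq[of v u] commute[of u v] by (cases "u \<in> S' \<and> v \<in> S'") (auto simp: norm_dist_def)
    assume u: "u \<in> S'" and v: "v \<in> S'"
    show "norm_dist S' N u v = 0 \<longleftrightarrow> u = v"
      using eq[OF u v] zero[OF subsetD[OF assms(2) u] subsetD[OF assms(2) v]] by simp
    assume w: "w \<in> S'"
    show "norm_dist S' N u w \<le> norm_dist S' N u v + norm_dist S' N v w"
      using triangle[OF subsetD[OF assms(2) u] subsetD[OF assms(2) v] subsetD[OF assms(2) w]]
      by (simp only: eq u v w)
  qed
qed

text \<open>
  The function with Herzog coefficients \<open>a\<close>: the exponential generating function of \<open>a\<close> at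
  \<open>\<rho> x\<close>.
\<close>
definition egf :: "real \<Rightarrow> (nat \<Rightarrow> complex) \<Rightarrow> real \<Rightarrow> complex" where
  "egf \<rho> a x = (\<Sum>k. a k * of_real (\<rho> ^ k / fact k) * of_real (x ^ k))"

lemma summable_egf:
  fixes a :: "nat \<Rightarrow> complex" and z :: complex
  assumes "\<And>k. norm (a k) \<le> B"
  shows "summable (\<lambda>k. a k * of_real (\<rho> ^ k / fact k) * z ^ k)"
proof (rule summable_comparison_test')
  show "summable (\<lambda>k. B * ((\<bar>\<rho>\<bar> * norm z) ^ k /\<^sub>R fact k))"
    by (intro summable_mult sums_summable[OF exp_converges])
  fix k
  have "norm (a k * of_real (\<rho> ^ k / fact k) * z ^ k) = norm (a k) * ((\<bar>\<rho>\<bar> * norm z) ^ k /\<^sub>R fact k)"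
  proof -
    have "norm (of_real (\<rho> ^ k / fact k) :: complex) = \<bar>\<rho>\<bar> ^ k / fact k"
      unfolding norm_of_real by (simp add: power_abs)
    then show ?thesis
      by (simp only: norm_mult norm_power power_mult_distrib real_scaleR_def divide_inverse ac_simps)
  qed
  also have "\<dots> \<le> B * ((\<bar>\<rho>\<bar> * norm z) ^ k /\<^sub>R fact k)"
    by (intro mult_right_mono assms) simp
  finally show "norm (a k * of_real (\<rho> ^ k / fact k) * z ^ k) \<le> B * ((\<bar>\<rho>\<bar> * norm z) ^ k /\<^sub>R fact k)" .
qed

lemma egf_sums:
  assumes "\<And>k. norm (a k) \<le> B"
  shows "(\<lambda>k. a k * of_real (\<rho> ^ k / fact k) * of_real (x ^ k)) sums egf \<rho> a x"
  unfolding egf_def using summable_sums[OF summable_egf[of a, where z = "of_real x", OF assms]] by simp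

lemma egf_add:
  assumes "\<And>k. norm (a k) \<le> B" "\<And>k. norm (b k) \<le> B'"
  shows "egf \<rho> (\<lambda>k. a k + b k) x = egf \<rho> a x + egf \<rho> b x"
  using sums_unique[OF sums_add[OF egf_sums[of a, OF assms(1)] egf_sums[of b, OF assms(2)]], of \<rho> x \<rho> x]
  by (simp only: egf_def distrib_right)

lemma egf_mult:
  assumes "\<And>k. norm (a k) \<le> B"
  shows "egf \<rho> (\<lambda>k. c * a k) x = c * egf \<rho> a x"
  using sums_unique[OF sums_mult[OF egf_sums[of a, OF assms], of c \<rho> x]]
  by (simp only: egf_def mult.assoc)

lemma egf_sum:
  assumes "\<And>i k. i \<in> I \<Longrightarrow> norm (a i k) \<le> B i"
  shows "egf \<rho> (\<lambda>k. \<Sum>i\<in>I. a i k) x = (\<Sum>i\<in>I. egf \<rho> (a i) x)"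
proof -
  have "(\<lambda>k. \<Sum>i\<in>I. a i k * of_real (\<rho> ^ k / fact k) * of_real (x ^ k)) sums (\<Sum>i\<in>I. egf \<rho> (a i) x)"
    by (rule sums_sum) (rule egf_sums, rule assms)
  from sums_unique[OF this] show ?thesis
    by (simp only: egf_def sum_distrib_right)
qed

lemma herzog_series_egf:
  assumes "a \<longlonglongrightarrow> 0"
  shows "herzog_series \<rho> (egf \<rho> a) a"
proof -
  obtain B where "\<And>k. norm (a k) \<le> B"
    using convergent_imp_Bseq[OF convergentI[OF assms]] by (auto simp: Bseq_def)
  from egf_sums[of a, OF this] assms show ?thesis
    by (simp add: herzog_series_def)
qed

lemma herzog_series_imp_egf: "herzog_series \<rho> f a \<Longrightarrow> f = egf \<rho> a"
  by (rule ext) (simp add: herzog_series_def egf_def sums_iff)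

lemma egf_mem_herzog_space: "a \<longlonglongrightarrow> 0 \<Longrightarrow> egf \<rho> a \<in> herzog_space \<rho>"
  using herzog_series_egf by (auto simp: herzog_space_def)

lemma herzog_norm_le:
  assumes "a \<longlonglongrightarrow> 0" "\<rho> > 0" "\<And>k. norm (a k) \<le> B"
  shows "herzog_norm \<rho> (egf \<rho> a) \<le> B"
  unfolding herzog_norm_eq[OF herzog_series_egf[OF assms(1)] assms(2)]
  by (rule cSUP_least) (use assms(3) in auto)

lemma norm_le_herzog_norm:
  assumes "a \<longlonglongrightarrow> 0" "\<rho> > 0"
  shows "norm (a k) \<le> herzog_norm \<rho> (egf \<rho> a)"
  unfolding herzog_norm_eq[OF herzog_series_egf[OF assms(1)] assms(2)]
  by (rule cSUP_upper[OF UNIV_I herzog_series_bdd[OF herzog_series_egf[OF assms(1)]]])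

lemma Dx_egf:
  assumes "\<And>k. norm (a k) \<le> B"
  shows "Dx (egf \<rho> a) = egf \<rho> (\<lambda>k. of_real \<rho> * a (Suc k))"
proof
  fix x :: real
  define c where "c k = a k * of_real (\<rho> ^ k / fact k)" for k
  have "summable (\<lambda>k. c k * z ^ k)" for z
    unfolding c_def by (rule summable_egf) (rule assms)
  from termdiffs_strong_converges_everywhere[OF this]
  have "((\<lambda>z. \<Sum>k. c k * z ^ k) has_field_derivative (\<Sum>k. diffs c k * of_real x ^ k)) (at (of_real x))" .
  from has_vector_derivative_real_field[OF this]
  have "((\<lambda>t. \<Sum>k. c k * of_real t ^ k) has_vector_derivative (\<Sum>k. diffs c k * of_real x ^ k)) (at x)" .
  moreover have "(\<lambda>t. \<Sum>k. c k * of_real t ^ k) = egf \<rho> a"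
    by (simp add: egf_def c_def fun_eq_iff)
  moreover have "(\<Sum>k. diffs c k * of_real x ^ k) = egf \<rho> (\<lambda>k. of_real \<rho> * a (Suc k)) x"
  proof -
    have "diffs c k = of_real \<rho> * a (Suc k) * of_real (\<rho> ^ k / fact k)" for k
      by (simp add: diffs_def c_def field_simps del: of_nat_Suc)
    then show ?thesis
      by (simp add: egf_def)
  qed
  ultimately show "Dx (egf \<rho> a) x = egf \<rho> (\<lambda>k. of_real \<rho> * a (Suc k)) x"
    by (simp add: Dx_def vector_derivative_at)
qed

lemma Dx_power_egf:
  assumes "\<And>k. norm (a k) \<le> B"
  shows "(Dx ^^ j) (egf \<rho> a) = egf \<rho> (\<lambda>k. of_real \<rho> ^ j * a (k + j))"
proof (induction j)
  case (Suc j)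
  have "norm (of_real \<rho> ^ j * a (k + j)) \<le> \<bar>\<rho>\<bar> ^ j * B" for k
    using assms by (simp add: norm_mult norm_power mult_left_mono)
  from Dx_egf[of "\<lambda>k. of_real \<rho> ^ j * a (k + j)", OF this, of \<rho>] show ?case
    by (simp add: Suc mult.assoc)
qed simp

lemma poly_Dx_egf:
  assumes "\<And>k. norm (a k) \<le> B"
  shows "poly_Dx q (egf \<rho> a) = egf \<rho> (\<lambda>k. \<Sum>j\<le>degree q. coeff q j * of_real \<rho> ^ j * a (k + j))"
proof
  fix x
  have bound: "norm (of_real \<rho> ^ j * a (k + j)) \<le> \<bar>\<rho>\<bar> ^ j * B" for j k
    using assms by (simp add: norm_mult norm_power mult_left_mono)
  have bound': "norm (coeff q j * (of_real \<rho> ^ j * a (k + j))) \<le> norm (coeff q j) * (\<bar>\<rho>\<bar> ^ j * B)" for j k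
    unfolding norm_mult[of "coeff q j"] by (rule mult_left_mono[OF bound]) simp
  have "poly_Dx q (egf \<rho> a) x = (\<Sum>j\<le>degree q. coeff q j * egf \<rho> (\<lambda>k. of_real \<rho> ^ j * a (k + j)) x)"
    by (simp add: poly_Dx_def Dx_power_egf[of a, OF assms])
  also have "\<dots> = (\<Sum>j\<le>degree q. egf \<rho> (\<lambda>k. coeff q j * (of_real \<rho> ^ j * a (k + j))) x)"
    by (simp add: egf_mult[OF bound])
  also have "\<dots> = egf \<rho> (\<lambda>k. \<Sum>j\<le>degree q. coeff q j * (of_real \<rho> ^ j * a (k + j))) x"
    by (rule egf_sum[symmetric, OF bound'])
  finally show "poly_Dx q (egf \<rho> a) x = egf \<rho> (\<lambda>k. \<Sum>j\<le>degree q. coeff q j * of_real \<rho> ^ j * a (k + j)) x"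
    by (simp add: mult.assoc)
qed

text \<open>
  Bounded continuous functions on a metric space form a Banach space.  With the usual metric on
  the naturals this covers the coefficient families.
\<close>
instantiation nat :: metric_space
begin

definition dist_nat :: "nat \<Rightarrow> nat \<Rightarrow> real" where
  "dist_nat m n = of_int \<bar>int m - int n\<bar>"

definition uniformity_nat :: "(nat \<times> nat) filter" where
  "uniformity_nat = (INF e\<in>{0<..}. principal {(x, y). dist x y < e})"

instance
proof
  show "uniformity = (INF e\<in>{0<..}. principal {(x :: nat, y). dist x y < e})"
    by (rule uniformity_nat_def)
  have "\<forall>\<^sub>F (x', y) in uniformity. x' = x \<longrightarrow> y \<in> U" if "x \<in> U" for x :: nat and U
  proof -
    have "\<forall>\<^sub>F (x', y) in principal {(x :: nat, y). dist x y < 1}. x' = x \<longrightarrow> y \<in> U"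
      unfolding eventually_principal using that by (auto simp: dist_nat_def simp flip: of_int_diff of_int_abs)
    then show ?thesis
      unfolding uniformity_nat_def by (rule filter_leD[OF INF_lower, rotated]) simp
  qed
  then show "open U \<longleftrightarrow> (\<forall>x\<in>U. \<forall>\<^sub>F (x', y) in uniformity. x' = x \<longrightarrow> y \<in> U)" for U :: "nat set"
    by (simp add: open_discrete)
qed (auto simp: dist_nat_def simp flip: of_int_add of_int_diff of_int_abs)

end

type_synonym coeff_family = "(nat \<times> nat) \<Rightarrow>\<^sub>C complex"

abbreviation entry :: "coeff_family \<Rightarrow> nat \<Rightarrow> nat \<Rightarrow> complex" where
  "entry f i k \<equiv> apply_bcontfun f (i, k)"

text \<open>
  The sequence model of \<open>X\<^sup>n\<close>: the row \<open>i\<close> is the coefficient sequence of the component \<open>i\<close>, and rows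
  outside \<open>{1..n}\<close> vanish.
\<close>
definition null_families :: "nat \<Rightarrow> coeff_family set" where
  "null_families n = {f. (\<forall>i. (\<lambda>k. entry f i k) \<longlonglongrightarrow> 0) \<and> (\<forall>i k. i \<notin> {1..n} \<longrightarrow> entry f i k = 0)}"

definition egf_vec :: "real \<Rightarrow> coeff_family \<Rightarrow> fvec" where
  "egf_vec \<rho> f = (\<lambda>i. egf \<rho> (\<lambda>k. entry f i k))"

lemma egf_vec_add: "egf_vec \<rho> (f + g) = egf_vec \<rho> f + egf_vec \<rho> g"
  by (intro ext) (simp add: egf_vec_def egf_add[OF norm_bounded norm_bounded])

lemma egf_vec_scale: "egf_vec \<rho> (cscale c f) = fvec_scale c (egf_vec \<rho> f)"
  by (intro ext) (simp add: egf_vec_def fvec_scale_def cscale_apply egf_mult[OF norm_bounded])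

lemma egf_vec_0 [simp]: "egf_vec \<rho> 0 = 0"
  by (intro ext) (simp add: egf_vec_def egf_def)

lemma egf_vec_diff: "egf_vec \<rho> (f - g) = egf_vec \<rho> f - egf_vec \<rho> g"
  using egf_vec_add[of \<rho> "f - g" g] by (simp add: algebra_simps)

lemma egf_vec_sum: "egf_vec \<rho> (\<Sum>i\<in>I. f i) = (\<Sum>i\<in>I. egf_vec \<rho> (f i))"
  by (induction I rule: infinite_finite_induct) (simp_all add: egf_vec_add)

lemma subspace_null_families: "cfam.subspace (null_families n)"
proof (rule cfam.subspaceI)
  show "f + g \<in> null_families n" if "f \<in> null_families n" "g \<in> null_families n" for f g
    using that tendsto_add by (fastforce simp: null_families_def)
  show "cscale c f \<in> null_families n" if "f \<in> null_families n" for c f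
    using that tendsto_mult_right_zero by (fastforce simp: null_families_def cscale_apply)
qed (simp add: null_families_def)

lemma closed_null_families: "closed (null_families n)"
  unfolding closed_sequential_limits
proof (intro allI impI, elim conjE)
  fix F f assume F: "\<forall>j. F j \<in> null_families n" and lim: "F \<longlonglongrightarrow> f"
  have "(\<lambda>k. entry f i k) \<longlonglongrightarrow> 0" for i
  proof (rule LIMSEQ_I)
    fix e :: real assume e: "e > 0"
    obtain j where j: "norm (F j - f) < e / 2"
      using LIMSEQ_D[OF lim half_gt_zero[OF e]] by blast
    have "(\<lambda>k. entry (F j) i k) \<longlonglongrightarrow> 0"
      using F by (simp add: null_families_def)
    from LIMSEQ_D[OF this half_gt_zero[OF e]]
    obtain K where K: "\<And>k. k \<ge> K \<Longrightarrow> norm (entry (F j) i k) < e / 2" by auto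
    have "norm (entry f i k) < e" if "k \<ge> K" for k
      using norm_bounded[of "F j - f" "(i, k)"] j K[OF that]
        norm_triangle_ineq4[of "entry (F j) i k" "entry (F j) i k - entry f i k"] by simp
    then show "\<exists>K. \<forall>k\<ge>K. norm (entry f i k - 0) < e" by auto
  qed
  moreover have "entry f i k = 0" if "i \<notin> {1..n}" for i k
  proof -
    have "(\<lambda>j. entry (F j) i k) \<longlonglongrightarrow> entry f i k"
      by (rule tendsto_uniform_limitI[OF tendsto_bcontfun_uniform_limit[OF lim] UNIV_I])
    moreover have "(\<lambda>j. entry (F j) i k) = (\<lambda>_. 0)"
      using F that by (auto simp: null_families_def)
    ultimately show ?thesis
      by (simp add: LIMSEQ_const_iff)
  qed
  ultimately show "f \<in> null_families n"
    by (simp add: null_families_def)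
qed

text \<open>
  Together with the next inequality: \<open>egf_vec \<rho>\<close> is an isomorphism, although not an isometry, as
  the norm on \<open>X\<^sup>n\<close> is the sum of the component norms and not their maximum.
\<close>
lemma norm_le_vec_norm:
  assumes "f \<in> null_families n" "\<rho> > 0"
  shows "norm f \<le> vec_norm (herzog_norm \<rho>) n (egf_vec \<rho> f)"
proof (rule norm_bound)
  fix ik :: "nat \<times> nat"
  obtain i k where ik: "ik = (i, k)" by fastforce
  have null: "(\<lambda>k. entry f i k) \<longlonglongrightarrow> 0" for i
    using assms(1) by (simp add: null_families_def)
  have pos: "0 \<le> herzog_norm \<rho> (egf_vec \<rho> f i)" for i
    unfolding egf_vec_def by (intro herzog_norm_nonneg egf_mem_herzog_space null assms(2))
  show "norm (f ik) \<le> vec_norm (herzog_norm \<rho>) n (egf_vec \<rho> f)"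
  proof (cases "i \<in> {1..n}")
    case True
    have "norm (entry f i k) \<le> herzog_norm \<rho> (egf_vec \<rho> f i)"
      unfolding egf_vec_def by (rule norm_le_herzog_norm[OF null assms(2)])
    also have "\<dots> \<le> vec_norm (herzog_norm \<rho>) n (egf_vec \<rho> f)"
      unfolding vec_norm_def using True pos by (intro member_le_sum) auto
    finally show ?thesis by (simp add: ik)
  next
    case False
    then show ?thesis
      using assms(1) pos by (auto simp: ik null_families_def vec_norm_def intro!: sum_nonneg)
  qed
qed

lemma vec_norm_le_norm:
  assumes "f \<in> null_families n" "\<rho> > 0"
  shows "vec_norm (herzog_norm \<rho>) n (egf_vec \<rho> f) \<le> n * norm f"
proof -
  have "herzog_norm \<rho> (egf_vec \<rho> f i) \<le> norm f" for i
    unfolding egf_vec_def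
    by (rule herzog_norm_le) (use assms in \<open>auto simp: null_families_def norm_bounded\<close>)
  then have "vec_norm (herzog_norm \<rho>) n (egf_vec \<rho> f) \<le> (\<Sum>i=1..n. norm f)"
    unfolding vec_norm_def by (intro sum_mono)
  then show ?thesis by simp
qed

lemma vec_space_eq_image: "vec_space (herzog_space \<rho>) n = egf_vec \<rho> ` null_families n"
proof (intro equalityI subsetI)
  fix U assume U: "U \<in> vec_space (herzog_space \<rho>) n"
  have "\<exists>a. herzog_series \<rho> (U i) a" if "i \<in> {1..n}" for i
    using U that by (auto simp: vec_space_def herzog_space_def)
  then obtain a where a: "\<And>i. i \<in> {1..n} \<Longrightarrow> herzog_series \<rho> (U i) (a i)"
    by metis
  define b where "b i k = (if i \<in> {1..n} then a i k else 0)" for i k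
  have b: "b i \<longlonglongrightarrow> 0" "U i = egf \<rho> (b i)" for i
  proof -
    show "b i \<longlonglongrightarrow> 0"
      using a[of i] unfolding b_def by (cases "i \<in> {1..n}") (auto simp: herzog_series_def)
    show "U i = egf \<rho> (b i)"
      using herzog_series_imp_egf[OF a[of i]] U unfolding b_def
      by (cases "i \<in> {1..n}") (auto simp: vec_space_def egf_def fun_eq_iff)
  qed
  have "\<exists>B. \<forall>k. norm (b i k) \<le> B" for i
    using convergent_imp_Bseq[OF convergentI[OF b(1)[of i]]] by (auto simp: Bseq_def)
  then obtain B where B: "\<And>i k. norm (b i k) \<le> B i" by metis
  have B0: "0 \<le> B i" for i
    using B[of i 0] norm_ge_zero order_trans by blast
  define f where "f = Bcontfun (\<lambda>(i, k). b i k)"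
  have bnd: "norm (case ik of (i, k) \<Rightarrow> b i k) \<le> (\<Sum>i=1..n. B i)" for ik
  proof -
    obtain i k where ik: "ik = (i, k)" by fastforce
    show ?thesis
    proof (cases "i \<in> {1..n}")
      case True
      then have "B i \<le> (\<Sum>i=1..n. B i)"
        using B0 by (intro member_le_sum) auto
      with B[of i k] show ?thesis by (simp add: ik)
    next
      case False
      then show ?thesis
        using B0 by (auto simp: ik b_def intro!: sum_nonneg)
    qed
  qed
  have f: "entry f i k = b i k" for i k
    using apply_Bcontfun[of "\<lambda>(i, k). b i k", OF bnd] by (simp add: f_def)
  have "b i k = 0" if "i \<notin> {1..n}" for i k
    using that by (simp only: b_def if_False)
  with b(1) have "f \<in> null_families n"
    by (simp add: null_families_def f)
  moreover have "U = egf_vec \<rho> f"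
    by (intro ext) (simp add: egf_vec_def f b(2))
  ultimately show "U \<in> egf_vec \<rho> ` null_families n" by blast
next
  fix U assume "U \<in> egf_vec \<rho> ` null_families n"
  then show "U \<in> vec_space (herzog_space \<rho>) n"
    by (auto simp: vec_space_def null_families_def egf_vec_def egf_mem_herzog_space egf_def zero_fun_def)
qed

text \<open>
  On coefficient sequences \<open>\<partial>\<^sub>x\<close> acts as \<open>\<rho>\<close> times the backward shift; this is the companion
  operator in the sequence model.
\<close>
definition shift_companion :: "real \<Rightarrow> nat \<Rightarrow> (nat \<Rightarrow> complex poly) \<Rightarrow> coeff_family \<Rightarrow> coeff_family" where
  "shift_companion \<rho> n p f = Bcontfun (\<lambda>(i, k).
     if i \<in> {1..<n} then entry f (i + 1) k
     else if i = n then \<Sum>l=1..n. \<Sum>j\<le>degree (p l). coeff (p l) j * of_real \<rho> ^ j * entry f l (k + j)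
     else 0)"

definition shift_bound :: "real \<Rightarrow> nat \<Rightarrow> (nat \<Rightarrow> complex poly) \<Rightarrow> real" where
  "shift_bound \<rho> n p = 1 + (\<Sum>l=1..n. \<Sum>j\<le>degree (p l). norm (coeff (p l) j) * \<bar>\<rho>\<bar> ^ j)"

lemma shift_companion_bound:
  "norm (if i \<in> {1..<n} then entry f (i + 1) k
     else if i = n then \<Sum>l=1..n. \<Sum>j\<le>degree (p l). coeff (p l) j * of_real \<rho> ^ j * entry f l (k + j)
     else 0) \<le> shift_bound \<rho> n p * norm (f :: coeff_family)"
proof -
  define R where "R = (\<Sum>l=1..n. \<Sum>j\<le>degree (p l). norm (coeff (p l) j) * \<bar>\<rho>\<bar> ^ j)"
  have "0 \<le> R"
    unfolding R_def by (intro sum_nonneg) auto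
  have "norm (\<Sum>l=1..n. \<Sum>j\<le>degree (p l). coeff (p l) j * of_real \<rho> ^ j * entry f l (k + j))
      \<le> (\<Sum>l=1..n. \<Sum>j\<le>degree (p l). norm (coeff (p l) j) * \<bar>\<rho>\<bar> ^ j * norm f)"
    by (intro order_trans[OF norm_sum] sum_mono)
      (auto simp: norm_mult norm_power intro!: mult_left_mono norm_bounded)
  also have "\<dots> = R * norm f"
    by (simp add: R_def sum_distrib_right)
  finally have *: "norm (\<Sum>l=1..n. \<Sum>j\<le>degree (p l). coeff (p l) j * of_real \<rho> ^ j * entry f l (k + j)) \<le> R * norm f" .
  have "R * norm f \<le> (1 + R) * norm f" "norm f \<le> (1 + R) * norm f" "0 \<le> (1 + R) * norm f"
    using \<open>0 \<le> R\<close> by (simp_all add: algebra_simps)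
  moreover have "norm (entry f (i + 1) k) \<le> norm f"
    by (rule norm_bounded)
  ultimately show ?thesis
    using * unfolding shift_bound_def R_def[symmetric] by auto
qed

lemma shift_companion_apply:
  "entry (shift_companion \<rho> n p f) i k =
    (if i \<in> {1..<n} then entry f (i + 1) k
     else if i = n then \<Sum>l=1..n. \<Sum>j\<le>degree (p l). coeff (p l) j * of_real \<rho> ^ j * entry f l (k + j)
     else 0)"
  unfolding shift_companion_def
  by (subst apply_Bcontfun[where B = "shift_bound \<rho> n p * norm f"])
    (auto simp only: prod.case split: prod.split intro: shift_companion_bound)

lemma bounded_operator_shift_companion: "bounded_operator (shift_companion \<rho> n p) (shift_bound \<rho> n p)"
proof -
  have le: "norm (shift_companion \<rho> n p f) \<le> shift_bound \<rho> n p * norm f" for f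
  proof (rule norm_bound)
    fix ik :: "nat \<times> nat"
    show "norm (shift_companion \<rho> n p f ik) \<le> shift_bound \<rho> n p * norm f"
      by (cases ik) (simp only: shift_companion_apply shift_companion_bound)
  qed
  have "bounded_linear (shift_companion \<rho> n p)"
  proof (rule bounded_linear_intro[where K = "shift_bound \<rho> n p"])
    show "shift_companion \<rho> n p (f + g) = shift_companion \<rho> n p f + shift_companion \<rho> n p g" for f g
      by (rule bcontfun_eqI) (auto simp: shift_companion_apply sum.distrib distrib_left split_paired_all)
    show "shift_companion \<rho> n p (r *\<^sub>R f) = r *\<^sub>R shift_companion \<rho> n p f" for r f
      by (rule bcontfun_eqI) (auto simp: shift_companion_apply scaleR_sum_right split_paired_all)
  qed (use le in \<open>simp add: mult.commute\<close>)
  moreover have "0 \<le> shift_bound \<rho> n p"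
    unfolding shift_bound_def by (intro add_nonneg_nonneg sum_nonneg) auto
  ultimately show ?thesis
    using le by (simp add: bounded_operator_def bounded_operator_axioms_def)
qed

lemma shift_companion_cscale: "shift_companion \<rho> n p (cscale c f) = cscale c (shift_companion \<rho> n p f)"
  by (rule bcontfun_eqI) (auto simp: shift_companion_apply cscale_apply sum_distrib_left mult.left_commute split_paired_all)

lemma shift_companion_null_families:
  assumes "f \<in> null_families n" and n: "n \<ge> 1"
  shows "shift_companion \<rho> n p f \<in> null_families n"
proof -
  have null: "(\<lambda>k. entry f i k) \<longlonglongrightarrow> 0" for i
    using assms by (simp add: null_families_def)
  have "(\<lambda>k. \<Sum>l=1..n. \<Sum>j\<le>degree (p l). coeff (p l) j * of_real \<rho> ^ j * entry f l (k + j)) \<longlonglongrightarrow> 0"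
    by (intro tendsto_null_sum tendsto_mult_right_zero LIMSEQ_ignore_initial_segment null)
  then have "(\<lambda>k. entry (shift_companion \<rho> n p f) i k) \<longlonglongrightarrow> 0" for i
    using null unfolding shift_companion_apply
    by (cases "i \<in> {1..<n}"; cases "i = n") (simp_all only: if_True if_False simp_thms tendsto_const)
  moreover have "entry (shift_companion \<rho> n p f) i k = 0" if "i \<notin> {1..n}" for i k
    using that n by (auto simp: shift_companion_apply)
  ultimately show ?thesis
    by (simp add: null_families_def)
qed

lemma sum_fun_apply: "(\<Sum>i\<in>I. f i) x = (\<Sum>i\<in>I. f i x)" for f :: "'i \<Rightarrow> 'a \<Rightarrow> 'b::comm_monoid_add"
  by (induction I rule: infinite_finite_induct) simp_all

lemma companion_op_egf_vec:
  assumes "n \<ge> 1"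
  shows "companion_op n p (egf_vec \<rho> f) = egf_vec \<rho> (shift_companion \<rho> n p f)"
proof (intro ext)
  fix i x
  have bound: "norm (\<Sum>j\<le>degree (p l). coeff (p l) j * of_real \<rho> ^ j * entry f l (k + j))
      \<le> (\<Sum>j\<le>degree (p l). norm (coeff (p l) j) * \<bar>\<rho>\<bar> ^ j * norm f)" for l k
    by (intro order_trans[OF norm_sum] sum_mono)
      (auto simp: norm_mult norm_power intro!: mult_left_mono norm_bounded)
  consider "i \<in> {1..<n}" | "i = n" | "i \<notin> {1..<n}" "i \<noteq> n" by blast
  then show "companion_op n p (egf_vec \<rho> f) i x = egf_vec \<rho> (shift_companion \<rho> n p f) i x"
  proof cases
    case 1
    then show ?thesis
      by (simp add: companion_op_def egf_vec_def shift_companion_apply)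
  next
    case 2
    have "companion_op n p (egf_vec \<rho> f) i x = (\<Sum>l=1..n. poly_Dx (p l) (egf_vec \<rho> f l) x)"
      by (simp add: companion_op_def 2 sum_fun_apply)
    also have "\<dots> = (\<Sum>l=1..n. egf \<rho> (\<lambda>k. \<Sum>j\<le>degree (p l). coeff (p l) j * of_real \<rho> ^ j * entry f l (k + j)) x)"
      unfolding egf_vec_def by (simp add: poly_Dx_egf[OF norm_bounded])
    also have "\<dots> = egf \<rho> (\<lambda>k. \<Sum>l=1..n. \<Sum>j\<le>degree (p l). coeff (p l) j * of_real \<rho> ^ j * entry f l (k + j)) x"
      by (rule egf_sum[symmetric, OF bound])
    also have "\<dots> = egf_vec \<rho> (shift_companion \<rho> n p f) i x"
      by (simp add: egf_vec_def shift_companion_apply 2)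
    finally show ?thesis .
  next
    case 3
    then have "entry (shift_companion \<rho> n p f) i k = 0" for k
      by (simp only: shift_companion_apply if_False)
    moreover have "companion_op n p (egf_vec \<rho> f) i = 0"
      using 3 by (simp only: companion_op_def if_False)
    ultimately show ?thesis
      by (simp add: egf_vec_def egf_def)
  qed
qed

section \<open>Density of exponentials\<close>

text \<open>
  The Herzog coefficients of \<open>x \<mapsto> e\<^bsup>zx\<^esup>\<close>, a null sequence for \<open>|z| < \<rho>\<close>.
\<close>
definition exp_vec :: "real \<Rightarrow> complex \<Rightarrow> nat \<Rightarrow>\<^sub>C complex" where
  "exp_vec \<rho> z = Bcontfun (\<lambda>k. (z / of_real \<rho>) ^ k)"

lemma norm_divide_power_le_1: "norm z \<le> \<rho> \<Longrightarrow> norm ((z / of_real \<rho>) ^ k) \<le> (1::real)" for z :: complex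
  using norm_ge_zero[of z] by (auto simp: norm_power norm_divide intro!: power_le_one divide_le_eq_1[THEN iffD2])

lemma exp_vec_apply: "norm z \<le> \<rho> \<Longrightarrow> exp_vec \<rho> z k = (z / of_real \<rho>) ^ k"
  unfolding exp_vec_def by (subst apply_Bcontfun[where B = 1]) (auto intro: norm_divide_power_le_1)

lemma holomorphic_family_exp_vec:
  assumes "r > 0" "norm c + r \<le> \<rho>"
  shows "holomorphic_family (exp_vec \<rho>) c r 1"
proof
  have le: "norm z \<le> \<rho>" if "z \<in> ball c r" for z
    using that norm_triangle_ineq[of c "z - c"] assms(2) by (simp add: dist_norm norm_minus_commute)
  show "(\<lambda>z. exp_vec \<rho> z k) holomorphic_on ball c r" for k
    by (rule holomorphic_transform[of "\<lambda>z. (z / of_real \<rho>) ^ k"])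
      (use assms norm_ge_zero[of c] in \<open>auto intro!: holomorphic_intros simp: exp_vec_apply le simp del: norm_ge_zero\<close>)
  show "norm (exp_vec \<rho> z) \<le> 1" if "z \<in> ball c r" for z
    by (rule norm_bound) (simp only: exp_vec_apply[OF le[OF that]] norm_divide_power_le_1[OF le[OF that]])
qed fact

text \<open>
  The Taylor coefficients at \<open>0\<close> of the family \<open>k \<mapsto> (z / \<rho>)\<^sup>k\<close> are multiples of the unit
  sequences, which span a dense subspace of the null sequences.
\<close>
lemma null_sequence_mem_if_exp_vec_mem:
  fixes W :: "(nat \<Rightarrow>\<^sub>C complex) set"
  assumes W: "closed W" "cfam.subspace W" and r: "r > 0" "r \<le> \<rho>"
    and mem: "\<And>z. z \<in> ball 0 r \<Longrightarrow> exp_vec \<rho> z \<in> W" and b: "apply_bcontfun b \<longlonglongrightarrow> 0"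
  shows "b \<in> W"
proof -
  interpret holomorphic_family "exp_vec \<rho>" 0 r 1
    using r by (intro holomorphic_family_exp_vec) auto
  have coeff: "coefficient j k = (if k = j then inverse (of_real \<rho>) ^ j else 0)" for j k
  proof -
    have "(deriv ^^ j) (\<lambda>z. exp_vec \<rho> z k) 0 = (deriv ^^ j) (\<lambda>z. inverse (of_real \<rho>) ^ k * (z - 0) ^ k) 0"
    proof (rule higher_deriv_cong_ev)
      have "\<forall>\<^sub>F z in nhds 0. z \<in> ball 0 r"
        using r by (intro eventually_nhds_in_open) auto
      then show "\<forall>\<^sub>F z in nhds 0. exp_vec \<rho> z k = inverse (of_real \<rho>) ^ k * (z - 0) ^ k"
        by eventually_elim (use r in \<open>simp add: exp_vec_apply field_simps\<close>)
    qed simp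
    also have "\<dots> = inverse (of_real \<rho>) ^ k * (deriv ^^ j) (\<lambda>z. (z - 0) ^ k) 0"
      by (rule higher_deriv_cmult[of _ UNIV]) (auto intro!: holomorphic_intros)
    also have "\<dots> = inverse (of_real \<rho>) ^ k * (pochhammer (of_nat (Suc k - j)) j * 0 ^ (k - j))"
      unfolding higher_deriv_power by simp
    also have "\<dots> = (if k = j then inverse (of_real \<rho>) ^ j * fact j else 0)"
      by (cases k j rule: linorder_cases) (auto simp: pochhammer_fact pochhammer_0_left)
    finally show ?thesis
      by (simp add: coefficient_apply taylor_coeff_def)
  qed
  have coeff_mem: "coefficient j \<in> W" for j
  proof (rule coefficient_mem[OF W])
    show "(0 :: complex) islimpt ball 0 r"
      using r by (simp add: islimpt_ball)
  qed (use mem in auto)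
  have "\<exists>y\<in>W. dist y b < e" if e: "e > 0" for e
  proof -
    obtain K where K: "\<And>k. k \<ge> K \<Longrightarrow> norm (b k) < e / 2"
      using LIMSEQ_D[OF b half_gt_zero[OF e]] by auto
    define y where "y = (\<Sum>j<K. cscale (b j * of_real \<rho> ^ j) (coefficient j))"
    have y: "y k = (if k < K then b k else 0)" for k
    proof -
      have "y k = (\<Sum>j<K. b j * of_real \<rho> ^ j * coefficient j k)"
        unfolding y_def by (induction K) (simp_all add: cscale_apply)
      also have "\<dots> = (\<Sum>j<K. if j = k then b k else 0)"
        by (intro sum.cong) (use r in \<open>auto simp: coeff field_simps\<close>)
      finally show ?thesis by simp
    qed
    have "y \<in> W"
      unfolding y_def by (intro cfam.subspace_sum cfam.subspace_scale W coeff_mem)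
    moreover have "dist y b \<le> e / 2"
    proof (rule dist_bound)
      show "dist (y k) (b k) \<le> e / 2" for k
        using K[of k] e by (auto simp: y dist_norm)
    qed
    ultimately show ?thesis
      using e by (intro bexI[of _ y]) auto
  qed
  then show ?thesis
    using closed_approachable[OF W(1)] by blast
qed

text \<open>
  Expanding at \<open>z\<^sub>0\<close> reaches the exponentials near \<open>0\<close>, because \<open>\<rho> > 2|z\<^sub>0|\<close>; expanding these
  at \<open>0\<close> yields the monomials.
\<close>
lemma exponentials_dense:
  assumes \<rho>: "\<rho> > 2 * norm z0" "\<rho> > 0" and acc: "z0 islimpt \<Lambda>"
    and W: "closed W" "cfam.subspace W" "\<And>z. z \<in> \<Lambda> \<Longrightarrow> norm z < \<rho> \<Longrightarrow> exp_vec \<rho> z \<in> W"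
    and b: "apply_bcontfun b \<longlonglongrightarrow> 0"
  shows "b \<in> W"
proof -
  define R where "R = \<rho> - norm z0"
  have R: "R > norm z0" "norm z0 + R \<le> \<rho>"
    using \<rho> by (auto simp: R_def)
  interpret holomorphic_family "exp_vec \<rho>" z0 R 1
    using R norm_ge_zero[of z0] by (intro holomorphic_family_exp_vec) linarith+
  have near: "exp_vec \<rho> z \<in> W" if "z \<in> ball z0 R" for z
  proof (rule mem_closed_subspace[OF W(1,2) acc _ that])
    fix z assume "z \<in> \<Lambda>" "z \<in> ball z0 R"
    then show "exp_vec \<rho> z \<in> W"
      using norm_triangle_ineq[of z0 "z - z0"] R(2)
      by (intro W(3)) (auto simp: dist_norm norm_minus_commute)
  qed
  show ?thesis
  proof (rule null_sequence_mem_if_exp_vec_mem[OF W(1,2) _ _ _ b])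
    show "R - norm z0 > 0" "R - norm z0 \<le> \<rho>"
      using R norm_ge_zero[of z0] by (linarith, linarith)
    show "exp_vec \<rho> z \<in> W" if "z \<in> ball 0 (R - norm z0)" for z
      using that norm_triangle_ineq4[of z0 z] by (intro near) (auto simp: dist_norm)
  qed
qed

section \<open>Eigenvectors of the companion operator\<close>

text \<open>
  The coefficients of the vector with components \<open>l\<^sup>i\<^sup>-\<^sup>1 e\<^bsup>zx\<^esup>\<close>, that is, of the solution
  \<open>e\<^bsup>lt + zx\<^esup>\<close> and its time derivatives at \<open>t = 0\<close>.
\<close>
definition mode_vec :: "real \<Rightarrow> nat \<Rightarrow> complex \<Rightarrow> complex \<Rightarrow> coeff_family" where
  "mode_vec \<rho> n l z = Bcontfun (\<lambda>(i, k). if i \<in> {1..n} then l ^ (i - 1) * (z / of_real \<rho>) ^ k else 0)"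

lemma mode_bound:
  fixes l z :: complex
  assumes "norm z \<le> \<rho>" "norm l \<le> C" "1 \<le> C"
  shows "norm (if i \<in> {1..n} then l ^ (i - 1) * (z / of_real \<rho>) ^ k else 0) \<le> C ^ n"
proof (cases "i \<in> {1..n}")
  case True
  have "norm (l ^ (i - 1)) \<le> C ^ (i - 1)"
    unfolding norm_power using assms(2) by (intro power_mono) auto
  also have "\<dots> \<le> C ^ n"
    using True assms(3) by (intro power_increasing) auto
  finally have "norm (l ^ (i - 1)) * norm ((z / of_real \<rho>) ^ k) \<le> C ^ n * 1"
    using norm_divide_power_le_1[OF assms(1)] assms(3) by (intro mult_mono) auto
  with True show ?thesis
    by (simp only: if_True norm_mult mult_1_right)
next
  case False
  then show ?thesis
    using assms(3) by (simp only: if_False norm_zero) simp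
qed

lemma mode_vec_apply:
  assumes "norm z \<le> \<rho>"
  shows "entry (mode_vec \<rho> n l z) i k = (if i \<in> {1..n} then l ^ (i - 1) * (z / of_real \<rho>) ^ k else 0)"
proof -
  define g where "g = (\<lambda>(i, k). if i \<in> {1..n} then l ^ (i - 1) * (z / of_real \<rho>) ^ k else 0)"
  have "norm (g ik) \<le> (1 + norm l) ^ n" for ik
    unfolding g_def case_prod_beta by (rule mode_bound[OF assms]) auto
  then have "apply_bcontfun (Bcontfun g) = g"
    by (rule apply_Bcontfun)
  then show ?thesis
    by (simp only: mode_vec_def g_def[symmetric]) (simp only: g_def prod.case)
qed

lemma norm_mode_vec_le:
  assumes "norm z \<le> \<rho>" "norm l \<le> C" "1 \<le> C"
  shows "norm (mode_vec \<rho> n l z) \<le> C ^ n"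
proof (rule norm_bound)
  fix ik :: "nat \<times> nat"
  show "norm (mode_vec \<rho> n l z ik) \<le> C ^ n"
    by (cases ik) (simp only: mode_vec_apply[OF assms(1)] mode_bound[OF assms])
qed

lemma mode_vec_null:
  assumes "norm z < \<rho>"
  shows "mode_vec \<rho> n l z \<in> null_families n"
proof -
  have "norm (z / of_real \<rho>) < 1"
    using assms le_less_trans[OF norm_ge_zero assms] by (simp add: norm_divide)
  then have "(\<lambda>k. l ^ (i - 1) * (z / of_real \<rho>) ^ k) \<longlonglongrightarrow> 0" for i
    by (intro tendsto_mult_right_zero LIMSEQ_power_zero)
  then have "(\<lambda>k. if i \<in> {1..n} then l ^ (i - 1) * (z / of_real \<rho>) ^ k else 0) \<longlonglongrightarrow> 0" for i
    by (cases "i \<in> {1..n}") (simp_all only: if_True if_False tendsto_const)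
  then show ?thesis
    unfolding null_families_def mem_Collect_eq mode_vec_apply[OF less_imp_le[OF assms]]
    by (intro conjI allI impI) (simp_all only: if_False)
qed

text \<open>
  The first \<open>n - 1\<close> rows hold by construction; the last one is the equation of the curve.
\<close>
lemma shift_companion_mode_vec:
  assumes z: "norm z \<le> \<rho>" "\<rho> > 0" and n: "n \<ge> 1"
    and curve: "l ^ n = (\<Sum>i=1..n. l ^ (i - 1) * poly (p i) z)"
  shows "shift_companion \<rho> n p (mode_vec \<rho> n l z) = cscale l (mode_vec \<rho> n l z)"
proof (rule bcontfun_eqI)
  fix ik :: "nat \<times> nat"
  obtain i k where ik: "ik = (i, k)" by fastforce
  consider "i \<in> {1..<n}" | "i = n" | "i \<notin> {1..n}" by fastforce
  then show "apply_bcontfun (shift_companion \<rho> n p (mode_vec \<rho> n l z)) ik = cscale l (mode_vec \<rho> n l z) ik"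
  proof cases
    case 1
    then have "l ^ i = l * l ^ (i - 1)"
      by (cases i) auto
    with 1 show ?thesis
      by (simp add: ik shift_companion_apply cscale_apply mode_vec_apply[OF z(1)])
  next
    case 2
    have "(\<Sum>j\<le>degree (p i). coeff (p i) j * of_real \<rho> ^ j * entry (mode_vec \<rho> n l z) i (k + j))
        = (z / of_real \<rho>) ^ k * (l ^ (i - 1) * poly (p i) z)" if "i \<in> {1..n}" for i
      using z(2) that
      by (simp add: mode_vec_apply[OF z(1)] poly_altdef sum_distrib_left power_add power_divide mult.left_commute
          mult.commute cong: sum.cong)
    then have "(\<Sum>i=1..n. \<Sum>j\<le>degree (p i). coeff (p i) j * of_real \<rho> ^ j * entry (mode_vec \<rho> n l z) i (k + j))
        = (z / of_real \<rho>) ^ k * l ^ n"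
      unfolding curve sum_distrib_left by (intro sum.cong refl)
    moreover have "l ^ n = l * l ^ (n - 1)"
      using n by (cases n) auto
    ultimately show ?thesis
      using n by (simp add: ik 2 shift_companion_apply cscale_apply mode_vec_apply[OF z(1)] mult.commute)
  next
    case 3
    then have "i \<notin> {1..<n}" "i \<noteq> n"
      using n by auto
    with 3 show ?thesis
      unfolding ik shift_companion_apply cscale_apply mode_vec_apply[OF z(1)] by (simp only: if_False mult_zero_right)
  qed
qed

lemma eigenvector_family_mode_vec:
  assumes \<rho>: "\<rho> > 0" and n: "n \<ge> 1" and c: "Re c = 0" "r > 0"
    and h: "h holomorphic_on ball c r" "\<And>l. l \<in> ball c r \<Longrightarrow> norm (h l) \<le> \<rho>"
    and curve: "\<And>l. l \<in> ball c r \<Longrightarrow> l ^ n = (\<Sum>i=1..n. l ^ (i - 1) * poly (p i) (h l))"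
  shows "eigenvector_family (shift_companion \<rho> n p) (shift_bound \<rho> n p)
    (\<lambda>l. mode_vec \<rho> n l (h l)) c r ((1 + norm c + r) ^ n)"
proof -
  interpret bounded_operator "shift_companion \<rho> n p" "shift_bound \<rho> n p"
    by (rule bounded_operator_shift_companion)
  show ?thesis
  proof
    fix ik :: "nat \<times> nat"
    obtain i k where ik: "ik = (i, k)" by fastforce
    have "(\<lambda>l. if i \<in> {1..n} then l ^ (i - 1) * (h l / of_real \<rho>) ^ k else 0) holomorphic_on ball c r"
      using \<rho> by (cases "i \<in> {1..n}") (auto intro!: holomorphic_intros h(1))
    then show "(\<lambda>l. mode_vec \<rho> n l (h l) ik) holomorphic_on ball c r"
      by (rule holomorphic_transform) (simp only: ik mode_vec_apply[OF h(2)])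
  next
    fix l assume l: "l \<in> ball c r"
    have "norm l \<le> 1 + norm c + r"
      using l norm_triangle_ineq[of c "l - c"] by (simp add: dist_norm norm_minus_commute)
    then show "norm (mode_vec \<rho> n l (h l)) \<le> (1 + norm c + r) ^ n"
      using c(2) by (intro norm_mode_vec_le h(2) l) auto
    show "shift_companion \<rho> n p (mode_vec \<rho> n l (h l)) = cscale l (mode_vec \<rho> n l (h l))"
      by (rule shift_companion_mode_vec[OF h(2)[OF l] \<rho> n curve[OF l]])
  qed (use c in \<open>auto simp: shift_companion_cscale\<close>)
qed

section \<open>The solution semigroup\<close>

text \<open>
  The partial sums of both exponential series correspond to each other, and the two norms are
  equivalent.
\<close>
lemma exp_semigroup_egf_vec:
  assumes \<rho>: "\<rho> > 0" and n: "n \<ge> 1" and f: "f \<in> null_families n"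
  shows "exp_semigroup (vec_space (herzog_space \<rho>) n) (vec_norm (herzog_norm \<rho>) n) (companion_op n p) t (egf_vec \<rho> f)
    = egf_vec \<rho> (op_exp (shift_companion \<rho> n p) t f)"
proof -
  define L where "L = shift_companion \<rho> n p"
  define S where "S = vec_space (herzog_space \<rho>) n"
  define N where "N = vec_norm (herzog_norm \<rho>) n"
  interpret bounded_operator L "shift_bound \<rho> n p"
    unfolding L_def by (rule bounded_operator_shift_companion)
  interpret Metric_space S "norm_dist S N"
    unfolding S_def N_def by (rule Metric_space_herzog_vec[OF \<rho>])
  have S: "S = egf_vec \<rho> ` null_families n"
    by (simp add: S_def vec_space_eq_image)
  have L_null: "L g \<in> null_families n" if "g \<in> null_families n" for g
    unfolding L_def by (rule shift_companion_null_families[OF that n])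
  have sub: "subspace (null_families n)"
    by (rule subspace_of_complex[OF subspace_null_families])
  have pow_null: "(L ^^ k) f \<in> null_families n" for k
    by (induction k) (simp_all add: f L_null)
  have pow: "(companion_op n p ^^ k) (egf_vec \<rho> f) = egf_vec \<rho> ((L ^^ k) f)" for k
    by (induction k) (simp_all add: L_def companion_op_egf_vec[OF n])
  define P where "P K = (\<Sum>k<K. (t ^ k / fact k) *\<^sub>R (L ^^ k) f)" for K
  have P_null: "P K \<in> null_families n" for K
    unfolding P_def by (intro subspace_sum[OF sub] subspace_scale[OF sub] pow_null)
  have E_null: "op_exp L t f \<in> null_families n"
    by (rule op_exp_mem_closed[OF closed_null_families sub L_null f])
  have partial: "(\<Sum>k<K. fvec_scale (of_real (t ^ k / fact k)) ((companion_op n p ^^ k) (egf_vec \<rho> f))) = egf_vec \<rho> (P K)" for K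
    unfolding P_def egf_vec_sum scaleR_eq_cscale egf_vec_scale pow ..
  have "P \<longlonglongrightarrow> op_exp L t f"
    using op_exp_sums[of t f] by (simp add: sums_def P_def[abs_def])
  then have lim: "(\<lambda>K. real n * norm (P K - op_exp L t f)) \<longlonglongrightarrow> 0"
    by (intro tendsto_mult_right_zero tendsto_norm_zero LIM_zero)
  have "limitin (norm_topology S N) (\<lambda>K. egf_vec \<rho> (P K)) (egf_vec \<rho> (op_exp L t f)) sequentially"
    unfolding limitin_norm_topology[OF Metric_space_axioms]
  proof (intro conjI allI impI)
    show "egf_vec \<rho> (op_exp L t f) \<in> S"
      unfolding S by (rule imageI[OF E_null])
    fix e :: real assume "e > 0"
    with lim have "\<forall>\<^sub>F K in sequentially. real n * norm (P K - op_exp L t f) < e"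
      by (rule order_tendstoD(2))
    then show "\<forall>\<^sub>F K in sequentially. egf_vec \<rho> (P K) \<in> S \<and> N (egf_vec \<rho> (P K) - egf_vec \<rho> (op_exp L t f)) < e"
    proof eventually_elim
      case (elim K)
      have "N (egf_vec \<rho> (P K - op_exp L t f)) \<le> real n * norm (P K - op_exp L t f)"
        unfolding N_def by (rule vec_norm_le_norm[OF cfam.subspace_diff[OF subspace_null_families P_null E_null] \<rho>])
      with elim P_null show ?case
        by (simp add: S egf_vec_diff)
    qed
  qed
  then show ?thesis
    unfolding exp_semigroup_def partial S_def[symmetric] N_def[symmetric] L_def[symmetric]
    by (intro the_equality) (auto intro: limitin_metric_unique simp: norm_topology_def)
qed

text \<open>
  Stated for an arbitrary invariant subspace \<open>Z\<close>, as it serves both for \<open>X\<^sup>n\<close> and for the space \<open>Y\<close>.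
\<close>
lemma C0_semigroup_egf_vec:
  assumes \<rho>: "\<rho> > 0" and L: "bounded_operator L M" "\<And>a f. L (cscale a f) = cscale a (L f)"
    and Z: "cfam.subspace Z" "Z \<subseteq> null_families n" "\<And>t f. f \<in> Z \<Longrightarrow> op_exp L t f \<in> Z"
    and T: "\<And>t f. f \<in> Z \<Longrightarrow> T t (egf_vec \<rho> f) = egf_vec \<rho> (op_exp L t f)"
  shows "C0_semigroup (egf_vec \<rho> ` Z) (vec_norm (herzog_norm \<rho>) n) T"
proof -
  interpret bounded_operator L M by fact
  define N where "N = vec_norm (herzog_norm \<rho>) n"
  have le: "N (egf_vec \<rho> f) \<le> n * norm f" "norm f \<le> N (egf_vec \<rho> f)" if "f \<in> Z" for f
    using that Z(2) \<rho> by (auto simp: N_def intro!: vec_norm_le_norm norm_le_vec_norm)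
  have ms: "Metric_space (egf_vec \<rho> ` Z) (norm_dist (egf_vec \<rho> ` Z) N)"
    unfolding N_def
    by (rule Metric_space_norm_dist_subset[OF Metric_space_herzog_vec[OF \<rho>]])
      (use Z(2) in \<open>auto simp: vec_space_eq_image\<close>)
  have bound: "N (egf_vec \<rho> (op_exp L t f)) \<le> n * exp (\<bar>t\<bar> * M) * N (egf_vec \<rho> f)" if f: "f \<in> Z" for t f
  proof -
    have "N (egf_vec \<rho> (op_exp L t f)) \<le> n * norm (op_exp L t f)"
      by (rule le(1)[OF Z(3)[OF f]])
    also have "\<dots> \<le> n * (exp (\<bar>t\<bar> * M) * N (egf_vec \<rho> f))"
      by (intro mult_left_mono order_trans[OF norm_op_exp_le] le(2) f) auto
    finally show ?thesis by (simp add: mult.assoc)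
  qed
  have cont: "limitin (norm_topology (egf_vec \<rho> ` Z) N) (\<lambda>t. T t (egf_vec \<rho> f)) (egf_vec \<rho> f) (at_right 0)"
    if f: "f \<in> Z" for f
    unfolding limitin_norm_topology[OF ms]
  proof (intro conjI allI impI)
    fix e :: real assume "e > 0"
    have "((\<lambda>t. op_exp L t f) \<longlongrightarrow> f) (at_right 0)"
      using op_exp_tendsto_0 by (rule tendsto_within_subset) simp
    then have "((\<lambda>t. real n * norm (op_exp L t f - f)) \<longlongrightarrow> 0) (at_right 0)"
      by (intro tendsto_mult_right_zero tendsto_norm_zero LIM_zero)
    from order_tendstoD(2)[OF this \<open>e > 0\<close>]
    show "\<forall>\<^sub>F t in at_right 0. T t (egf_vec \<rho> f) \<in> egf_vec \<rho> ` Z \<and> N (T t (egf_vec \<rho> f) - egf_vec \<rho> f) < e"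
    proof eventually_elim
      case (elim t)
      have "N (egf_vec \<rho> (op_exp L t f - f)) \<le> real n * norm (op_exp L t f - f)"
        by (rule le(1)[OF cfam.subspace_diff[OF Z(1) Z(3)[OF f] f]])
      with elim Z(3)[OF f] show ?case
        by (simp add: T[OF f] egf_vec_diff)
    qed
  qed (use f in simp)
  show ?thesis
    unfolding C0_semigroup_def N_def[symmetric]
  proof (intro conjI allI impI ballI)
    fix t :: real and U V
    assume U: "U \<in> egf_vec \<rho> ` Z"
    then obtain f where f: "f \<in> Z" "U = egf_vec \<rho> f" by blast
    show "T t U \<in> egf_vec \<rho> ` Z"
      using f Z(3) by (simp add: T)
    show "T t (fvec_scale c U) = fvec_scale c (T t U)" for c
      using f cfam.subspace_scale[OF Z(1)]
      by (simp add: T op_exp_cscale[OF L] flip: egf_vec_scale)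
    assume V: "V \<in> egf_vec \<rho> ` Z"
    then obtain g where g: "g \<in> Z" "V = egf_vec \<rho> g" by blast
    show "T t (U + V) = T t U + T t V"
      using f g cfam.subspace_add[OF Z(1)]
      by (simp add: T linear_simps(1)[OF bounded_linear_op_exp] flip: egf_vec_add)
  next
    fix t :: real
    show "\<exists>C. \<forall>U\<in>egf_vec \<rho> ` Z. N (T t U) \<le> C * N U"
      by (intro exI[of _ "n * exp (\<bar>t\<bar> * M)"]) (auto simp: T intro: bound)
  next
    fix U assume "U \<in> egf_vec \<rho> ` Z"
    then show "T 0 U = U"
      by (auto simp: T)
  next
    fix s t :: real and U assume "U \<in> egf_vec \<rho> ` Z"
    then show "T (s + t) U = T s (T t U)"
      using Z(3) by (auto simp: T op_exp_add)
  next
    fix U assume "U \<in> egf_vec \<rho> ` Z"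
    then show "limitin (norm_topology (egf_vec \<rho> ` Z) N) (\<lambda>t. T t U) U (at_right 0)"
      using cont by blast
  qed
qed

section \<open>Chaos of the projection family\<close>

lemma egf_diff:
  assumes "\<And>k. norm (a k) \<le> B" "\<And>k. norm (b k) \<le> B'"
  shows "egf \<rho> a x - egf \<rho> b x = egf \<rho> (\<lambda>k. a k - b k) x"
  using sums_unique[OF sums_diff[OF egf_sums[of a, OF assms(1)] egf_sums[of b, OF assms(2)]], of \<rho> x \<rho> x]
  by (simp only: egf_def left_diff_distrib)

text \<open>
  The set of sequences approximated by the row \<open>i\<close> of elements of \<open>Y\<close> is the closure of a
  projection of \<open>Y\<close>; as a closed subspace it is subject to the identity theorem.
\<close>
lemma closed_subspace_row_approximable:
  fixes i :: nat
  assumes "cfam.subspace Y"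
  defines "W \<equiv> {b :: nat \<Rightarrow>\<^sub>C complex. \<forall>e>0. \<exists>g\<in>Y. \<forall>k. norm (entry g i k - apply_bcontfun b k) \<le> e}"
  shows "closed W" "cfam.subspace W"
proof -
  have "b \<in> W" if b: "b \<in> closure W" for b
    unfolding W_def
  proof (intro CollectI allI impI)
    fix e :: real assume e: "e > 0"
    obtain b' where b': "b' \<in> W" "dist b' b < e / 2"
      using closure_approachableD[OF b half_gt_zero[OF e]] by (metis dist_commute)
    obtain g where g: "g \<in> Y" "\<And>k. norm (entry g i k - b' k) \<le> e / 2"
      using b'(1) half_gt_zero[OF e] unfolding W_def by blast
    have "norm (entry g i k - b k) \<le> e" for k
      using norm_triangle_ineq[of "entry g i k - b' k" "b' k - b k"] g(2)[of k] b'(2)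
        dist_bounded[of b' k b] by (simp add: dist_norm)
    with g(1) show "\<exists>g\<in>Y. \<forall>k. norm (entry g i k - b k) \<le> e" by blast
  qed
  then show "closed W"
    using closure_subset_eq by blast
  show "cfam.subspace W"
  proof (rule cfam.subspaceI)
    show "0 \<in> W"
      unfolding W_def using cfam.subspace_0[OF assms(1)] by (auto intro!: bexI[of _ 0])
  next
    fix b b' assume b: "b \<in> W" "b' \<in> W"
    show "b + b' \<in> W"
      unfolding W_def
    proof (intro CollectI allI impI)
      fix e :: real assume e: "e > 0"
      obtain g where g: "g \<in> Y" "\<And>k. norm (entry g i k - b k) \<le> e / 2"
        using b(1) half_gt_zero[OF e] unfolding W_def by blast
      obtain g' where g': "g' \<in> Y" "\<And>k. norm (entry g' i k - b' k) \<le> e / 2"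
        using b(2) half_gt_zero[OF e] unfolding W_def by blast
      have "norm (entry (g + g') i k - (b + b') k) \<le> e" for k
        using norm_triangle_ineq[of "entry g i k - b k" "entry g' i k - b' k"] g(2)[of k] g'(2)[of k]
        by (simp add: algebra_simps)
      then show "\<exists>g\<in>Y. \<forall>k. norm (entry g i k - (b + b') k) \<le> e"
        using cfam.subspace_add[OF assms(1) g(1) g'(1)] by blast
    qed
  next
    fix c b assume b: "b \<in> W"
    show "cscale c b \<in> W"
      unfolding W_def
    proof (intro CollectI allI impI)
      fix e :: real assume e: "e > 0"
      have c: "norm c + 1 > 0"
        using norm_ge_zero[of c] by linarith
      then have "e / (norm c + 1) > 0"
        using e by simp
      then obtain g where g: "g \<in> Y" "\<And>k. norm (entry g i k - b k) \<le> e / (norm c + 1)"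
        using b unfolding W_def by blast
      have "norm (entry (cscale c g) i k - cscale c b k) \<le> e" for k
      proof -
        have "norm (entry (cscale c g) i k - cscale c b k) = norm c * norm (entry g i k - b k)"
          by (simp add: cscale_apply norm_mult flip: right_diff_distrib)
        also have "\<dots> \<le> (norm c + 1) * (e / (norm c + 1))"
          using g(2)[of k] e c by (intro mult_mono) auto
        finally show ?thesis using c by simp
      qed
      then show "\<exists>g\<in>Y. \<forall>k. norm (entry g i k - cscale c b k) \<le> e"
        using cfam.subspace_scale[OF assms(1) g(1)] by blast
    qed
  qed
qed

lemma closure_projection_eq:
  assumes \<rho>: "\<rho> > 0" and Y: "Y \<subseteq> null_families n"
    and approx: "\<And>b e. apply_bcontfun b \<longlonglongrightarrow> 0 \<Longrightarrow> e > 0 \<Longrightarrow> \<exists>g\<in>Y. \<forall>k. norm (entry g 1 k - apply_bcontfun b k) \<le> e"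
  shows "norm_topology (herzog_space \<rho>) (herzog_norm \<rho>) closure_of ((\<lambda>U. U 1) ` egf_vec \<rho> ` Y) = herzog_space \<rho>"
proof (rule closure_of_norm_topology_eqI[OF Metric_space_herzog[OF \<rho>]])
  have null: "entry g i \<longlonglongrightarrow> 0" if "g \<in> Y" for g i
    using that Y by (auto simp: null_families_def)
  then show "(\<lambda>U. U 1) ` egf_vec \<rho> ` Y \<subseteq> herzog_space \<rho>"
    by (auto simp: egf_vec_def egf_mem_herzog_space)
  fix f and e :: real assume f: "f \<in> herzog_space \<rho>" and e: "e > 0"
  obtain a where a: "herzog_series \<rho> f a"
    using f by (auto simp: herzog_space_def)
  then have f_eq: "f = egf \<rho> a" and lim: "a \<longlonglongrightarrow> 0"
    by (auto intro: herzog_series_imp_egf simp: herzog_series_def)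
  obtain B where B: "\<And>k. norm (a k) \<le> B"
    using convergent_imp_Bseq[OF convergentI[OF lim]] by (auto simp: Bseq_def)
  have Ba: "apply_bcontfun (Bcontfun a) = a"
    by (rule apply_Bcontfun[OF B])
  obtain g where g: "g \<in> Y" "\<And>k. norm (entry g 1 k - a k) \<le> e / 2"
    using approx[of "Bcontfun a", unfolded Ba, OF lim half_gt_zero[OF e]] by blast
  have "herzog_norm \<rho> (egf \<rho> (\<lambda>k. a k - entry g 1 k)) \<le> e / 2"
  proof (rule herzog_norm_le[OF _ \<rho>])
    show "(\<lambda>k. a k - entry g 1 k) \<longlonglongrightarrow> 0"
      using tendsto_diff[OF lim null[OF g(1), of 1]] by simp
    show "norm (a k - entry g 1 k) \<le> e / 2" for k
      using g(2)[of k] by (simp add: norm_minus_commute)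
  qed
  moreover have "f - egf_vec \<rho> g 1 = egf \<rho> (\<lambda>k. a k - entry g 1 k)"
    unfolding f_eq egf_vec_def by (intro ext) (simp only: minus_apply egf_diff[of a B "entry g 1" "norm g", OF B norm_bounded])
  ultimately have "herzog_norm \<rho> (f - egf_vec \<rho> g 1) < e"
    using e by simp
  with g(1) show "\<exists>y\<in>(\<lambda>U. U 1) ` egf_vec \<rho> ` Y. herzog_norm \<rho> (f - y) < e"
    by blast
qed

lemma closedin_egf_vec_image:
  assumes \<rho>: "\<rho> > 0" and Z: "closed Z" "Z \<subseteq> null_families n"
  shows "closedin (norm_topology (vec_space (herzog_space \<rho>) n) (vec_norm (herzog_norm \<rho>) n)) (egf_vec \<rho> ` Z)"
proof -
  define S where "S = vec_space (herzog_space \<rho>) n"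
  define N where "N = vec_norm (herzog_norm \<rho>) n"
  interpret Metric_space S "norm_dist S N"
    unfolding S_def N_def by (rule Metric_space_herzog_vec[OF \<rho>])
  have S: "S = egf_vec \<rho> ` null_families n"
    by (simp add: S_def vec_space_eq_image)
  have "\<exists>r>0. disjnt (egf_vec \<rho> ` Z) (mball x r)" if x: "x \<in> S - egf_vec \<rho> ` Z" for x
  proof -
    obtain f where f: "f \<in> null_families n" "x = egf_vec \<rho> f" "f \<notin> Z"
      using x unfolding S by blast
    then obtain r where r: "r > 0" "\<And>g. g \<in> Z \<Longrightarrow> r \<le> dist g f"
      using closed_approachable[OF Z(1), of f] by (meson not_le)
    have "egf_vec \<rho> g \<notin> mball x r" if g: "g \<in> Z" for g
    proof -
      have "dist g f \<le> N (egf_vec \<rho> (f - g))"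
        using norm_le_vec_norm[OF cfam.subspace_diff[OF subspace_null_families f(1) subsetD[OF Z(2) g]] \<rho>]
        by (simp add: N_def dist_norm norm_minus_commute)
      then have "\<not> N (x - egf_vec \<rho> g) < r"
        using r(2)[OF g] by (simp add: f(2) egf_vec_diff)
      moreover have "x \<in> S" "egf_vec \<rho> g \<in> S"
        using f g Z(2) by (auto simp: S)
      ultimately show ?thesis
        by (simp add: in_mball norm_dist_def)
    qed
    then show ?thesis
      using r(1) by (auto simp: disjnt_iff)
  qed
  then have "closedin mtopology (egf_vec \<rho> ` Z)"
    unfolding closedin_metric using Z(2) by (auto simp: S)
  then show ?thesis
    by (simp add: norm_topology_def S_def N_def)
qed

lemma devaney_chaotic_egf_vec:
  assumes \<rho>: "\<rho> > 0" and E: "eigenvector_family L M F c r B"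
    and Y: "Y = eigenvector_family.eigenspace F c r" "Y \<subseteq> null_families n"
    and T: "\<And>t f. f \<in> Y \<Longrightarrow> T t (egf_vec \<rho> f) = egf_vec \<rho> (op_exp L t f)"
  shows "devaney_chaotic (egf_vec \<rho> ` Y) (vec_norm (herzog_norm \<rho>) n) T"
proof -
  interpret eigenvector_family L M F c r B by fact
  define N where "N = vec_norm (herzog_norm \<rho>) n"
  have ms: "Metric_space (egf_vec \<rho> ` Y) (norm_dist (egf_vec \<rho> ` Y) N)"
    unfolding N_def
    by (rule Metric_space_norm_dist_subset[OF Metric_space_herzog_vec[OF \<rho>]])
      (use Y(2) in \<open>auto simp: vec_space_eq_image\<close>)
  have sub: "cfam.subspace Y"
    unfolding Y(1) by (rule subspace_eigenspace)
  have mem: "op_exp L t f \<in> Y" if "f \<in> Y" for t f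
    using that unfolding Y(1) by (rule op_exp_mem_eigenspace)
  have near: "N (egf_vec \<rho> f - egf_vec \<rho> g) < e"
    if "f \<in> Y" "g \<in> Y" "dist g f < e / (real n + 1)" for f g e
  proof -
    have "N (egf_vec \<rho> (f - g)) \<le> n * norm (f - g)"
      unfolding N_def by (rule vec_norm_le_norm[OF cfam.subspace_diff[OF subspace_null_families]])
        (use that Y(2) \<rho> in auto)
    also have "\<dots> \<le> (real n + 1) * dist g f"
      by (intro mult_mono) (auto simp: dist_norm norm_minus_commute)
    also have "\<dots> < e"
      using that(3) by (simp add: field_simps)
    finally show ?thesis by (simp add: egf_vec_diff)
  qed
  have C0: "C0_semigroup (egf_vec \<rho> ` Y) N T"
    unfolding N_def
    by (rule C0_semigroup_egf_vec[OF \<rho> bounded_operator_axioms complex_linear sub Y(2) mem T])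
  obtain x where x: "x \<in> Y" "\<And>y e. y \<in> Y \<Longrightarrow> e > 0 \<Longrightarrow> \<exists>t\<ge>0. dist (op_exp L t x) y < e"
    using dense_orbit unfolding Y(1) by blast
  have "norm_topology (egf_vec \<rho> ` Y) N closure_of {T t (egf_vec \<rho> x) |t. t \<ge> 0} = egf_vec \<rho> ` Y"
  proof (rule closure_of_norm_topology_eqI[OF ms])
    show "{T t (egf_vec \<rho> x) |t. t \<ge> 0} \<subseteq> egf_vec \<rho> ` Y"
      using x(1) mem by (auto simp: T)
    fix U and e :: real assume "U \<in> egf_vec \<rho> ` Y" and e: "e > 0"
    then obtain y where y: "y \<in> Y" "U = egf_vec \<rho> y" by blast
    have "e / (real n + 1) > 0" using e by simp
    from x(2)[OF y(1) this] obtain t where "t \<ge> 0" "dist (op_exp L t x) y < e / (real n + 1)" by blast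
    with near[OF y(1) mem[OF x(1)]] y(2) x(1)
    show "\<exists>V\<in>{T t (egf_vec \<rho> x) |t. t \<ge> 0}. N (U - V) < e"
      by (auto simp: T)
  qed
  moreover have "norm_topology (egf_vec \<rho> ` Y) N closure_of {U \<in> egf_vec \<rho> ` Y. \<exists>t>0. T t U = U} = egf_vec \<rho> ` Y"
  proof (rule closure_of_norm_topology_eqI[OF ms])
    fix U and e :: real assume "U \<in> egf_vec \<rho> ` Y" and e: "e > 0"
    then obtain y where y: "y \<in> Y" "U = egf_vec \<rho> y" by blast
    have "e / (real n + 1) > 0" using e by simp
    from periodic_dense[OF y(1)[unfolded Y(1)] this] obtain z t
      where z: "z \<in> Y" "dist z y < e / (real n + 1)" and t: "t > 0" "op_exp L t z = z"
      unfolding Y(1) by blast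
    have "T t (egf_vec \<rho> z) = egf_vec \<rho> z"
      by (simp add: T[OF z(1)] t(2))
    with near[OF y(1) z] z(1) t(1) y(2)
    show "\<exists>V\<in>{U \<in> egf_vec \<rho> ` Y. \<exists>t>0. T t U = U}. N (U - V) < e"
      by blast
  qed auto
  ultimately show ?thesis
    unfolding devaney_chaotic_def N_def[symmetric] using C0 x(1) by blast
qed

text \<open>
  A branch with constant value near \<open>c\<close> would put infinitely many points of the curve over one
  \<open>z\<close>.
\<close>
lemma branch_value_islimpt:
  assumes h: "h holomorphic_on ball c r" "r > 0"
    and curve: "\<And>l. l \<in> ball c r \<Longrightarrow> l ^ n = (\<Sum>i=1..n. l ^ (i - 1) * poly (p i) (h l))"
  shows "h c islimpt h ` ball c r"
  unfolding islimpt_approachable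
proof (intro allI impI)
  fix e :: real assume "e > 0"
  have "continuous (at c) h"
    using holomorphic_on_imp_continuous_on[OF h(1)] h(2) by (simp add: continuous_on_eq_continuous_at)
  then obtain d where d: "d > 0" "\<And>l. dist l c < d \<Longrightarrow> dist (h l) (h c) < e"
    using \<open>e > 0\<close> unfolding continuous_at_eps_delta by blast
  have "\<exists>l\<in>ball c (min d r). h l \<noteq> h c"
  proof (rule ccontr)
    assume "\<not> ?thesis"
    then have "ball c (min d r) \<subseteq> {l. l ^ n = (\<Sum>i=1..n. l ^ (i - 1) * poly (p i) (h c))}"
      using curve by fastforce
    then have "finite (ball c (min d r))"
      using finite_char_fibre finite_subset by blast
    then show False
      using uncountable_ball[of "min d r" c] d(1) h(2) countable_finite by auto
  qed
  then show "\<exists>z\<in>h ` ball c r. z \<noteq> h c \<and> dist z (h c) < e"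
    using d(2) by (auto simp: dist_commute)
qed

theorem corollary4p10:
  fixes n m :: nat and a :: "nat \<Rightarrow> nat \<Rightarrow> complex"
  assumes "n \<ge> 1" and "m \<ge> 1"
    and "\<exists>i\<in>{1..n}. degree (symbol_poly a m i) > 0"
  shows "\<exists>\<rho>\<^sub>0>0. \<forall>\<rho>>\<rho>\<^sub>0.
    projection_family_chaotic (herzog_space \<rho>) (herzog_norm \<rho>) n (solution_semigroup \<rho> n m a)"
proof -
  define p where "p = symbol_poly a m"
  obtain c R h where c: "Re c = 0" and R: "R > 0" and hR: "h holomorphic_on ball c R"
    and curveR: "\<And>l. l \<in> ball c R \<Longrightarrow> l ^ n = (\<Sum>i=1..n. l ^ (i - 1) * poly (p i) (h l))"
    using characteristic_branch[of n p] assms(3) unfolding p_def by blast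
  show ?thesis
  \<comment> \<open>Twice the norm is what the density of the exponentials requires; adding \<open>1\<close> makes the bound positive.\<close>
  proof (rule exI[of _ "2 * norm (h c) + 1"], intro conjI allI impI)
    show "2 * norm (h c) + 1 > 0"
      by (simp add: add_nonneg_pos)
    fix \<rho> assume \<rho>1: "\<rho> > 2 * norm (h c) + 1"
    then have \<rho>: "\<rho> > 0" "\<rho> > 2 * norm (h c)" "\<rho> > norm (h c)"
      using norm_ge_zero[of "h c"] by linarith+
    have "continuous (at c) h"
      using holomorphic_on_imp_continuous_on[OF hR] R by (simp add: continuous_on_eq_continuous_at)
    then obtain d where d: "d > 0" "\<And>l. dist l c < d \<Longrightarrow> dist (h l) (h c) < \<rho> - norm (h c)"
      using \<rho>(3) unfolding continuous_at_eps_delta by (meson diff_gt_0_iff_gt)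
    \<comment> \<open>On the smaller disc the exponentials belong to the Herzog space for \<open>\<rho>\<close>.\<close>
    define r where "r = min R d"
    have r: "r > 0" and sub: "ball c r \<subseteq> ball c R"
      using R d(1) by (auto simp: r_def)
    have h: "h holomorphic_on ball c r"
      using hR sub by (rule holomorphic_on_subset)
    have curve: "l ^ n = (\<Sum>i=1..n. l ^ (i - 1) * poly (p i) (h l))" if "l \<in> ball c r" for l
      using that sub curveR by blast
    have small: "norm (h l) < \<rho>" if "l \<in> ball c r" for l
      using d(2)[of l] that norm_triangle_ineq[of "h c" "h l - h c"] by (simp add: r_def dist_norm norm_minus_commute)
    define L where "L = shift_companion \<rho> n p"
    define F where "F l = mode_vec \<rho> n l (h l)" for l
    have E: "eigenvector_family L (shift_bound \<rho> n p) F c r ((1 + norm c + r) ^ n)"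
      unfolding L_def F_def[abs_def]
      by (rule eigenvector_family_mode_vec[OF \<rho>(1) assms(1) c r h less_imp_le[OF small] curve])
    interpret E: eigenvector_family L "shift_bound \<rho> n p" F c r "(1 + norm c + r) ^ n"
      by (rule E)
    define Y where "Y = E.eigenspace"
    have F_mem: "F l \<in> Y" if "l \<in> ball c r" for l
      using E.span_subset_eigenspace[OF order_refl] cfam.span_base[of "F l" "F ` ball c r"] that
      unfolding Y_def by blast
    have Y_null: "Y \<subseteq> null_families n"
      unfolding Y_def E.eigenspace_def
      by (intro closure_minimal cfam.span_minimal closed_null_families subspace_null_families)
        (auto simp: F_def intro!: mode_vec_null small)
    have Y_sub: "cfam.subspace Y"
      unfolding Y_def by (rule E.subspace_eigenspace)
    define T where "T = solution_semigroup \<rho> n m a"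
    have T: "T t (egf_vec \<rho> f) = egf_vec \<rho> (op_exp L t f)" if "f \<in> null_families n" for t f
      unfolding T_def solution_semigroup_def L_def p_def
      by (rule exp_semigroup_egf_vec[OF \<rho>(1) assms(1) that])
    have null_inv: "op_exp L t f \<in> null_families n" if "f \<in> null_families n" for t f
      by (rule E.op_exp_mem_closed[OF closed_null_families subspace_of_complex[OF subspace_null_families] _ that])
        (unfold L_def, rule shift_companion_null_families[OF _ assms(1)])
    have entry_F: "entry (F l) 1 k = exp_vec \<rho> (h l) k" if "l \<in> ball c r" for l k
      using assms(1) less_imp_le[OF small[OF that]] by (simp add: F_def mode_vec_apply exp_vec_apply)
    have "projection_family_chaotic (herzog_space \<rho>) (herzog_norm \<rho>) n T"
      unfolding projection_family_chaotic_def
    proof (intro conjI exI[of _ "egf_vec \<rho> ` Y"])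
      show "C0_semigroup (vec_space (herzog_space \<rho>) n) (vec_norm (herzog_norm \<rho>) n) T"
        unfolding vec_space_eq_image
        by (rule C0_semigroup_egf_vec[OF \<rho>(1) E.bounded_operator_axioms E.complex_linear
              subspace_null_families order_refl null_inv T])
      show "egf_vec \<rho> ` Y \<subseteq> vec_space (herzog_space \<rho>) n"
        unfolding vec_space_eq_image by (rule image_mono[OF Y_null])
      show "fvec.subspace (egf_vec \<rho> ` Y)"
      proof (rule fvec.subspaceI)
        show "0 \<in> egf_vec \<rho> ` Y"
          using cfam.subspace_0[OF Y_sub] by (force intro: image_eqI[of _ _ 0])
        show "U + V \<in> egf_vec \<rho> ` Y" if "U \<in> egf_vec \<rho> ` Y" "V \<in> egf_vec \<rho> ` Y" for U V
          using that cfam.subspace_add[OF Y_sub] by (auto simp flip: egf_vec_add)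
        show "fvec_scale b U \<in> egf_vec \<rho> ` Y" if "U \<in> egf_vec \<rho> ` Y" for b U
          using that cfam.subspace_scale[OF Y_sub] by (auto simp flip: egf_vec_scale)
      qed
      show "closedin (norm_topology (vec_space (herzog_space \<rho>) n) (vec_norm (herzog_norm \<rho>) n)) (egf_vec \<rho> ` Y)"
        by (rule closedin_egf_vec_image[OF \<rho>(1) _ Y_null]) (simp add: Y_def E.closed_eigenspace)
      show "egf_vec \<rho> ` Y \<noteq> {0}"
      proof
        assume "egf_vec \<rho> ` Y = {0}"
        moreover have "F c \<in> Y"
          using r by (intro F_mem) simp
        ultimately have "egf_vec \<rho> (F c) = egf_vec \<rho> 0"
          by auto
        then have "egf_vec \<rho> (F c - 0) = 0"
          by (simp add: egf_vec_diff)
        then have "norm (F c) \<le> vec_norm (herzog_norm \<rho>) n 0"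
          using norm_le_vec_norm[OF subsetD[OF Y_null \<open>F c \<in> Y\<close>] \<rho>(1)] by simp
        also have "\<dots> = 0"
          using herzog_norm_eq_0[OF herzog_space_0 \<rho>(1)] by (simp add: vec_norm_def)
        finally have "entry (F c) 1 0 = 0"
          by simp
        then show False
          using entry_F[of c 0] r less_imp_le[OF small[of c]] by (simp add: exp_vec_apply)
      qed
      show "\<forall>t\<ge>0. \<forall>U\<in>egf_vec \<rho> ` Y. T t U \<in> egf_vec \<rho> ` Y"
        using T Y_null E.op_exp_mem_eigenspace by (auto simp: Y_def subset_iff)
      show "devaney_chaotic (egf_vec \<rho> ` Y) (vec_norm (herzog_norm \<rho>) n) T"
        using T Y_null by (intro devaney_chaotic_egf_vec[OF \<rho>(1) E Y_def Y_null]) auto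
      show "norm_topology (herzog_space \<rho>) (herzog_norm \<rho>) closure_of ((\<lambda>U. U 1) ` egf_vec \<rho> ` Y) = herzog_space \<rho>"
      proof (rule closure_projection_eq[OF \<rho>(1) Y_null])
        fix b :: "nat \<Rightarrow>\<^sub>C complex" and e :: real
        assume b: "apply_bcontfun b \<longlonglongrightarrow> 0" and e: "e > 0"
        define W where "W = {b :: nat \<Rightarrow>\<^sub>C complex. \<forall>e>0. \<exists>g\<in>Y. \<forall>k. norm (entry g 1 k - apply_bcontfun b k) \<le> e}"
        have W: "closed W" "cfam.subspace W"
          unfolding W_def by (rule closed_subspace_row_approximable[OF Y_sub])+
        have "b \<in> W"
        proof (rule exponentials_dense[OF \<rho>(2,1) branch_value_islimpt[OF h r curve] W _ b])
          fix z assume "z \<in> h ` ball c r"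
          then obtain l where l: "l \<in> ball c r" "z = h l" by blast
          show "exp_vec \<rho> z \<in> W"
            unfolding W_def l(2) mem_Collect_eq
            by (intro allI impI bexI[OF _ F_mem[OF l(1)]]) (simp only: entry_F[OF l(1)] diff_self norm_zero)
        qed
        with e show "\<exists>g\<in>Y. \<forall>k. norm (entry g 1 k - apply_bcontfun b k) \<le> e"
          by (simp add: W_def)
      qed
    qed
    then show "projection_family_chaotic (herzog_space \<rho>) (herzog_norm \<rho>) n (solution_semigroup \<rho> n m a)"
      by (simp add: T_def)
  qed
qed

end
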